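(* Let $0<p<\infty$ and let $\mathcal Z=\{z_n\}$ be a sequence of pairwise distinct points in $\mathbb D$. Then $\mathcal Z$ is an interpolating sequence if and only if there exists a Carleson measure $\mu$, supported precisely on $\mathcal Z$, such that the embedding operator $j_p(\mu):H^p\hookrightarrow L^p(\mu)$ has closed range in $L^p(\mu)$.
   Context: $\mathbb D=\{z\in\mathbb C:|z|<1\}$, $\mathbb T=\partial\mathbb D$, and $m$ is normalized arc length measure on $\mathbb T$. For $0<p<\infty$, the Hardy space $H^p$ is the set of holomorphic $f$ on $\mathbb D$ with $\|f\|_{H^p}=\sup_{0<r<1}\left(\int_{\mathbb T}|f(r\zeta)|^p\,dm(\zeta)\right)^{1/p}<\infty$ (a quasinorm when $p<1$); $H^\infty$ is the space of bounded holomorphic functions on $\mathbb D$. For a positive Borel measure $\mu$ on $\mathbb D$ and $0<p<\infty$, $L^p(\mu)=L^p(\mathbb D,\mu)$ is the usual (quasi-)normed Lebesgue space of complex-valued Borel measurable functions on $\mathbb D$. A Carleson measure is a positive Borel measure $\mu$ on $\mathbb D$ such that $H^p\subset L^p(\mu)$ for some (equivalently, by Carleson's theorem, every) $p\in(0,\infty)$. For such $\mu$, $j_p(\mu):H^p\to L^p(\mu)$ is the (automatically continuous) linear operator sending $f\in H^p$ to its restriction to the support of $\mu$, i.e. to $f$ viewed as an element of $L^p(\mu)$. "$\mu$ is supported precisely on $\mathcal Z$" means that $\mu$ lives on $\mathcal Z$ (i.e. $\mu(\mathbb D\setminus\mathcal Z)=0$) and assigns positive mass to every point of $\mathcal Z$.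 Sequences are infinite. A sequence $\{z_n\}$ of pairwise distinct points in $\mathbb D$ is an interpolating (or $H^\infty$-interpolating) sequence if $\{\,\{f(z_n)\}:f\in H^\infty\}=\ell^\infty$. *)

theory Defs
  imports "HOL-Complex_Analysis.Complex_Analysis"
begin

definition circle_measure :: "complex measure" where
  "circle_measure = distr (uniform_measure lborel {0..2*pi})
     (restrict_space borel (sphere 0 1)) cis"

definition hardy_mean :: "real \<Rightarrow> (complex \<Rightarrow> complex) \<Rightarrow> real \<Rightarrow> real" where
  "hardy_mean p f r =
     (LINT \<zeta>|circle_measure. norm (f (of_real r * \<zeta>)) powr p) powr (1 / p)"

text \<open>Functions on the disc are total functions on \<^typ>\<open>complex\<close>; their values off
  \<^term>\<open>ball 0 1\<close> are irrelevant.  This is why the measure has the circle, not the plane, as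
  its space: otherwise the values of \<open>f\<close> off the disc could destroy measurability of the
  integrand in \<^const>\<open>hardy_mean\<close>, and a Bochner integral of a non-integrable function is 0.
  The next lemmas show that this does not occur.\<close>

lemma cis_measurable_circle:
  "cis \<in> measurable (uniform_measure lborel {0..2*pi}) (restrict_space borel (sphere 0 1))"
proof (rule measurable_restrict_space2)
  have "cis \<in> borel_measurable borel"
    by (intro borel_measurable_continuous_onI continuous_intros)
  then show "cis \<in> borel_measurable (uniform_measure lborel {0..2*pi})"
    by (simp add: measurable_def)
qed auto

lemma prob_circle_measure: "emeasure circle_measure (sphere 0 1) = 1"
proof -
  have "emeasure circle_measure (sphere 0 1) =
      emeasure (uniform_measure lborel {0..2*pi}) (cis -` sphere 0 1 \<inter> UNIV)"
    unfolding circle_measure_def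
    by (subst emeasure_distr[OF cis_measurable_circle]) (auto simp: sets_restrict_space)
  also have "cis -` sphere 0 1 \<inter> UNIV = UNIV" by auto
  also have "emeasure (uniform_measure lborel {0..2*pi}) UNIV = 1"
    by (simp add: divide_ennreal ennreal_1[symmetric] del: ennreal_1)
  finally show ?thesis .
qed

lemma integrable_hardy_mean:
  assumes "f holomorphic_on ball 0 1" "0 < p" "0 < r" "r < 1"
  shows "integrable circle_measure (\<lambda>\<zeta>. norm (f (of_real r * \<zeta>)) powr p)"
proof -
  have sp: "space circle_measure = sphere 0 1"
    by (simp add: circle_measure_def space_restrict_space)
  have *: "continuous_on (sphere 0 1) (\<lambda>\<zeta>. f (of_real r * \<zeta>))"
    by (rule continuous_on_compose2[OF holomorphic_on_imp_continuous_on[OF assms(1)]])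
       (use assms in \<open>auto intro!: continuous_intros simp: norm_mult\<close>)
  have c: "continuous_on (sphere 0 1) (\<lambda>\<zeta>. norm (f (of_real r * \<zeta>)) powr p)"
    using assms(2) by (intro continuous_on_powr' continuous_on_norm * continuous_on_const) auto
  have "(\<lambda>\<zeta>. norm (f (of_real r * \<zeta>)) powr p) \<in> borel_measurable circle_measure"
    using borel_measurable_continuous_on_restrict[OF c]
    by (simp add: circle_measure_def measurable_def)
  moreover obtain B where "\<forall>\<zeta>\<in>sphere 0 1. norm (norm (f (of_real r * \<zeta>)) powr p) \<le> B"
    using compact_imp_bounded[OF compact_continuous_image[OF c compact_sphere]]
    by (auto simp: bounded_iff)
  moreover have "finite_measure circle_measure"
    by (rule finite_measureI) (simp add: sp prob_circle_measure)
  ultimately show ?thesis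
    by (intro finite_measure.integrable_const_bound[of _ _ B]) (auto simp: sp)
qed

definition Hardy :: "real \<Rightarrow> (complex \<Rightarrow> complex) set" where
  "Hardy p = {f. f holomorphic_on ball 0 1 \<and> bdd_above (hardy_mean p f ` {0<..<1})}"

definition Hardy_inf :: "(complex \<Rightarrow> complex) set" where
  "Hardy_inf = {f. f holomorphic_on ball 0 1 \<and> bounded (f ` ball 0 1)}"

definition borel_measure_on_disc :: "complex measure \<Rightarrow> bool" where
  "borel_measure_on_disc \<mu> \<longleftrightarrow> sets \<mu> = sets (restrict_space borel (ball 0 1))"

definition Lp_fun :: "complex measure \<Rightarrow> real \<Rightarrow> (complex \<Rightarrow> complex) set" where
  "Lp_fun \<mu> p = {f \<in> borel_measurable \<mu>. integrable \<mu> (\<lambda>z. norm (f z) powr p)}"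

definition Lp_norm :: "complex measure \<Rightarrow> real \<Rightarrow> (complex \<Rightarrow> complex) \<Rightarrow> real" where
  "Lp_norm \<mu> p f = (LINT z|\<mu>. norm (f z) powr p) powr (1 / p)"

text \<open>Elements of \<open>L\<^sup>p(\<mu>)\<close> are almost-everywhere classes.\<close>

definition Lp_class ::
  "complex measure \<Rightarrow> real \<Rightarrow> (complex \<Rightarrow> complex) \<Rightarrow> (complex \<Rightarrow> complex) set" where
  "Lp_class \<mu> p f = {g \<in> Lp_fun \<mu> p. AE z in \<mu>. g z = f z}"

definition Lp_space :: "complex measure \<Rightarrow> real \<Rightarrow> (complex \<Rightarrow> complex) set set" where
  "Lp_space \<mu> p = Lp_class \<mu> p ` Lp_fun \<mu> p"

text \<open>The topology of the (quasi-)norm: a set is open iff it contains a ball around each of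
  its points.  For \<open>p < 1\<close> this is also the topology of the metric
  \<open>Lp_norm \<mu> p (f - g) powr p\<close>.\<close>

definition Lp_open :: "complex measure \<Rightarrow> real \<Rightarrow> (complex \<Rightarrow> complex) set set \<Rightarrow> bool" where
  "Lp_open \<mu> p U \<longleftrightarrow> U \<subseteq> Lp_space \<mu> p \<and>
     (\<forall>f \<in> Lp_fun \<mu> p. Lp_class \<mu> p f \<in> U \<longrightarrow>
        (\<exists>\<epsilon>>0. \<forall>g \<in> Lp_fun \<mu> p. Lp_norm \<mu> p (\<lambda>z. g z - f z) < \<epsilon> \<longrightarrow> Lp_class \<mu> p g \<in> U))"

definition Lp_topology :: "complex measure \<Rightarrow> real \<Rightarrow> (complex \<Rightarrow> complex) set topology" where
  "Lp_topology \<mu> p = topology (Lp_open \<mu> p)"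

lemma istopology_Lp_open: "istopology (Lp_open \<mu> p)"
  unfolding istopology_def
proof (intro conjI allI impI)
  fix S T assume S: "Lp_open \<mu> p S" and T: "Lp_open \<mu> p T"
  show "Lp_open \<mu> p (S \<inter> T)"
    unfolding Lp_open_def
  proof (intro conjI ballI impI)
    show "S \<inter> T \<subseteq> Lp_space \<mu> p"
      using S by (auto simp: Lp_open_def)
  next
    fix f assume f: "f \<in> Lp_fun \<mu> p" and fST: "Lp_class \<mu> p f \<in> S \<inter> T"
    obtain a where a: "a > 0"
      "\<forall>g \<in> Lp_fun \<mu> p. Lp_norm \<mu> p (\<lambda>z. g z - f z) < a \<longrightarrow> Lp_class \<mu> p g \<in> S"
      using S f fST unfolding Lp_open_def by blast
    obtain b where b: "b > 0"
      "\<forall>g \<in> Lp_fun \<mu> p. Lp_norm \<mu> p (\<lambda>z. g z - f z) < b \<longrightarrow> Lp_class \<mu> p g \<in> T"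
      using T f fST unfolding Lp_open_def by blast
    show "\<exists>\<epsilon>>0. \<forall>g \<in> Lp_fun \<mu> p. Lp_norm \<mu> p (\<lambda>z. g z - f z) < \<epsilon> \<longrightarrow>
        Lp_class \<mu> p g \<in> S \<inter> T"
      using a b by (intro exI[of _ "min a b"]) auto
  qed
next
  fix K assume K: "\<forall>S\<in>K. Lp_open \<mu> p S"
  show "Lp_open \<mu> p (\<Union>K)"
    unfolding Lp_open_def
  proof (intro conjI ballI impI)
    show "\<Union>K \<subseteq> Lp_space \<mu> p"
      using K by (auto simp: Lp_open_def)
  next
    fix f assume f: "f \<in> Lp_fun \<mu> p" and "Lp_class \<mu> p f \<in> \<Union>K"
    then obtain S where S: "S \<in> K" "Lp_class \<mu> p f \<in> S" by blast
    then obtain a where a: "a > 0"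
      "\<forall>g \<in> Lp_fun \<mu> p. Lp_norm \<mu> p (\<lambda>z. g z - f z) < a \<longrightarrow> Lp_class \<mu> p g \<in> S"
      using K f unfolding Lp_open_def by blast
    then show "\<exists>\<epsilon>>0. \<forall>g \<in> Lp_fun \<mu> p. Lp_norm \<mu> p (\<lambda>z. g z - f z) < \<epsilon> \<longrightarrow>
        Lp_class \<mu> p g \<in> \<Union>K"
      using S by blast
  qed
qed

lemma openin_Lp_topology: "openin (Lp_topology \<mu> p) U \<longleftrightarrow> Lp_open \<mu> p U"
  unfolding Lp_topology_def by (simp add: istopology_Lp_open)

lemma topspace_Lp_topology: "topspace (Lp_topology \<mu> p) = Lp_space \<mu> p"
proof -
  have "Lp_open \<mu> p (Lp_space \<mu> p)"
    unfolding Lp_open_def by (auto simp: Lp_space_def intro: exI[of _ 1])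
  then show ?thesis
    unfolding topspace_def openin_Lp_topology by (auto simp: Lp_open_def)
qed

definition Carleson_measure :: "complex measure \<Rightarrow> bool" where
  "Carleson_measure \<mu> \<longleftrightarrow> borel_measure_on_disc \<mu> \<and> (\<exists>q>0. Hardy q \<subseteq> Lp_fun \<mu> q)"

text \<open>The map \<open>j\<^sub>p(\<mu>)\<close>, to be applied to \<^term>\<open>f \<in> Hardy p\<close>.  If \<open>f\<close> were not in
  \<^term>\<open>Lp_fun \<mu> p\<close> the value would be the empty set, which is not an element of
  \<^term>\<open>Lp_space \<mu> p\<close>; by Carleson's theorem this does not happen for a Carleson measure.\<close>

definition embedding ::
  "real \<Rightarrow> complex measure \<Rightarrow> (complex \<Rightarrow> complex) \<Rightarrow> (complex \<Rightarrow> complex) set" where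
  "embedding p \<mu> f = Lp_class \<mu> p f"

definition supported_precisely_on :: "complex measure \<Rightarrow> complex set \<Rightarrow> bool" where
  "supported_precisely_on \<mu> Z \<longleftrightarrow>
     emeasure \<mu> (ball 0 1 - Z) = 0 \<and> (\<forall>z\<in>Z. emeasure \<mu> {z} > 0)"

definition interpolating_sequence :: "(nat \<Rightarrow> complex) \<Rightarrow> bool" where
  "interpolating_sequence z \<longleftrightarrow> inj z \<and> range z \<subseteq> ball 0 1 \<and>
     {\<lambda>n. f (z n) | f. f \<in> Hardy_inf} = {a. bounded (range a)}"

end

theory Submission
  imports Defs
begin

text \<open>Let \<open>z\<close> be interpolating.  Varopoulos' averaging gives functions \<open>F n\<close> with
  \<open>F n (z n) = 1\<close>, \<open>F n (z k) = 0\<close> for \<open>k \<noteq> n\<close>, and \<open>\<Sum>\<bar>F n\<bar>\<close> bounded.  By duality such functions make \<open>\<mu> = \<Sum>(1 - \<bar>z n\<bar>\<^sup>2) \<delta>\<^bsub>z n\<^esub>\<close> a Carleson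
  measure: for \<open>p = 2\<close> this is Cauchy's formula and the Cauchy--Schwarz inequality, and for
  general \<open>p\<close> a zero-free majorant \<open>g\<close> of \<open>f\<close> with the same modulus on a circle is replaced by
  \<open>g\<close> to the power \<open>p / 2\<close>.  The sums \<open>\<Sum>a\<^sub>n F n K\<^sub>n\<^sup>s\<close>, with \<open>K\<^sub>n\<close> the normalised Szego kernel, show
  that the embedding is onto.

  Conversely, a closed range and Baire's theorem give, for every \<open>f \<in> H\<^sup>p\<close>, a function of norm at most
  \<open>C\<close> times the norm of \<open>f\<close> in \<open>L\<^sup>p(\<mu>)\<close> with the same values on \<open>z\<close>.  For \<open>f\<close> a finite Blaschke product vanishing at all
  points but \<open>z k\<close> this bounds \<open>\<bar>f (z k)\<bar>\<close> below, because \<open>\<mu>{z k}\<close> is at most a multiple of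
  \<open>1 - \<bar>z k\<bar>\<^sup>2\<close>.  So the sequence is uniformly separated, and P. Jones' explicit functions interpolate.\<close>

subsection \<open>A Baire category argument for sequence spaces\<close>

text \<open>For \<open>p < 1\<close> the quasinorms are not norms. Estimates are therefore made for
  their \<open>p\<close>-th powers, which obey a triangle inequality with the factor
  \<open>2 powr p\<close> for every \<open>p > 0\<close>. The Baire argument is set up for such a
  functional on sequences, so that it serves both the bounded interpolation problem and the traces
  of Hardy functions; the sets in it are the traces of balls of functions, closed under
  coordinatewise convergence by Montel's theorem. The explicit functions belong to finitely many
  points and have bounds independent of their number; normal families give the limit. Two
  constructions occur because the starting points differ: an interpolating sequence only provides
  some bounded function for each target, so good functions have to be averaged out of these, whereas
  uniform separation provides Blaschke products from which functions can be written down. Cauchy's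
  formula and the power \<open>p / 2\<close> ask for functions that are holomorphic across the
  circle and have no zeros on it. Hence the dilations by radii that avoid the moduli of the
  zeros.\<close>

text \<open>Baire's theorem on the closed subgroup \<open>R\<close> of \<open>V\<close>, written out
  for a functional with a weak triangle inequality. Completeness comes from \<open>fatou\<close>:
  Cauchy sequences converge coordinatewise and \<open>N\<close> is lower semicontinuous. The ball in
  the conclusion is centred at 0 because differences move a ball inside \<open>A m\<close> to the
  origin, at the price of passing to \<open>A (\<phi> m)\<close>.\<close>

lemma baire_lower_semicontinuous:
  fixes N :: "(nat \<Rightarrow> complex) \<Rightarrow> real" and A :: "nat \<Rightarrow> (nat \<Rightarrow> complex) set"
  assumes V_diff: "\<And>x y. x \<in> V \<Longrightarrow> y \<in> V \<Longrightarrow> (\<lambda>n. x n - y n) \<in> V"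
    and N_nonneg: "\<And>x. 0 \<le> N x"
    and N_zero: "N (\<lambda>n. 0) = 0"
    and N_commute: "\<And>x y. N (\<lambda>n. x n - y n) = N (\<lambda>n. y n - x n)"
    and N_triangle: "\<And>x y w. x \<in> V \<Longrightarrow> y \<in> V \<Longrightarrow> w \<in> V \<Longrightarrow>
        N (\<lambda>n. x n - w n) \<le> K * (N (\<lambda>n. x n - y n) + N (\<lambda>n. y n - w n))"
    and coordinate: "\<And>n e. 0 < e \<Longrightarrow> \<exists>d>0. \<forall>x\<in>V. N x < d \<longrightarrow> norm (x n) < e"
    and fatou: "\<And>u x c. (\<And>i. u i \<in> V) \<Longrightarrow> (\<And>i. N (u i) \<le> c) \<Longrightarrow>
        (\<And>n. (\<lambda>i. u i n) \<longlonglongrightarrow> x n) \<Longrightarrow> x \<in> V \<and> N x \<le> c"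
    and K: "1 \<le> K"
    and R_V: "R \<subseteq> V" and zero: "(\<lambda>n. 0) \<in> R" and R_add: "\<And>x y. x \<in> R \<Longrightarrow> y \<in> R \<Longrightarrow> (\<lambda>n. x n + y n) \<in> R"
    and R_closed: "\<And>u x. (\<And>i. u i \<in> R) \<Longrightarrow> x \<in> V \<Longrightarrow>
        (\<lambda>i. N (\<lambda>n. u i n - x n)) \<longlonglongrightarrow> 0 \<Longrightarrow> x \<in> R"
    and A_closed: "\<And>m u x. (\<And>i. u i \<in> A m) \<Longrightarrow> (\<And>n. (\<lambda>i. u i n) \<longlonglongrightarrow> x n) \<Longrightarrow> x \<in> A m"
    and R_eq: "R = (\<Union>m. A m)"
    and A_diff: "\<And>m x y. x \<in> A m \<Longrightarrow> y \<in> A m \<Longrightarrow> (\<lambda>n. x n - y n) \<in> A (\<phi> m)"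
  shows "\<exists>m. \<exists>e>0. \<forall>x\<in>R. N x < e \<longrightarrow> x \<in> A m"
proof (rule ccontr)
  assume contra: "\<not> ?thesis"
  define d where "d = (\<lambda>x y. N (\<lambda>n. x n - y n))"
  have pointwise: "(\<lambda>i. u i n) \<longlonglongrightarrow> x n" if "\<And>i. u i \<in> V" "x \<in> V" "(\<lambda>i. d (u i) x) \<longlonglongrightarrow> 0" for u x n
  proof (rule LIMSEQ_I)
    fix e :: real assume "0 < e"
    then obtain \<delta> where \<delta>: "\<delta> > 0" "\<forall>x\<in>V. N x < \<delta> \<longrightarrow> norm (x n) < e"
      using coordinate by blast
    have "\<forall>\<^sub>F i in sequentially. d (u i) x < \<delta>"
      using that(3) \<delta>(1) by (rule order_tendstoD)
    then obtain i0 where "\<forall>i\<ge>i0. d (u i) x < \<delta>"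
      unfolding eventually_sequentially by blast
    then show "\<exists>no. \<forall>i\<ge>no. norm (u i n - x n) < e"
      using \<delta>(2) V_diff[OF that(1,2)] unfolding d_def by blast
  qed
  \<comment> \<open>If \<open>A m\<close> filled the ball around \<open>x\<close>, subtracting
    \<open>x\<close> would put a ball around 0 into \<open>A (\<phi> m)\<close>, against
    \<open>contra\<close>. A nearby \<open>y\<close> outside \<open>A m\<close> has a whole ball
    outside it, since \<open>A m\<close> is closed under coordinatewise limits.\<close>
  have far: "\<exists>y e. y \<in> R \<and> d x y < s \<and> 0 < e \<and> (\<forall>w\<in>R. d w y < e \<longrightarrow> w \<notin> A m)" if x: "x \<in> R" and s: "0 < s" for m x s
  proof -
    have "\<exists>y\<in>R. d y x < s \<and> y \<notin> A m"
    proof (rule ccontr)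
      assume no: "\<not> ?thesis"
      have "v \<in> A (\<phi> m)" if v: "v \<in> R" "N v < s" for v
      proof -
        have "(\<lambda>n. v n + x n) \<in> A m"
          using no R_add[OF v(1) x] v(2) unfolding d_def by auto
        moreover have "x \<in> A m"
        proof -
          have "d x x < s" using s N_zero by (simp add: d_def)
          then show ?thesis using no x by blast
        qed
        ultimately have "(\<lambda>n. (v n + x n) - x n) \<in> A (\<phi> m)" by (rule A_diff)
        then show ?thesis by simp
      qed
      with contra s show False by blast
    qed
    then obtain y where y: "y \<in> R" "d y x < s" "y \<notin> A m" by blast
    have "\<exists>e>0. \<forall>w\<in>R. d w y < e \<longrightarrow> w \<notin> A m"
    proof (rule ccontr)
      assume "\<not> ?thesis"
      then have "\<forall>i. \<exists>w. w \<in> R \<and> d w y < inverse (real (Suc i)) \<and> w \<in> A m"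
        by (metis inverse_positive_iff_positive of_nat_0_less_iff zero_less_Suc)
      then obtain u where u: "\<And>i. u i \<in> R" "\<And>i. d (u i) y < inverse (real (Suc i))" "\<And>i. u i \<in> A m"
        by metis
      have "(\<lambda>i. d (u i) y) \<longlonglongrightarrow> 0"
        by (rule real_tendsto_sandwich[OF _ _ tendsto_const LIMSEQ_inverse_real_of_nat])
          (use u(2) N_nonneg in \<open>auto simp: d_def intro!: always_eventually less_imp_le\<close>)
      then have "(\<lambda>i. u i n) \<longlonglongrightarrow> y n" for n
        using u(1) y(1) R_V by (intro pointwise) auto
      then have "y \<in> A m"
        by (rule A_closed[OF u(3)])
      with y(3) show False by blast
    qed
    then show ?thesis using y N_commute unfolding d_def by metis
  qed
  \<comment> \<open>The radii satisfy
    \<open>K * (e / (4 * K^2) + (e / (2 * K)) / (2 * K)) = e / (2 * K)\<close>, so the factor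
    \<open>K\<close> lost in each triangle inequality is regained at the next radius.\<close>
  have step: "\<exists>q'. (fst q' \<in> R \<and> 0 < snd q' \<and> (\<forall>w\<in>R. d w (fst q') < snd q' \<longrightarrow> w \<notin> A m)) \<and>
       (d (fst q) (fst q') < snd q / (4 * K^2) \<and> snd q' \<le> snd q / (2 * K))"
    if "fst q \<in> R" "0 < snd q" for q :: "(nat \<Rightarrow> complex) \<times> real" and m
  proof -
    have "0 < snd q / (4 * K^2)" using that K by auto
    from far[OF that(1) this, of m] obtain y e where
      y: "y \<in> R" "d (fst q) y < snd q / (4 * K^2)" "0 < e" "\<forall>w\<in>R. d w y < e \<longrightarrow> w \<notin> A m" by blast
    then show ?thesis
      using that K by (intro exI[of _ "(y, min e (snd q / (2*K)))"]) auto
  qed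
  \<comment> \<open>Index \<open>m\<close> avoids \<open>A (m - 1)\<close>; index 0 avoids nothing,
    so the unit ball around 0 can start the sequence.\<close>
  define P where "P = (\<lambda>m (q::(nat \<Rightarrow> complex) \<times> real). fst q \<in> R \<and> 0 < snd q \<and> (\<forall>w\<in>R. d w (fst q) < snd q \<longrightarrow> (m > 0 \<longrightarrow> w \<notin> A (m - 1))))"
  have "\<exists>q. \<forall>m. P m (q m) \<and> (d (fst (q m)) (fst (q (Suc m))) < snd (q m) / (4 * K^2) \<and> snd (q (Suc m)) \<le> snd (q m) / (2 * K))"
  proof (rule dependent_nat_choice[where Q="\<lambda>m q q'. d (fst q) (fst q') < snd q / (4 * K^2) \<and> snd q' \<le> snd q / (2 * K)"])
    show "\<exists>q. P 0 q" by (rule exI[of _ "(\<lambda>n. 0, 1)"]) (simp add: P_def zero)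
    show "\<exists>y. P (Suc n) y \<and> d (fst x) (fst y) < snd x / (4 * K\<^sup>2) \<and> snd y \<le> snd x / (2 * K)" if "P n x" for x n
      using step[of x n] that by (simp add: P_def)
  qed
  then obtain q where q: "\<And>m. P m (q m)"
    "\<And>m. d (fst (q m)) (fst (q (Suc m))) < snd (q m) / (4 * K^2) \<and> snd (q (Suc m)) \<le> snd (q m) / (2 * K)"
    by blast
  define y where "y = (\<lambda>m. fst (q m))"
  define e where "e = (\<lambda>m. snd (q m))"
  have yR: "y m \<in> R" and e0: "0 < e m" and avoid: "\<And>w. w \<in> R \<Longrightarrow> d w (y (Suc m)) < e (Suc m) \<Longrightarrow> w \<notin> A m" for m
    using q(1)[of m] q(1)[of "Suc m"] by (auto simp: P_def y_def e_def)
  have yV: "y m \<in> V" for m using yR R_V by blast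
  have dy: "d (y m) (y (Suc m)) < e m / (4 * K^2)" and eSuc: "e (Suc m) \<le> e m / (2 * K)" for m
    using q(2)[of m] by (auto simp: y_def e_def)
  have dist: "d (y m) (y (m + Suc k)) \<le> e m / (2 * K)" for m k
  proof (induction k arbitrary: m)
    case 0
    have "e m / (4 * K^2) \<le> e m / (2 * K)"
      using K e0[of m] by (intro divide_left_mono) (auto simp: power2_eq_square)
    then show ?case using dy[of m] by simp
  next
    case (Suc k)
    have "d (y m) (y (m + Suc (Suc k))) \<le> K * (d (y m) (y (Suc m)) + d (y (Suc m)) (y (Suc m + Suc k)))"
      using N_triangle[of "y m" "y (Suc m)" "y (m + Suc (Suc k))"] yV by (simp add: d_def)
    also have "\<dots> \<le> K * (e m / (4 * K^2) + e (Suc m) / (2 * K))"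
      using dy[of m] Suc[of "Suc m"] K by (intro mult_left_mono add_mono) auto
    also have "\<dots> = e m / (4 * K) + e (Suc m) / 2"
      using K by (simp add: field_simps power2_eq_square)
    also have "\<dots> \<le> e m / (4 * K) + (e m / (2 * K)) / 2"
      using eSuc[of m] by (intro add_left_mono divide_right_mono) auto
    also have "\<dots> = e m / (2 * K)" using K by (simp add: field_simps)
    finally show ?case .
  qed
  have e_small: "e m \<le> e 0 / 2 ^ m" for m
  proof (induction m)
    case (Suc m)
    have "e (Suc m) \<le> e m / (2 * K)" by (rule eSuc)
    also have "\<dots> \<le> e m / 2" using K e0[of m] by (intro divide_left_mono) auto
    also have "\<dots> \<le> (e 0 / 2 ^ m) / 2" using Suc by simp
    finally show ?case by simp
  qed auto
  have e_lim: "e \<longlonglongrightarrow> 0"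
  proof (rule real_tendsto_sandwich[OF _ _ tendsto_const])
    show "(\<lambda>m. e 0 * (1/2) ^ m) \<longlonglongrightarrow> 0"
      by (rule tendsto_mult_right_zero, rule LIMSEQ_power_zero) auto
  qed (use e_small e0 in \<open>auto intro!: always_eventually less_imp_le simp: power_divide\<close>)
  have dist': "d (y m) (y k) \<le> e m / (2 * K)" if "m < k" for m k
    using dist[of m "k - Suc m"] that by simp
  have "Cauchy (\<lambda>m. y m n)" for n
  proof (rule CauchyI')
    fix s :: real assume "0 < s"
    then obtain \<delta> where \<delta>: "\<delta> > 0" "\<forall>x\<in>V. N x < \<delta> \<longrightarrow> norm (x n) < s"
      using coordinate by blast
    obtain m0 where m0: "\<And>m. m \<ge> m0 \<Longrightarrow> e m < \<delta>"
      using order_tendstoD(2)[OF e_lim \<delta>(1)] unfolding eventually_sequentially by blast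
    have "norm (y m n - y k n) < s" if "m0 \<le> m" "m < k" for m k
    proof -
      have "e m / (2 * K) \<le> e m / 1" using K e0[of m] by (intro divide_left_mono) auto
      then have "d (y m) (y k) < \<delta>" using dist'[OF that(2)] m0[OF that(1)] by simp
      then show ?thesis using \<delta>(2) V_diff[OF yV yV] unfolding d_def by blast
    qed
    then show "\<exists>M. \<forall>m\<ge>M. \<forall>k>m. dist (y m n) (y k n) < s"
      by (auto simp: dist_norm intro!: exI[of _ m0])
  qed
  then have "\<forall>n. \<exists>x. (\<lambda>m. y m n) \<longlonglongrightarrow> x"
    by (simp add: Cauchy_convergent_iff convergent_def)
  from choice[OF this] obtain l where l: "\<And>n. (\<lambda>m. y m n) \<longlonglongrightarrow> l n"
    by blast
  \<comment> \<open>\<open>fatou\<close> is applied to the differences as \<open>k\<close> grows: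
    the limit inherits the bound on distances, and \<open>l\<close> lies in \<open>V\<close> because
    \<open>y m - l\<close> does.\<close>
  have diffl: "(\<lambda>n. y m n - l n) \<in> V \<and> d (y m) l \<le> e m / (2 * K)" for m
    unfolding d_def
  proof (rule fatou[of "\<lambda>k n. y m n - y (m + Suc k) n"])
    show "(\<lambda>n. y m n - y (m + Suc i) n) \<in> V" for i by (intro V_diff yV)
    show "N (\<lambda>n. y m n - y (m + Suc i) n) \<le> e m / (2 * K)" for i using dist[of m i] by (simp add: d_def)
    show "(\<lambda>i. y m n - y (m + Suc i) n) \<longlonglongrightarrow> y m n - l n" for n
      using LIMSEQ_ignore_initial_segment[OF l, of "Suc m" n]
      by (intro tendsto_diff tendsto_const) (simp add: add.commute)
  qed
  have "(\<lambda>n. y 0 n - (y 0 n - l n)) \<in> V" using V_diff[OF yV conjunct1[OF diffl]] .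
  then have lV: "l \<in> V" by simp
  have small: "d (y m) l < e m" for m
  proof -
    have "e m / (2 * K) < e m / 1" using K e0[of m] by (intro divide_strict_left_mono) auto
    then show ?thesis using diffl[of m] by simp
  qed
  have "(\<lambda>m. d (y m) l) \<longlonglongrightarrow> 0"
    by (rule real_tendsto_sandwich[OF _ _ tendsto_const e_lim])
      (use small N_nonneg in \<open>auto intro!: always_eventually less_imp_le simp: d_def\<close>)
  then have "l \<in> R" using R_closed[OF yR lV] by (simp add: d_def)
  then obtain m where "l \<in> A m" using R_eq by blast
  moreover have "d l (y (Suc m)) < e (Suc m)" using small[of "Suc m"] N_commute by (simp add: d_def)
  ultimately show False using avoid[OF \<open>l \<in> R\<close>] by blast
qed

subsection \<open>Cauchy integrals over the circle\<close>

lemma space_circle_measure [simp]: "space circle_measure = sphere 0 1"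
  by (simp add: circle_measure_def space_restrict_space)

interpretation circle: finite_measure circle_measure
  by (rule finite_measureI) (simp add: prob_circle_measure)

lemma measurable_circle:
  fixes g :: "complex \<Rightarrow> 'a::topological_space"
  assumes "continuous_on (sphere 0 1) g"
  shows "g \<in> borel_measurable circle_measure"
  using borel_measurable_continuous_on_restrict[OF assms]
  by (simp add: circle_measure_def measurable_def)

lemma integrable_circle:
  fixes g :: "complex \<Rightarrow> 'a::{banach, second_countable_topology}"
  assumes "continuous_on (sphere 0 1) g"
  shows "integrable circle_measure g"
proof -
  obtain B where "\<forall>\<zeta>\<in>sphere 0 1. norm (g \<zeta>) \<le> B"
    using compact_imp_bounded[OF compact_continuous_image[OF assms compact_sphere]]
    by (auto simp: bounded_iff)
  then show ?thesis
    by (intro circle.integrable_const_bound[of _ B] measurable_circle assms) auto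
qed

text \<open>The parameter runs over the unit interval to match
  \<open>circlepath 0 1\<close>.\<close>

lemma integral_circle_eq:
  fixes g :: "complex \<Rightarrow> complex"
  assumes g: "continuous_on (sphere 0 1) g"
  shows "(LINT \<zeta>|circle_measure. g \<zeta>) = integral {0..1} (\<lambda>t. g (cis (2 * pi * t)))"
proof -
  have c: "continuous_on A (\<lambda>t. g (cis t))" for A
    by (rule continuous_on_compose2[OF g]) (auto intro!: continuous_intros)
  have "(LINT \<zeta>|circle_measure. g \<zeta>) = (LINT t|uniform_measure lborel {0..2*pi}. g (cis t))"
    unfolding circle_measure_def
    by (rule integral_distr[OF cis_measurable_circle borel_measurable_continuous_on_restrict[OF g]])
  also have "uniform_measure lborel {0..2*pi} = density lborel (\<lambda>t. ennreal (indicator {0..2*pi} t / (2 * pi)))"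
    unfolding uniform_measure_def
    by (rule arg_cong[where f="density lborel"]) (auto simp: indicator_def divide_ennreal ennreal_1[symmetric] simp del: ennreal_1)
  also have "(LINT t|\<dots>. g (cis t)) = (LINT t|lborel. (indicator {0..2*pi} t / (2 * pi)) *\<^sub>R g (cis t))"
  proof (rule integral_density)
    have "continuous_on UNIV (\<lambda>t. g (cis t))" by (rule c)
    then show "(\<lambda>t. g (cis t)) \<in> borel_measurable lborel"
      using borel_measurable_continuous_onI by (simp add: measurable_def)
  qed auto
  also have "\<dots> = (LINT t:{0..2*pi}|lborel. (1 / (2 * pi)) *\<^sub>R g (cis t))"
    unfolding set_lebesgue_integral_def by (rule Bochner_Integration.integral_cong) auto
  also have "\<dots> = integral {0..2*pi} (\<lambda>t. (1 / (2 * pi)) *\<^sub>R g (cis t))"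
    by (intro set_borel_integral_eq_integral(2) borel_integrable_atLeastAtMost' continuous_intros c)
  also have "\<dots> = (1 / (2 * pi)) *\<^sub>R integral {0..2*pi} (\<lambda>t. g (cis t))"
    by (rule integral_cmul)
  also have "\<dots> = integral ((\<lambda>x. x / (2 * pi)) ` {0..2*pi}) (\<lambda>t. g (cis (2 * pi * t)))"
    by (subst integral_stretch_real[where m = "2 * pi"]) auto
  also have "(\<lambda>x. x / (2 * pi)) ` {0..2*pi} = {0..1}"
    by (simp add: image_divide_atLeastAtMost)
  finally show ?thesis .
qed

text \<open>On the circle \<open>cnj \<zeta> = 1 / \<zeta>\<close>, so
  \<open>d\<zeta> / (\<zeta> - a)\<close> is \<open>2 * pi * \<i> / (1 - a * cnj \<zeta>)\<close>
  times normalised arc length.\<close>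

lemma Cauchy_circle:
  assumes h: "h holomorphic_on ball 0 R" and R: "1 < R" and a: "norm a < 1"
  shows "h a = (LINT \<zeta>|circle_measure. h \<zeta> / (1 - a * cnj \<zeta>))"
proof -
  have hc: "continuous_on (cball 0 1) h" 
    using holomorphic_on_imp_continuous_on[OF h] by (rule continuous_on_subset) (use R in auto)
  have hb: "h holomorphic_on ball 0 1" by (rule holomorphic_on_subset[OF h]) (use R in auto)
  have cis: "circlepath 0 1 t = cis (2 * pi * t)" for t
    by (simp add: circlepath cis_conv_exp mult_ac)
  have ne: "1 - a * cnj \<zeta> \<noteq> 0" if "norm \<zeta> = 1" for \<zeta>
  proof
    assume "1 - a * cnj \<zeta> = 0"
    then have "norm (a * cnj \<zeta>) = 1" by (metis eq_iff_diff_eq_0 norm_one)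
    then show False using a that by (simp add: norm_mult)
  qed
  have "((\<lambda>u. h u / (u - a)) has_contour_integral (2 * of_real pi * \<i> * h a)) (circlepath 0 1)"
    by (rule Cauchy_integral_circlepath[OF hc hb]) (use a in simp)
  then have "2 * of_real pi * \<i> * h a = integral {0..1} (\<lambda>t. h (cis (2*pi*t)) / (cis (2*pi*t) - a) * (2 * pi * \<i> * cis (2*pi*t)))"
    unfolding has_contour_integral_def
    by (intro integral_unique[symmetric]) (auto elim!: has_integral_eq[rotated]
      simp: cis vector_derivative_circlepath01 cis_conv_exp mult_ac)
  also have "\<dots> = integral {0..1} (\<lambda>t. (2 * of_real pi * \<i>) * (h (cis (2*pi*t)) / (1 - a * cnj (cis (2*pi*t)))))"
  proof (rule integral_cong)
    fix t :: real
    let ?u = "cis (2*pi*t)"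
    have "?u * cnj ?u = 1" by (simp add: complex_norm_square[symmetric] del: cis_cnj)
    then have "?u * (1 - a * cnj ?u) = ?u - a" by (simp add: algebra_simps del: cis_cnj)
    then have hu: "h ?u / (?u - a) * ?u = h ?u / (1 - a * cnj ?u)"
      by (metis cis_neq_zero mult.commute mult_divide_mult_cancel_left times_divide_eq_left)
    have "h ?u / (?u - a) * (2 * pi * \<i> * ?u) = 2 * of_real pi * \<i> * (h ?u / (?u - a) * ?u)"
      by (simp only: mult_ac of_real_mult of_real_numeral)
    also note hu
    finally show "h ?u / (?u - a) * (2 * pi * \<i> * ?u) = 2 * of_real pi * \<i> * (h ?u / (1 - a * cnj ?u))" .
  qed
  also have "\<dots> = 2 * of_real pi * \<i> * integral {0..1} (\<lambda>t. h (cis (2*pi*t)) / (1 - a * cnj (cis (2*pi*t))))"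
    by (rule integral_mult_right)
  also have "integral {0..1} (\<lambda>t. h (cis (2*pi*t)) / (1 - a * cnj (cis (2*pi*t)))) = (LINT \<zeta>|circle_measure. h \<zeta> / (1 - a * cnj \<zeta>))"
    by (rule integral_circle_eq[symmetric])
      (use ne in \<open>auto intro!: continuous_intros continuous_on_subset[OF hc]\<close>)
  finally show ?thesis by simp
qed

text \<open>The reproducing property of the Szego kernel at its own point: Cauchy's formula for the
  kernel, evaluated at \<open>a\<close>, integrates its squared modulus.\<close>

lemma norm_Szego_square_integral:
  assumes a: "norm a < 1"
  shows "(LINT \<zeta>|circle_measure. (norm (1 / (1 - cnj a * \<zeta>)))^2) = 1 / (1 - (norm a)^2)"
proof -
  \<comment> \<open>A radius between 1 and the distance \<open>1 / norm a\<close> of the pole; their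
    mean will do.\<close>
  obtain R where R: "1 < R" "R * norm a < 1"
  proof (cases "a = 0")
    case False
    with a show ?thesis using that[of "(1 + 1 / norm a) / 2"] by (auto simp: field_simps)
  qed (use that[of 2] in auto)
  have ne: "1 - cnj a * \<zeta> \<noteq> 0" if "norm \<zeta> < R" for \<zeta>
  proof
    assume "1 - cnj a * \<zeta> = 0"
    then have "norm (cnj a * \<zeta>) = 1" by (metis eq_iff_diff_eq_0 norm_one)
    moreover have "norm a * norm \<zeta> \<le> norm a * R" using that by (intro mult_left_mono) auto
    ultimately show False using R by (simp add: norm_mult mult.commute)
  qed
  have c: "continuous_on (sphere 0 1) (\<lambda>\<zeta>. (norm (1 / (1 - cnj a * \<zeta>)))^2)"
    using ne R by (intro continuous_intros) auto
  have eq: "1 / (1 - cnj a * \<zeta>) / (1 - a * cnj \<zeta>) = of_real ((norm (1 / (1 - cnj a * \<zeta>)))^2)" for \<zeta>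
  proof -
    have "complex_of_real ((norm (1 / (1 - cnj a * \<zeta>)))^2) = (1 / (1 - cnj a * \<zeta>)) * cnj (1 / (1 - cnj a * \<zeta>))"
      by (rule complex_norm_square)
    then show ?thesis by simp
  qed
  have "1 / (1 - cnj a * a) = (LINT \<zeta>|circle_measure. 1 / (1 - cnj a * \<zeta>) / (1 - a * cnj \<zeta>))"
    by (rule Cauchy_circle[OF _ R(1) a]) (use ne in \<open>auto intro!: holomorphic_intros\<close>)
  also have "\<dots> = of_real (LINT \<zeta>|circle_measure. (norm (1 / (1 - cnj a * \<zeta>)))^2)"
    unfolding eq by (rule integral_complex_of_real)
  also have "1 / (1 - cnj a * a) = of_real (1 / (1 - (norm a)^2))"
    using complex_norm_square[of a] by (simp add: mult.commute)
  finally show ?thesis by (simp only: of_real_eq_iff)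
qed

subsection \<open>Carleson embeddings\<close>

lemma Cauchy_Schwarz_integral:
  fixes f g :: "'a \<Rightarrow> real"
  assumes f: "f \<in> borel_measurable M" "integrable M (\<lambda>x. (f x)^2)"
    and g: "g \<in> borel_measurable M" "integrable M (\<lambda>x. (g x)^2)"
  shows "integrable M (\<lambda>x. f x * g x)"
    "(LINT x|M. f x * g x)^2 \<le> (LINT x|M. (f x)^2) * (LINT x|M. (g x)^2)"
proof -
  show fg: "integrable M (\<lambda>x. f x * g x)"
  proof (rule Bochner_Integration.integrable_bound)
    show "integrable M (\<lambda>x. (f x)^2 + (g x)^2)" using f g by simp
    show "AE x in M. norm (f x * g x) \<le> norm ((f x)^2 + (g x)^2)"
    proof (rule AE_I2)
      fix x
      have "0 \<le> (\<bar>f x\<bar> - \<bar>g x\<bar>)^2" by simp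
      then have "2 * (\<bar>f x\<bar> * \<bar>g x\<bar>) \<le> (f x)^2 + (g x)^2" by (simp add: power2_diff)
      moreover have "0 \<le> \<bar>f x\<bar> * \<bar>g x\<bar>" by simp
      ultimately have "\<bar>f x\<bar> * \<bar>g x\<bar> \<le> (f x)^2 + (g x)^2" by linarith
      then show "norm (f x * g x) \<le> norm ((f x)^2 + (g x)^2)" by (simp add: abs_mult)
    qed
  qed (use f g in simp)
  define A where "A = (LINT x|M. (f x)^2)"
  define B where "B = (LINT x|M. (g x)^2)"
  define C where "C = (LINT x|M. f x * g x)"
  \<comment> \<open>\<open>- C / A\<close> minimises this polynomial in \<open>s\<close>; for
    \<open>A = 0\<close> a nonzero linear coefficient would make it negative somewhere.\<close>
  have quad: "0 \<le> A * s^2 + 2 * s * C + B" for s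
  proof -
    have "0 \<le> (LINT x|M. (s * f x + g x)^2)" by simp
    also have "\<dots> = (LINT x|M. s^2 * (f x)^2 + (2 * s) * (f x * g x) + (g x)^2)"
      by (simp add: power2_sum power_mult_distrib ac_simps)
    also have "\<dots> = A * s^2 + 2 * s * C + B"
      using f g fg by (simp add: A_def B_def C_def)
    finally show ?thesis .
  qed
  have "A \<ge> 0" "B \<ge> 0" by (simp_all add: A_def B_def)
  have "C^2 \<le> A * B"
  proof (cases "A = 0")
    case True
    have "C = 0"
    proof (rule ccontr)
      assume "C \<noteq> 0"
      with quad[of "- (B + 1) / (2 * C)"] True show False by (simp add: field_simps)
    qed
    then show ?thesis using True by simp
  next
    case False
    with quad[of "- C / A"] \<open>A \<ge> 0\<close> show ?thesis by (simp add: field_simps power2_eq_square)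
  qed
  then show "(LINT x|M. f x * g x)^2 \<le> (LINT x|M. (f x)^2) * (LINT x|M. (g x)^2)"
    by (simp add: A_def B_def C_def)
qed

lemma one_minus_mult_cnj_nonzero:
  fixes a \<zeta> :: complex
  assumes "norm a < 1" "norm \<zeta> \<le> 1"
  shows "1 - a * cnj \<zeta> \<noteq> 0" "1 - cnj a * \<zeta> \<noteq> 0"
proof -
  have "norm a * norm \<zeta> \<le> norm a * 1" using assms by (intro mult_left_mono) auto
  then have *: "norm a * norm \<zeta> < 1" using assms by simp
  show "1 - a * cnj \<zeta> \<noteq> 0"
    using * by (metis complex_mod_cnj eq_iff_diff_eq_0 less_irrefl norm_mult norm_one)
  show "1 - cnj a * \<zeta> \<noteq> 0"
    using * by (metis complex_mod_cnj eq_iff_diff_eq_0 less_irrefl norm_mult norm_one)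
qed

text \<open>The Szego kernels at the points \<open>a n\<close> are weighted by the functions \<open>F n\<close>, so that
  Cauchy's formula for \<open>h * F n\<close> and the Cauchy--Schwarz inequality turn the pointwise
  bound on \<open>\<Sum>\<bar>F n\<bar>\<close> into a Carleson embedding.\<close>

lemma Carleson_sum_square:
  fixes F :: "'a \<Rightarrow> complex \<Rightarrow> complex" and a :: "'a \<Rightarrow> complex"
  assumes I: "finite I" and R: "1 < R" and h: "h holomorphic_on ball 0 R"
    and F: "\<And>n. n \<in> I \<Longrightarrow> F n holomorphic_on ball 0 R"
    and M: "\<And>\<zeta>. norm \<zeta> = 1 \<Longrightarrow> (\<Sum>n\<in>I. norm (F n \<zeta>)) \<le> M"
    and a: "\<And>n. n \<in> I \<Longrightarrow> norm (a n) < 1" and Fa: "\<And>n. n \<in> I \<Longrightarrow> F n (a n) = 1"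
  shows "(\<Sum>n\<in>I. (1 - (norm (a n))^2) * (norm (h (a n)))^2) \<le> M^2 * (LINT \<zeta>|circle_measure. (norm (h \<zeta>))^2)"
proof -
  define w where "w = (\<lambda>n. 1 - (norm (a n))^2)"
  define k where "k = (\<lambda>n \<zeta>. 1 / (1 - cnj (a n) * \<zeta>))"
  define S where "S = (\<Sum>n\<in>I. w n * (norm (h (a n)))^2)"
  \<comment> \<open>Majorant of the sum of kernels that arises when the values
    \<open>h (a n)\<close> are tested against their own conjugates.\<close>
  define G where "G = (\<lambda>\<zeta>. \<Sum>n\<in>I. w n * norm (h (a n)) * norm (F n \<zeta>) * norm (k n \<zeta>))"
  have w0: "0 < w n" if "n \<in> I" for n
    using a[OF that] by (simp add: w_def abs_square_less_1)
  have S0: "0 \<le> S" unfolding S_def using w0 by (intro sum_nonneg) (simp add: less_imp_le)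
  have "0 \<le> M" using M[of 1] sum_nonneg[of I "\<lambda>n. norm (F n 1)"] by simp
  have sub: "sphere 0 1 \<subseteq> ball (0::complex) R" using R by auto
  have hc: "continuous_on (sphere 0 1) h"
    by (rule continuous_on_subset[OF holomorphic_on_imp_continuous_on[OF h] sub])
  have Fc: "continuous_on (sphere 0 1) (F n)" if "n \<in> I" for n
    by (rule continuous_on_subset[OF holomorphic_on_imp_continuous_on[OF F[OF that]] sub])
  have kc: "continuous_on (sphere 0 1) (k n)" if "n \<in> I" for n
    unfolding k_def using one_minus_mult_cnj_nonzero a[OF that] by (intro continuous_intros) auto
  have Gc: "continuous_on (sphere 0 1) G"
    unfolding G_def by (intro continuous_intros Fc kc)
  have kk: "(LINT \<zeta>|circle_measure. (norm (k n \<zeta>))^2) = 1 / w n" if "n \<in> I" for n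
    unfolding k_def w_def by (rule norm_Szego_square_integral[OF a[OF that]])
  \<comment> \<open>Cauchy-Schwarz over \<open>n\<close> with the weights
    \<open>norm (F n \<zeta>)\<close>: one factor \<open>M\<close> bounds their sum, the other each
    single weight. The integral of the squared kernel cancels one power of
    \<open>w n\<close>.\<close>
  have G2: "(LINT \<zeta>|circle_measure. (G \<zeta>)^2) \<le> M^2 * S"
  proof -
    have "(G \<zeta>)^2 \<le> (\<Sum>n\<in>I. M^2 * ((w n * norm (h (a n)))^2 * (norm (k n \<zeta>))^2))" if "norm \<zeta> = 1" for \<zeta>
    proof -
      have "(G \<zeta>)^2 = (\<Sum>n\<in>I. sqrt (norm (F n \<zeta>)) * (sqrt (norm (F n \<zeta>)) * (w n * norm (h (a n)) * norm (k n \<zeta>))))^2"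
        unfolding G_def by (simp add: mult.assoc[symmetric]) (simp add: mult_ac)
      also have "\<dots> \<le> (\<Sum>n\<in>I. (sqrt (norm (F n \<zeta>)))^2) * (\<Sum>n\<in>I. (sqrt (norm (F n \<zeta>)) * (w n * norm (h (a n)) * norm (k n \<zeta>)))^2)"
        by (rule Cauchy_Schwarz_ineq_sum)
      also have "\<dots> = (\<Sum>n\<in>I. norm (F n \<zeta>)) * (\<Sum>n\<in>I. norm (F n \<zeta>) * ((w n * norm (h (a n)))^2 * (norm (k n \<zeta>))^2))"
        by (simp add: power_mult_distrib mult_ac)
      also have "\<dots> \<le> M * (\<Sum>n\<in>I. M * ((w n * norm (h (a n)))^2 * (norm (k n \<zeta>))^2))"
      proof (intro mult_mono M that sum_mono mult_right_mono)
        fix n assume "n \<in> I"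
        then have "norm (F n \<zeta>) \<le> (\<Sum>n\<in>I. norm (F n \<zeta>))" by (intro member_le_sum I) auto
        then show "norm (F n \<zeta>) \<le> M" using M[OF that] by simp
      qed (use \<open>0 \<le> M\<close> in \<open>auto intro!: sum_nonneg\<close>)
      also have "\<dots> = (\<Sum>n\<in>I. M^2 * ((w n * norm (h (a n)))^2 * (norm (k n \<zeta>))^2))"
        by (simp add: sum_distrib_left power2_eq_square mult_ac)
      finally show ?thesis .
    qed
    then have "(LINT \<zeta>|circle_measure. (G \<zeta>)^2) \<le> (LINT \<zeta>|circle_measure. (\<Sum>n\<in>I. M^2 * ((w n * norm (h (a n)))^2 * (norm (k n \<zeta>))^2)))"
      by (intro integral_mono integrable_circle continuous_intros Gc kc) auto
    also have "\<dots> = (\<Sum>n\<in>I. M^2 * ((w n * norm (h (a n)))^2 * (LINT \<zeta>|circle_measure. (norm (k n \<zeta>))^2)))"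
      by (subst Bochner_Integration.integral_sum) (intro integrable_circle continuous_intros kc, auto)
    also have "\<dots> = (\<Sum>n\<in>I. M^2 * (w n * (norm (h (a n)))^2))"
    proof (rule sum.cong[OF refl], rule arg_cong[where f="\<lambda>x. M^2 * x"])
      fix n assume "n \<in> I"
      with w0[OF this] show "(w n * norm (h (a n)))^2 * (LINT \<zeta>|circle_measure. (norm (k n \<zeta>))^2) = w n * (norm (h (a n)))^2"
        unfolding kk[OF \<open>n \<in> I\<close>] by (simp add: power2_eq_square)
    qed
    also have "\<dots> = M^2 * S" by (simp add: S_def sum_distrib_left)
    finally show ?thesis .
  qed
  have intc: "integrable circle_measure (\<lambda>\<zeta>. h \<zeta> * F n \<zeta> / (1 - a n * cnj \<zeta>))" if "n \<in> I" for n
    using one_minus_mult_cnj_nonzero(1)[OF a[OF that]]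
    by (intro integrable_circle continuous_intros hc Fc that) auto
  \<comment> \<open>The factor \<open>F n (a n) = 1\<close> is inserted so that Cauchy's formula can
    be used for \<open>h * F n\<close> instead of \<open>h\<close>.\<close>
  have "of_real S = (\<Sum>n\<in>I. of_real (w n) * cnj (h (a n)) * (h (a n) * F n (a n)))"
    unfolding S_def of_real_sum
  proof (intro sum.cong refl)
    fix n assume "n \<in> I"
    have "complex_of_real (w n * (norm (h (a n)))^2) = of_real (w n) * (h (a n) * cnj (h (a n)))"
      using complex_norm_square[of "h (a n)"] by simp
    then show "complex_of_real (w n * (norm (h (a n)))^2) = of_real (w n) * cnj (h (a n)) * (h (a n) * F n (a n))"
      using Fa[OF \<open>n \<in> I\<close>] by (simp add: mult_ac)
  qed
  also have "\<dots> = (\<Sum>n\<in>I. of_real (w n) * cnj (h (a n)) * (LINT \<zeta>|circle_measure. h \<zeta> * F n \<zeta> / (1 - a n * cnj \<zeta>)))"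
  proof (intro sum.cong refl arg_cong2[where f="(*)"])
    fix n assume "n \<in> I"
    show "h (a n) * F n (a n) = (LINT \<zeta>|circle_measure. h \<zeta> * F n \<zeta> / (1 - a n * cnj \<zeta>))"
      using Cauchy_circle[OF holomorphic_on_mult[OF h F[OF \<open>n \<in> I\<close>]] R a[OF \<open>n \<in> I\<close>]] .
  qed
  also have "\<dots> = (LINT \<zeta>|circle_measure. (\<Sum>n\<in>I. of_real (w n) * cnj (h (a n)) * (h \<zeta> * F n \<zeta> / (1 - a n * cnj \<zeta>))))"
    by (subst Bochner_Integration.integral_sum[OF integrable_mult_right[OF intc]])
      (assumption, simp only: integral_mult_right_zero)
  finally have "S = norm (LINT \<zeta>|circle_measure. (\<Sum>n\<in>I. of_real (w n) * cnj (h (a n)) * (h \<zeta> * F n \<zeta> / (1 - a n * cnj \<zeta>))))"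
    using S0 by (metis abs_of_nonneg norm_of_real)
  also have "\<dots> \<le> (LINT \<zeta>|circle_measure. norm (\<Sum>n\<in>I. of_real (w n) * cnj (h (a n)) * (h \<zeta> * F n \<zeta> / (1 - a n * cnj \<zeta>))))"
    by (rule integral_norm_bound)
  also have "\<dots> \<le> (LINT \<zeta>|circle_measure. norm (h \<zeta>) * G \<zeta>)"
  proof (rule integral_mono)
    show "integrable circle_measure (\<lambda>\<zeta>. norm (\<Sum>n\<in>I. of_real (w n) * cnj (h (a n)) * (h \<zeta> * F n \<zeta> / (1 - a n * cnj \<zeta>))))"
      using one_minus_mult_cnj_nonzero a by (intro integrable_circle continuous_intros hc Fc) auto
    show "integrable circle_measure (\<lambda>\<zeta>. norm (h \<zeta>) * G \<zeta>)"
      by (intro integrable_circle continuous_intros hc Gc)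
    fix \<zeta> assume "\<zeta> \<in> space circle_measure"
    show "norm (\<Sum>n\<in>I. of_real (w n) * cnj (h (a n)) * (h \<zeta> * F n \<zeta> / (1 - a n * cnj \<zeta>))) \<le> norm (h \<zeta>) * G \<zeta>"
    proof (rule order_trans[OF norm_sum], unfold G_def sum_distrib_left, rule sum_mono)
      fix n assume "n \<in> I"
      have "norm (1 - a n * cnj \<zeta>) = norm (1 - cnj (a n) * \<zeta>)"
        using complex_mod_cnj[of "1 - a n * cnj \<zeta>"] by simp
      then show "norm (of_real (w n) * cnj (h (a n)) * (h \<zeta> * F n \<zeta> / (1 - a n * cnj \<zeta>))) \<le> norm (h \<zeta>) * (w n * norm (h (a n)) * norm (F n \<zeta>) * norm (k n \<zeta>))"
        using w0[OF \<open>n \<in> I\<close>] by (simp add: norm_mult norm_divide k_def mult_ac)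
    qed
  qed
  finally have "S \<le> (LINT \<zeta>|circle_measure. norm (h \<zeta>) * G \<zeta>)" .
  then have "S^2 \<le> (LINT \<zeta>|circle_measure. norm (h \<zeta>) * G \<zeta>)^2" using S0 by (intro power_mono) auto
  also have "\<dots> \<le> (LINT \<zeta>|circle_measure. (norm (h \<zeta>))^2) * (LINT \<zeta>|circle_measure. (G \<zeta>)^2)"
    by (intro Cauchy_Schwarz_integral measurable_circle integrable_circle continuous_intros hc Gc)
  also have "\<dots> \<le> (LINT \<zeta>|circle_measure. (norm (h \<zeta>))^2) * (M^2 * S)"
    by (intro mult_left_mono G2) simp
  \<comment> \<open>\<open>S\<close> is a finite sum, so one factor can be cancelled unless it is
    zero.\<close>
  finally have "S * S \<le> (M^2 * (LINT \<zeta>|circle_measure. (norm (h \<zeta>))^2)) * S" by (simp add: power2_eq_square mult_ac)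
  moreover have "0 \<le> M^2 * (LINT \<zeta>|circle_measure. (norm (h \<zeta>))^2)" by simp
  ultimately have "S \<le> M^2 * (LINT \<zeta>|circle_measure. (norm (h \<zeta>))^2)"
    using S0 by (cases "S = 0") auto
  then show ?thesis by (simp add: S_def w_def)
qed

text \<open>Divide out the zeros in the disc together with their Blaschke factors.\<close>

lemma zero_free_majorant:
  assumes "f holomorphic_on ball 0 R" "1 < R" "\<And>\<zeta>. norm \<zeta> = 1 \<Longrightarrow> f \<zeta> \<noteq> 0"
  obtains g where "g holomorphic_on ball 0 R" "\<And>z. norm z \<le> 1 \<Longrightarrow> g z \<noteq> 0"
    "\<And>\<zeta>. norm \<zeta> = 1 \<Longrightarrow> norm (g \<zeta>) = norm (f \<zeta>)" "\<And>z. norm z \<le> 1 \<Longrightarrow> norm (f z) \<le> norm (g z)"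
proof -
  define Z where "Z = (\<lambda>f::complex \<Rightarrow> complex. {z \<in> cball 0 1. f z = 0})"
  have finite_Z: "finite (Z f)" if f: "f holomorphic_on ball 0 R" "\<And>\<zeta>. norm \<zeta> = 1 \<Longrightarrow> f \<zeta> \<noteq> 0" for f
  proof -
    have 1: "(1::complex) \<in> ball 0 R" "f 1 \<noteq> 0" using f(2)[of 1] \<open>1 < R\<close> by auto
    have sub: "cball 0 1 \<subseteq> ball (0::complex) R" using \<open>1 < R\<close> by auto
    have "finite (Z f)" if nonempty: "Z f \<noteq> {}"
    proof -
      obtain a where "a \<in> cball 0 1" "f a = 0" using nonempty by (auto simp: Z_def)
      then have "a \<in> ball 0 R" "f a = 0" using sub by blast+
      then have "\<not> f constant_on ball 0 R" using 1 unfolding constant_on_def by metis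
      then show ?thesis unfolding Z_def
        using sub by (intro holomorphic_compact_finite_zeros[OF f(1)]) auto
    qed
    then show ?thesis by (cases "Z f = {}") auto
  qed
  have "\<exists>g. g holomorphic_on ball 0 R \<and> (\<forall>z. norm z \<le> 1 \<longrightarrow> g z \<noteq> 0) \<and>
      (\<forall>\<zeta>. norm \<zeta> = 1 \<longrightarrow> norm (g \<zeta>) = norm (f \<zeta>)) \<and> (\<forall>z. norm z \<le> 1 \<longrightarrow> norm (f z) \<le> norm (g z))"
    if "f holomorphic_on ball 0 R" "\<And>\<zeta>. norm \<zeta> = 1 \<Longrightarrow> f \<zeta> \<noteq> 0" for f
    using that
  \<comment> \<open>Induction on the number of distinct zeros; each is removed with its full
    multiplicity \<open>n\<close>.\<close>
  proof (induction "card (Z f)" arbitrary: f)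
    case 0
    then have "Z f = {}" using finite_Z[of f] by simp
    then show ?case using 0 by (intro exI[of _ f]) (auto simp: Z_def)
  next
    case (Suc m)
    note f = Suc.prems
    from Suc.hyps(2) obtain a where "a \<in> Z f" by (metis card.empty nat.distinct(1) ex_in_conv)
    then have fa: "f a = 0" and "norm a \<le> 1" by (auto simp: Z_def)
    then have a: "norm a < 1" using f(2)[of a] by (metis less_eq_real_def)
    have "f 1 \<noteq> 0" using f(2) by simp
    have aR: "a \<in> ball 0 R" "1 \<in> ball (0::complex) R" using a \<open>1 < R\<close> by auto
    then have "\<not> f constant_on ball 0 R"
      using fa \<open>f 1 \<noteq> 0\<close> unfolding constant_on_def by metis
    then obtain q r n where q: "0 < n" "0 < r" "ball a r \<subseteq> ball 0 R" "q holomorphic_on ball a r"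
        "\<And>w. w \<in> ball a r \<Longrightarrow> f w = (w - a)^n * q w" "\<And>w. w \<in> ball a r \<Longrightarrow> q w \<noteq> 0"
      using holomorphic_factor_zero_nonconstant[OF f(1) open_ball connected_ball aR(1) fa] by metis
    define u where "u = (\<lambda>z. if z = a then q a else f z / (z - a)^n)"
    have "u holomorphic_on ball a r \<union> (ball 0 R - {a})"
    proof (rule holomorphic_on_Un)
      show "u holomorphic_on ball a r"
        by (rule holomorphic_transform[OF q(4)]) (simp add: u_def q(5))
      have "(\<lambda>z. f z / (z - a)^n) holomorphic_on ball 0 R - {a}"
        using f(1) by (intro holomorphic_intros) (auto intro: holomorphic_on_subset)
      then show "u holomorphic_on ball 0 R - {a}"
        by (rule holomorphic_transform) (auto simp: u_def)
    qed auto
    then have u: "u holomorphic_on ball 0 R"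
      using q(2) by (elim holomorphic_on_subset) auto
    define v where "v = (\<lambda>z. u z * (1 - cnj a * z)^n)"
    have v: "v holomorphic_on ball 0 R" unfolding v_def by (intro holomorphic_intros u)
    have fu: "f z = u z * (z - a)^n" for z
      using fa q(1) by (simp add: u_def)
    have zero_iff: "v z = 0 \<longleftrightarrow> f z = 0 \<and> z \<noteq> a" if "norm z \<le> 1" for z
      using one_minus_mult_cnj_nonzero(2)[OF a that] q(6)[of a] q(2) by (auto simp: v_def u_def)
    \<comment> \<open>Both claims on the moduli come from this identity: equality on the circle, and
      \<open>norm (z - a) \<le> norm (1 - cnj a * z)\<close> inside.\<close>
    have norm_eq: "norm (1 - cnj a * z)^2 = norm (z - a)^2 + (1 - norm a^2) * (1 - norm z^2)" for z
      unfolding cmod_power2 by (simp add: power2_eq_square algebra_simps)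
    have "Z f = insert a (Z v)" "a \<notin> Z v"
      using zero_iff fa a by (auto simp: Z_def)
    moreover have "finite (Z v)" using \<open>Z f = insert a (Z v)\<close> finite_Z[OF f] by simp
    ultimately have "m = card (Z v)" using Suc.hyps(2) by simp
    moreover have "v \<zeta> \<noteq> 0" if "norm \<zeta> = 1" for \<zeta> using zero_iff[of \<zeta>] f(2)[OF that] that by simp
    ultimately obtain g where g: "g holomorphic_on ball 0 R" "\<forall>z. norm z \<le> 1 \<longrightarrow> g z \<noteq> 0"
      "\<forall>\<zeta>. norm \<zeta> = 1 \<longrightarrow> norm (g \<zeta>) = norm (v \<zeta>)" "\<forall>z. norm z \<le> 1 \<longrightarrow> norm (v z) \<le> norm (g z)"
      using Suc.hyps(1)[of v] v by blast
    have "norm (v \<zeta>) = norm (f \<zeta>)" if "norm \<zeta> = 1" for \<zeta>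
    proof -
      have "norm (1 - cnj a * \<zeta>)^2 = norm (\<zeta> - a)^2" using norm_eq[of \<zeta>] that by simp
      then have "norm (1 - cnj a * \<zeta>) = norm (\<zeta> - a)" by (simp add: power2_eq_iff_nonneg)
      then show ?thesis by (simp add: v_def fu norm_mult norm_power)
    qed
    moreover have "norm (f z) \<le> norm (v z)" if "norm z \<le> 1" for z
    proof -
      have "norm (z - a)^2 \<le> norm (1 - cnj a * z)^2"
        using norm_eq[of z] that a by (simp add: power_le_one)
      then have "norm (z - a) \<le> norm (1 - cnj a * z)" by (simp add: power2_le_iff_abs_le)
      then show ?thesis by (simp add: v_def fu norm_mult norm_power mult_left_mono power_mono)
    qed
    ultimately show ?case using g by (intro exI[of _ g]) (metis order_trans)
  qed
  from this[OF assms(1,3)] that show thesis by blast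
qed

lemma Carleson_sum_powr:
  fixes F :: "'a \<Rightarrow> complex \<Rightarrow> complex" and a :: "'a \<Rightarrow> complex"
  assumes I: "finite I" and R: "1 < R" and f: "f holomorphic_on ball 0 R"
    and f0: "\<And>\<zeta>. norm \<zeta> = 1 \<Longrightarrow> f \<zeta> \<noteq> 0" and p: "0 < p"
    and F: "\<And>n. n \<in> I \<Longrightarrow> F n holomorphic_on ball 0 R"
    and M: "\<And>\<zeta>. norm \<zeta> = 1 \<Longrightarrow> (\<Sum>n\<in>I. norm (F n \<zeta>)) \<le> M"
    and a: "\<And>n. n \<in> I \<Longrightarrow> norm (a n) < 1" and Fa: "\<And>n. n \<in> I \<Longrightarrow> F n (a n) = 1"
  shows "(\<Sum>n\<in>I. (1 - (norm (a n))^2) * norm (f (a n)) powr p) \<le> M^2 * (LINT \<zeta>|circle_measure. norm (f \<zeta>) powr p)"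
proof -
  obtain g where g: "g holomorphic_on ball 0 R" "\<And>z. norm z \<le> 1 \<Longrightarrow> g z \<noteq> 0"
    "\<And>\<zeta>. norm \<zeta> = 1 \<Longrightarrow> norm (g \<zeta>) = norm (f \<zeta>)" "\<And>z. norm z \<le> 1 \<Longrightarrow> norm (f z) \<le> norm (g z)"
    using zero_free_majorant[OF f R f0] by blast
  \<comment> \<open>The square case asks for holomorphy across the circle, so the logarithm of
    \<open>g\<close> has to exist on a disc of radius \<open>1 + e\<close>; compactness enlarges the
    zero-free region that far.\<close>
  have "open (ball 0 R \<inter> g -` (- {0}))"
    by (intro continuous_open_preimage holomorphic_on_imp_continuous_on g) auto
  moreover have "cball 0 1 \<subseteq> ball 0 R \<inter> g -` (- {0})" using g(2) R by auto
  ultimately obtain e where e: "0 < e" "(\<Union>x\<in>cball 0 1. cball x e) \<subseteq> ball 0 R \<inter> g -` (- {0})"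
    using compact_subset_open_imp_cball_epsilon_subset[OF compact_cball] by blast
  have sub: "ball 0 (1 + e) \<subseteq> ball 0 R \<inter> g -` (- {0})"
  proof
    fix z :: complex assume z: "z \<in> ball 0 (1 + e)"
    have "z \<in> (\<Union>x\<in>cball 0 1. cball x e)"
    proof (cases "norm z \<le> 1")
      case False
      then have "z \<noteq> 0" by (metis norm_zero zero_le_one)
      have "dist (z / norm z) z = norm z - 1"
      proof -
        have "z / norm z - z = z * of_real (1 / norm z - 1)" by (simp add: algebra_simps divide_inverse)
        then have "dist (z / norm z) z = norm z * \<bar>1 / norm z - 1\<bar>"
          by (simp only: dist_norm norm_mult norm_of_real)
        also have "\<dots> = norm z - 1" using False \<open>z \<noteq> 0\<close> by (simp add: abs_if field_simps)
        finally show ?thesis .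
      qed
      then show ?thesis using z False \<open>z \<noteq> 0\<close> by (intro UN_I[of "z / norm z"]) (auto simp: norm_divide)
    qed (use e in \<open>auto intro!: bexI[of _ z]\<close>)
    then show "z \<in> ball 0 R \<inter> g -` (- {0})" using e by blast
  qed
  have "convex (ball (0::complex) (1 + e))" "\<And>z. z \<in> ball 0 (1 + e) \<Longrightarrow> g z \<noteq> 0" using sub by auto
  moreover have "g holomorphic_on ball 0 (1 + e)" by (rule holomorphic_on_subset[OF g(1)]) (use sub in auto)
  ultimately obtain l where l: "l holomorphic_on ball 0 (1 + e)" "\<And>z. z \<in> ball 0 (1 + e) \<Longrightarrow> g z = exp (l z)"
    using contractible_imp_holomorphic_log[OF _ convex_imp_contractible] by metis
  define h where "h = (\<lambda>z. exp (of_real (p / 2) * l z))"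
  have h: "h holomorphic_on ball 0 (1 + e)" unfolding h_def by (intro holomorphic_intros l)
  have hg: "(norm (h z))^2 = norm (g z) powr p" if "norm z \<le> 1" for z
  proof -
    have "norm (g z) powr p = exp (p * Re (l z))" using l(2)[of z] that e by (simp add: powr_def)
    also have "\<dots> = (exp (p / 2 * Re (l z)))^2" by (simp add: power2_eq_square exp_add[symmetric])
    finally show ?thesis by (simp add: h_def)
  qed
  \<comment> \<open>\<open>f\<close> is dominated by \<open>g\<close> inside the disc, where the sum
    is taken, and has the same modulus on the circle, where the integral is taken.\<close>
  have "(\<Sum>n\<in>I. (1 - (norm (a n))^2) * norm (f (a n)) powr p) \<le> (\<Sum>n\<in>I. (1 - (norm (a n))^2) * (norm (h (a n)))^2)"
  proof (intro sum_mono mult_left_mono)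
    fix n assume "n \<in> I"
    then have n: "norm (a n) \<le> 1" using a less_imp_le by blast
    show "norm (f (a n)) powr p \<le> (norm (h (a n)))^2"
      unfolding hg[OF n] using g(4)[OF n] p by (intro powr_mono2) auto
    show "0 \<le> 1 - (norm (a n))^2" using n by (simp add: power_le_one)
  qed
  also have "\<dots> \<le> M^2 * (LINT \<zeta>|circle_measure. (norm (h \<zeta>))^2)"
  proof (rule Carleson_sum_square[OF I _ _ _ M a Fa])
    show "1 < min R (1 + e)" using R e by simp
    show "h holomorphic_on ball 0 (min R (1 + e))" by (rule holomorphic_on_subset[OF h]) auto
    show "F n holomorphic_on ball 0 (min R (1 + e))" if "n \<in> I" for n by (rule holomorphic_on_subset[OF F[OF that]]) auto
  qed auto
  also have "(LINT \<zeta>|circle_measure. (norm (h \<zeta>))^2) = (LINT \<zeta>|circle_measure. norm (f \<zeta>) powr p)"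
    by (rule Bochner_Integration.integral_cong) (auto simp: hg g(3))
  finally show ?thesis .
qed

text \<open>The \<open>p\<close>-th power of \<open>hardy_mean\<close>: without the root it is
  subadditive up to the factor \<open>2 powr p\<close> for every \<open>p > 0\<close>.\<close>

definition pmean :: "real \<Rightarrow> (complex \<Rightarrow> complex) \<Rightarrow> real \<Rightarrow> real" where
  "pmean p f r = (LINT \<zeta>|circle_measure. norm (f (of_real r * \<zeta>)) powr p)"

lemma pmean_nonneg: "0 \<le> pmean p f r"
  by (simp add: pmean_def)

text \<open>Only radii close to 1 matter, so that a bound for a quotient by a finite Blaschke
  product can be read off near the circle, without monotonicity of the means.\<close>

lemma Carleson_sum_disc:
  fixes F :: "'a \<Rightarrow> complex \<Rightarrow> complex" and a :: "'a \<Rightarrow> complex"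
  assumes I: "finite I" and f: "f holomorphic_on ball 0 1" and p: "0 < p"
    and F: "\<And>n. n \<in> I \<Longrightarrow> F n holomorphic_on ball 0 1"
    and M: "\<And>z. norm z < 1 \<Longrightarrow> (\<Sum>n\<in>I. norm (F n z)) \<le> M"
    and a: "\<And>n. n \<in> I \<Longrightarrow> norm (a n) < 1" and Fa: "\<And>n. n \<in> I \<Longrightarrow> F n (a n) = 1"
    and r0: "r0 < 1" and B: "\<And>r. r0 < r \<Longrightarrow> 0 < r \<Longrightarrow> r < 1 \<Longrightarrow> pmean p f r \<le> B"
  shows "(\<Sum>n\<in>I. (1 - (norm (a n))^2) * norm (f (a n)) powr p) \<le> M^2 * B"
proof (cases "\<forall>z\<in>ball 0 1. f z = 0")
  case True
  have "max r0 0 < 1" using r0 by simp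
  then obtain r where "max r0 0 < r" "r < 1" using dense by blast
  then have "0 \<le> B" using B[of r] pmean_nonneg[of p f r] by linarith
  then show ?thesis using True a p by simp
next
  case False
  then have nz: "\<exists>z\<in>ball 0 1. f z \<noteq> 0" by blast
  \<comment> \<open>The sum for the dilated function at the points \<open>a n / r\<close>; it tends
    to the desired sum as \<open>r\<close> tends to 1.\<close>
  define S where "S = (\<lambda>r. \<Sum>n\<in>I. (1 - (norm (a n) / r)^2) * norm (f (a n)) powr p)"
  have good: "\<exists>r. s < r \<and> r < 1 \<and> S r \<le> M^2 * B" if s: "s < 1" for s
  proof -
    \<comment> \<open>The radius has to exceed every \<open>norm (a n)\<close>, so that
      \<open>a n / r\<close> stays in the disc, and \<open>r0\<close>, so that \<open>B\<close>
      applies.\<close>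
    define T where "T = insert 0 (insert s (insert r0 ((\<lambda>n. norm (a n)) ` I)))"
    define t where "t = Max T"
    have "finite T" using I by (simp add: T_def)
    have "t < 1" using s r0 a Max_in[OF \<open>finite T\<close>] by (auto simp: t_def T_def)
    have t: "0 \<le> t" "s \<le> t" "r0 \<le> t" "\<And>n. n \<in> I \<Longrightarrow> norm (a n) \<le> t"
      unfolding t_def by (intro Max_ge \<open>finite T\<close>; simp add: T_def)+
    obtain t' where t': "t < t'" "t' < 1" using \<open>t < 1\<close> dense by blast
    have "\<not> f constant_on ball 0 1 \<or> (\<forall>z\<in>ball 0 1. f z \<noteq> 0)"
      using nz unfolding constant_on_def by metis
    then have "finite {z \<in> cball 0 t'. f z = 0}"
    proof
      assume "\<not> f constant_on ball 0 1"
      then show ?thesis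
        by (intro holomorphic_compact_finite_zeros[OF f]) (use t' in auto)
    next
      assume "\<forall>z\<in>ball 0 1. f z \<noteq> 0"
      then have "{z \<in> cball 0 t'. f z = 0} = {}" using t' by auto
      then show ?thesis by (metis finite.emptyI)
    qed
    then have "finite (norm ` {z \<in> cball 0 t'. f z = 0})" by simp
    moreover have "infinite {t<..<t'}" using t' by (simp add: infinite_Ioo)
    \<comment> \<open>Finitely many moduli of zeros cannot fill the interval, so some circle in it
      carries no zero of \<open>f\<close>.\<close>
    ultimately obtain r where r: "r \<in> {t<..<t'}" "r \<notin> norm ` {z \<in> cball 0 t'. f z = 0}"
      by (meson finite_subset subsetI)
    have r01: "0 < r" "r < 1" "s < r" "r0 < r" using r(1) t t' by auto
    have norm_r: "norm (of_real r * z) = r * norm z" for z :: complex using r01 by (simp add: norm_mult)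
    have sub: "(\<lambda>z. of_real r * z) ` ball 0 (1 / r) \<subseteq> ball (0::complex) 1"
    proof safe
      fix z :: complex assume "z \<in> ball 0 (1 / r)"
      then show "of_real r * z \<in> ball 0 1" using r01 norm_r[of z] by (simp add: field_simps dist_0_norm)
    qed
    have scale: "(\<lambda>z. u (of_real r * z)) holomorphic_on ball 0 (1 / r)" if "u holomorphic_on ball 0 1" for u
      using holomorphic_on_compose_gen[OF _ that sub] by (auto simp: o_def intro!: holomorphic_intros)
    have ra: "of_real r * (a n / of_real r) = a n" for n using r01 by simp
    have "(\<Sum>n\<in>I. (1 - (norm (a n / of_real r))^2) * norm (f (of_real r * (a n / of_real r))) powr p)
        \<le> M^2 * (LINT \<zeta>|circle_measure. norm (f (of_real r * \<zeta>)) powr p)"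
    proof (rule Carleson_sum_powr[OF I _ scale[OF f] _ p, where F="\<lambda>n z. F n (of_real r * z)"])
      show "1 < 1 / r" using r01 by simp
      show "f (of_real r * \<zeta>) \<noteq> 0" if "norm \<zeta> = 1" for \<zeta>
      proof
        assume "f (of_real r * \<zeta>) = 0"
        then have "norm (of_real r * \<zeta>) \<in> norm ` {z \<in> cball 0 t'. f z = 0}"
          using r(1) r01 that by (intro imageI) (auto simp: norm_r norm_mult)
        then show False using r(2) that by (simp add: norm_r)
      qed
      show "norm (a n / of_real r) < 1" if "n \<in> I" for n
        using t(4)[OF that] r(1) r01 by (simp add: norm_divide)
      show "(\<Sum>n\<in>I. norm (F n (of_real r * \<zeta>))) \<le> M" if "norm \<zeta> = 1" for \<zeta>
        by (rule M) (use that r01 in \<open>simp add: norm_r\<close>)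
      show "F n (of_real r * (a n / of_real r)) = 1" if "n \<in> I" for n
        using Fa[OF that] by (simp only: ra)
    qed (rule scale, rule F)
    also have "\<dots> \<le> M^2 * B"
      using B[of r] r01 by (intro mult_left_mono) (auto simp: pmean_def)
    finally have "S r \<le> M^2 * B"
      using r01 by (simp only: S_def ra) (simp add: norm_divide)
    then show ?thesis using r01 by blast
  qed
  \<comment> \<open>One good radius beyond each \<open>s < 1\<close> suffices: if \<open>S 1\<close>
    were too large, all radii close to 1 would be bad.\<close>
  have "isCont S 1" unfolding S_def by (intro continuous_intros) auto
  then have lim: "(S \<longlongrightarrow> S 1) (at_left 1)"
    by (meson isCont_def tendsto_within_subset filterlim_at_split)
  have "S 1 \<le> M^2 * B"
  proof (rule ccontr)
    assume "\<not> ?thesis"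
    then have "eventually (\<lambda>r. M^2 * B < S r) (at_left 1)" using order_tendstoD(1)[OF lim] by simp
    then obtain s where "s < 1" "\<And>r. s < r \<Longrightarrow> r < 1 \<Longrightarrow> M^2 * B < S r"
      unfolding eventually_at_left_field by blast
    then show False using good[of s] by fastforce
  qed
  then show ?thesis by (simp add: S_def)
qed

subsection \<open>Means, point evaluations and normal families\<close>

definition Hp_le :: "real \<Rightarrow> real \<Rightarrow> (complex \<Rightarrow> complex) \<Rightarrow> bool" where
  "Hp_le p A f \<longleftrightarrow> f holomorphic_on ball 0 1 \<and> (\<forall>r. 0 < r \<longrightarrow> r < 1 \<longrightarrow> pmean p f r \<le> A)"

lemma Hardy_iff:
  assumes p: "0 < p"
  shows "f \<in> Hardy p \<longleftrightarrow> (\<exists>A. Hp_le p A f)"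
proof
  have pm: "hardy_mean p f r = pmean p f r powr (1 / p)" for r
    by (simp add: hardy_mean_def pmean_def)
  assume f: "f \<in> Hardy p"
  then obtain B where B: "\<forall>r\<in>{0<..<1}. hardy_mean p f r \<le> B"
    unfolding Hardy_def bdd_above_def by auto
  have "pmean p f r \<le> B powr p" if "0 < r" "r < 1" for r
  proof -
    have "pmean p f r = (pmean p f r powr (1 / p)) powr p"
      using p pmean_nonneg[of p f r] by (simp add: powr_powr)
    also have "\<dots> \<le> B powr p" using B that p by (intro powr_mono2) (auto simp: pm)
    finally show ?thesis .
  qed
  then show "\<exists>A. Hp_le p A f" using f by (auto simp: Hp_le_def Hardy_def)
next
  assume "\<exists>A. Hp_le p A f"
  then obtain A where A: "Hp_le p A f" by blast
  have "hardy_mean p f r \<le> A powr (1 / p)" if "r \<in> {0<..<1}" for r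
    using A that p pmean_nonneg[of p f r] unfolding hardy_mean_def pmean_def[symmetric]
    by (intro powr_mono2) (auto simp: Hp_le_def)
  then show "f \<in> Hardy p" using A
    by (auto simp: Hardy_def Hp_le_def bdd_above_def intro!: exI[of _ "A powr (1 / p)"])
qed

text \<open>Comparison with twice the larger norm, which treats \<open>p < 1\<close> and
  \<open>p \<ge> 1\<close> alike.\<close>

lemma powr_norm_diff_le:
  fixes x y :: "'a::real_normed_vector"
  assumes "0 < p"
  shows "norm (x - y) powr p \<le> 2 powr p * (norm x powr p + norm y powr p)"
proof -
  have "norm (x - y) powr p \<le> (2 * max (norm x) (norm y)) powr p"
    using norm_triangle_ineq4[of x y] assms by (intro powr_mono2) auto
  also have "\<dots> = 2 powr p * (max (norm x) (norm y)) powr p" by (simp add: powr_mult)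
  also have "(max (norm x) (norm y)) powr p \<le> norm x powr p + norm y powr p" by (simp add: max_def)
  finally show ?thesis by simp
qed

lemma Hp_le_diff:
  assumes p: "0 < p" and f: "Hp_le p A f" and g: "Hp_le p B g"
  shows "Hp_le p (2 powr p * (A + B)) (\<lambda>z. f z - g z)"
  unfolding Hp_le_def
proof (intro conjI allI impI)
  have fg: "f holomorphic_on ball 0 1" "g holomorphic_on ball 0 1" using f g by (auto simp: Hp_le_def)
  show fgd: "(\<lambda>z. f z - g z) holomorphic_on ball 0 1" by (intro holomorphic_intros fg)
  fix r :: real assume r: "0 < r" "r < 1"
  note int = integrable_hardy_mean[OF _ p r]
  have "pmean p (\<lambda>z. f z - g z) r \<le> (LINT \<zeta>|circle_measure. 2 powr p * (norm (f (of_real r * \<zeta>)) powr p + norm (g (of_real r * \<zeta>)) powr p))"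
    unfolding pmean_def using powr_norm_diff_le[OF p]
    by (intro integral_mono int[OF fgd] integrable_mult_right Bochner_Integration.integrable_add int fg) auto
  also have "\<dots> = 2 powr p * (pmean p f r + pmean p g r)"
    using int[OF fg(1)] int[OF fg(2)] by (simp add: pmean_def)
  also have "\<dots> \<le> 2 powr p * (A + B)" using f g r by (intro mult_left_mono add_mono) (auto simp: Hp_le_def)
  finally show "pmean p (\<lambda>z. f z - g z) r \<le> 2 powr p * (A + B)" .
qed

lemma Hp_le_scale:
  assumes "Hp_le p A f"
  shows "Hp_le p (norm c powr p * A) (\<lambda>z. c * f z)"
  unfolding Hp_le_def
proof (intro conjI allI impI)
  show "(\<lambda>z. c * f z) holomorphic_on ball 0 1" using assms by (auto simp: Hp_le_def intro!: holomorphic_intros)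
  fix r :: real assume r: "0 < r" "r < 1"
  have "pmean p (\<lambda>z. c * f z) r = norm c powr p * pmean p f r"
    by (simp add: pmean_def norm_mult powr_mult)
  then show "pmean p (\<lambda>z. c * f z) r \<le> norm c powr p * A"
    using assms r by (simp add: Hp_le_def mult_left_mono)
qed

lemma Hp_le_mono: "Hp_le p A f \<Longrightarrow> A \<le> B \<Longrightarrow> Hp_le p B f"
  by (force simp: Hp_le_def)

text \<open>The Carleson sum for a single point, with the constant function 1 as \<open>F\<close>
  and hence \<open>M = 1\<close>.\<close>

lemma point_evaluation_bound:
  assumes f: "f holomorphic_on ball 0 1" and p: "0 < p" and a: "norm a < 1"
    and r0: "r0 < 1" and B: "\<And>r. r0 < r \<Longrightarrow> 0 < r \<Longrightarrow> r < 1 \<Longrightarrow> pmean p f r \<le> B"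
  shows "(1 - (norm a)^2) * norm (f a) powr p \<le> B"
  using Carleson_sum_disc[of "{()}" f p "\<lambda>_ _. 1" 1 "\<lambda>_. a" r0 B] assms by auto

lemma Hp_le_point:
  assumes "Hp_le p A f" "0 < p" "norm a < 1"
  shows "(1 - (norm a)^2) * norm (f a) powr p \<le> A"
  by (rule point_evaluation_bound[of f p a 0]) (use assms in \<open>auto simp: Hp_le_def\<close>)

lemma Hp_le_point':
  assumes f: "Hp_le p A f" and p: "0 < p" and a: "norm a \<le> r" "r < 1"
  shows "norm (f a) powr p \<le> A / (1 - r^2)"
proof -
  have 1: "norm a ^ 2 \<le> r^2" using a by (intro power_mono) auto
  have 2: "r^2 < 1" using a order_trans[OF norm_ge_zero a(1)] by (simp add: abs_square_less_1)
  have "(1 - r^2) * norm (f a) powr p \<le> (1 - (norm a)^2) * norm (f a) powr p"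
    using 1 by (intro mult_right_mono) auto
  also have "\<dots> \<le> A" using a by (intro Hp_le_point[OF f p]) auto
  finally show ?thesis using 2 by (simp add: field_simps)
qed

text \<open>Point evaluations bound the family on compact sets. On a fixed circle they also give the
  constant majorant with which dominated convergence passes the bound \<open>A\<close> to the
  limit.\<close>

lemma Hp_le_Montel:
  assumes p: "0 < p" and f: "\<And>i::nat. Hp_le p A (f i)"
  obtains g s where "Hp_le p A g" "strict_mono (s::nat \<Rightarrow> nat)"
    "\<And>z. norm z < 1 \<Longrightarrow> (\<lambda>i. f (s i) z) \<longlonglongrightarrow> g z"
proof -
  have holf: "f i holomorphic_on ball 0 1" for i using f by (simp add: Hp_le_def)
  obtain g s where gs: "g holomorphic_on ball 0 1" "strict_mono (s::nat \<Rightarrow> nat)"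
    "\<And>x. x \<in> ball 0 1 \<Longrightarrow> ((\<lambda>n. f (s n) x) \<longlonglongrightarrow> g x)"
  proof (rule Montel[of "ball 0 1" "range f" f])
    fix K :: "complex set" assume K: "compact K" "K \<subseteq> ball 0 1"
    obtain r where r: "r < 1" "K \<subseteq> cball 0 r"
    proof (cases "K = {}")
      case False
      have "compact (norm ` K)" using K by (intro compact_continuous_image continuous_intros)
      then obtain z where z: "z \<in> K" "\<forall>y\<in>K. norm y \<le> norm z"
        using compact_attains_sup[of "norm ` K"] False by auto
      then show ?thesis using K by (intro that[of "norm z"]) auto
    qed (use that[of 0] in auto)
    have "norm (f i z) \<le> (A / (1 - r^2)) powr (1 / p)" if "z \<in> K" for i z
    proof -
      have "norm (f i z) = (norm (f i z) powr p) powr (1 / p)" using p by (simp add: powr_powr)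
      also have "\<dots> \<le> (A / (1 - r^2)) powr (1 / p)"
        using Hp_le_point'[OF f p, of z r] r that p by (intro powr_mono2) auto
      finally show ?thesis .
    qed
    then show "\<exists>B. \<forall>h\<in>range f. \<forall>z\<in>K. norm (h z) \<le> B" by blast
  qed (use holf in auto)
  have "pmean p g r \<le> A" if r: "0 < r" "r < 1" for r
  proof -
    have c: "continuous_on (sphere 0 1) (\<lambda>\<zeta>. norm (u (of_real r * \<zeta>)) powr p)" if "u holomorphic_on ball 0 1" for u
      using r p by (intro continuous_on_powr' continuous_intros continuous_on_compose2[OF holomorphic_on_imp_continuous_on[OF that]]) (auto simp: norm_mult)
    have "(\<lambda>i. pmean p (f (s i)) r) \<longlonglongrightarrow> pmean p g r"
      unfolding pmean_def
    proof (rule integral_dominated_convergence[where w="\<lambda>_. A / (1 - r^2)"])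
      show "AE \<zeta> in circle_measure. (\<lambda>i. norm (f (s i) (of_real r * \<zeta>)) powr p) \<longlonglongrightarrow> norm (g (of_real r * \<zeta>)) powr p"
        using r p by (intro AE_I2 tendsto_powr' tendsto_norm gs tendsto_const) (auto simp: norm_mult)
      show "AE \<zeta> in circle_measure. norm (norm (f (s i) (of_real r * \<zeta>)) powr p) \<le> A / (1 - r^2)" for i
        using Hp_le_point'[OF f p, of _ r] r by (intro AE_I2) (auto simp: norm_mult)
    qed (auto intro!: measurable_circle c gs holf)
    then show ?thesis by (rule LIMSEQ_le_const2) (use f r in \<open>auto simp: Hp_le_def\<close>)
  qed
  then show thesis using gs by (intro that[of g s]) (auto simp: Hp_le_def)
qed

lemma bounded_Montel:
  assumes f: "\<And>i::nat. f i holomorphic_on ball 0 1" "\<And>i z. norm z < 1 \<Longrightarrow> norm (f i z) \<le> M"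
  obtains g s where "g holomorphic_on ball 0 1" "\<And>z. norm z < 1 \<Longrightarrow> norm (g z) \<le> M"
    "strict_mono (s::nat \<Rightarrow> nat)" "\<And>z. norm z < 1 \<Longrightarrow> (\<lambda>i. f (s i) z) \<longlonglongrightarrow> g z"
proof -
  obtain g s where gs: "g holomorphic_on ball 0 1" "strict_mono (s::nat \<Rightarrow> nat)"
    "\<And>x. x \<in> ball 0 1 \<Longrightarrow> ((\<lambda>n. f (s n) x) \<longlonglongrightarrow> g x)"
  proof (rule Montel[of "ball 0 1" "range f" f])
    fix K :: "complex set" assume "K \<subseteq> ball 0 1"
    then show "\<exists>B. \<forall>h\<in>range f. \<forall>z\<in>K. norm (h z) \<le> B" using f by (intro exI[of _ M]) auto
  qed (use f in auto)
  have "norm (g z) \<le> M" if "norm z < 1" for z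
    by (rule LIMSEQ_le_const2[OF tendsto_norm[OF gs(3)]]) (use that f in auto)
  then show thesis using gs by (intro that[of g s]) auto
qed

lemma suminf_Fatou:
  fixes t :: "nat \<Rightarrow> nat \<Rightarrow> real"
  assumes t0: "\<And>i n. 0 \<le> t i n" and s: "\<And>i. summable (t i)" and c: "\<And>i. suminf (t i) \<le> c"
    and lim: "\<And>n. (\<lambda>i. t i n) \<longlonglongrightarrow> x n"
  shows "summable x" "suminf x \<le> c"
proof -
  have x0: "0 \<le> x n" for n by (rule LIMSEQ_le_const[OF lim]) (use t0 in auto)
  have le: "(\<Sum>k<n. x k) \<le> c" for n
  proof (rule LIMSEQ_le_const2[OF tendsto_sum[OF lim]])
    have "(\<Sum>k<n. t i k) \<le> c" for i
      using sum_le_suminf[OF s[of i], of "{..<n}"] t0 c[of i] by (auto intro: order_trans)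
    then show "\<exists>N. \<forall>i\<ge>N. (\<Sum>k<n. t i k) \<le> c" by blast
  qed
  show "summable x" by (rule summableI_nonneg_bounded[OF x0 le])
  then show "suminf x \<le> c" by (rule suminf_le_const[OF _ le])
qed

subsection \<open>From interpolation to a closed range\<close>

text \<open>The open mapping theorem for the restriction map onto bounded sequences: the Baire lemma
  with \<open>R = V\<close> and with \<open>A m\<close> the traces of functions bounded by
  \<open>m\<close>.\<close>

lemma interpolation_constant:
  assumes z: "interpolating_sequence z"
  obtains M where "0 < M" "\<And>a. (\<And>n. norm (a n) \<le> 1) \<Longrightarrow>
    \<exists>f. f holomorphic_on ball 0 1 \<and> (\<forall>w. norm w < 1 \<longrightarrow> norm (f w) \<le> M) \<and> (\<forall>n. f (z n) = a n)"
proof -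
  have zb: "norm (z n) < 1" for n using z by (auto simp: interpolating_sequence_def image_subset_iff)
  define V where "V = {x::nat \<Rightarrow> complex. bounded (range x)}"
  \<comment> \<open>The value 0 for unbounded sequences keeps \<open>N\<close> nonnegative and
    symmetric everywhere, as the Baire lemma demands.\<close>
  define N where "N = (\<lambda>x::nat \<Rightarrow> complex. if bounded (range x) then SUP n. norm (x n) else 0)"
  define A where "A = (\<lambda>m. {x. \<exists>f. f holomorphic_on ball 0 1 \<and> (\<forall>w. norm w < 1 \<longrightarrow> norm (f w) \<le> real m) \<and> (\<forall>n. f (z n) = x n)})"
  have bdd: "bdd_above (range (\<lambda>n. norm (x n)))" if "x \<in> V" for x
    using that by (auto simp: V_def bounded_iff bdd_above_def)
  have le_N: "norm (x n) \<le> N x" if "x \<in> V" for x n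
    using cSUP_upper[OF _ bdd[OF that], of n] that by (simp add: N_def V_def)
  have N_le: "x \<in> V \<and> N x \<le> c" if "\<And>n. norm (x n) \<le> c" for x c
  proof -
    have "x \<in> V" using that by (auto simp: V_def bounded_iff)
    then show ?thesis using that by (auto simp: N_def V_def intro!: cSUP_least)
  qed
  have V_diff: "(\<lambda>n. x n - y n) \<in> V" if "x \<in> V" "y \<in> V" for x y
    using bounded_minus_comp[of x UNIV y] that by (simp add: V_def)
  have "\<exists>m. \<exists>e>0. \<forall>x\<in>V. N x < e \<longrightarrow> x \<in> A m"
  proof (rule baire_lower_semicontinuous[where K=1 and V=V and \<phi>="\<lambda>m. 2 * m"])
    show "(\<lambda>n. x n - y n) \<in> V" if "x \<in> V" "y \<in> V" for x y by (rule V_diff[OF that])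
    show "0 \<le> N x" for x
      using order_trans[OF norm_ge_zero le_N[of x 0]] by (cases "x \<in> V") (auto simp: N_def V_def)
    show "N (\<lambda>n. 0) = 0" by (simp add: N_def)
    show "N (\<lambda>n. x n - y n) = N (\<lambda>n. y n - x n)" for x y
    proof -
      have "bounded (range (\<lambda>n. x n - y n)) \<longleftrightarrow> bounded (range (\<lambda>n. y n - x n))"
        by (simp add: bounded_iff norm_minus_commute)
      then show ?thesis by (simp add: N_def norm_minus_commute)
    qed
    show "N (\<lambda>n. x n - w n) \<le> 1 * (N (\<lambda>n. x n - y n) + N (\<lambda>n. y n - w n))" if "x \<in> V" "y \<in> V" "w \<in> V" for x y w
    proof -
      have "norm (x n - w n) \<le> N (\<lambda>n. x n - y n) + N (\<lambda>n. y n - w n)" for n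
        using le_N[OF V_diff[OF that(1,2)], of n] le_N[OF V_diff[OF that(2,3)], of n]
          norm_triangle_ineq[of "x n - y n" "y n - w n"] by simp
      then show ?thesis using N_le by simp
    qed
    show "\<exists>d>0. \<forall>x\<in>V. N x < d \<longrightarrow> norm (x n) < e" if "0 < e" for n e
      using le_N that by (intro exI[of _ e]) (auto intro: le_less_trans)
    show "x \<in> V \<and> N x \<le> c" if u: "\<And>i. u i \<in> V" "\<And>i. N (u i) \<le> c" "\<And>n. (\<lambda>i. u i n) \<longlonglongrightarrow> x n" for u x c
    proof (rule N_le)
      show "norm (x n) \<le> c" for n
        by (rule LIMSEQ_le_const2[OF tendsto_norm[OF u(3)]]) (use u le_N in \<open>blast intro: order_trans\<close>)
    qed
    show "(\<lambda>n. 0) \<in> V" by (simp add: V_def)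
    show "(\<lambda>n. x n + y n) \<in> V" if "x \<in> V" "y \<in> V" for x y
      using bounded_plus_comp[of x UNIV y] that by (simp add: V_def)
    show "x \<in> A m" if u: "\<And>i. u i \<in> A m" "\<And>n. (\<lambda>i. u i n) \<longlonglongrightarrow> x n" for m u x
    proof -
      have "\<forall>i. \<exists>f. f holomorphic_on ball 0 1 \<and> (\<forall>w. norm w < 1 \<longrightarrow> norm (f w) \<le> real m) \<and> (\<forall>n. f (z n) = u i n)"
        using u(1) by (simp add: A_def)
      from choice[OF this] obtain f where f: "\<And>i. f i holomorphic_on ball 0 1"
        "\<And>i w. norm w < 1 \<Longrightarrow> norm (f i w) \<le> real m" "\<And>i n. f i (z n) = u i n" by blast
      obtain g s where gs: "g holomorphic_on ball 0 1" "\<And>z. norm z < 1 \<Longrightarrow> norm (g z) \<le> real m"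
        "strict_mono (s::nat \<Rightarrow> nat)" "\<And>z. norm z < 1 \<Longrightarrow> (\<lambda>i. f (s i) z) \<longlonglongrightarrow> g z"
        by (rule bounded_Montel[of f "real m"]) (simp_all add: f)
      have "g (z n) = x n" for n
        using LIMSEQ_unique[OF gs(4)[OF zb[of n]]] LIMSEQ_subseq_LIMSEQ[OF u(2) gs(3), of n]
        by (simp add: f(3) o_def)
      then show ?thesis using gs by (auto simp: A_def)
    qed
    have AV: "A m \<subseteq> V" for m
    proof
      fix x assume "x \<in> A m"
      then obtain f where "\<And>w. norm w < 1 \<Longrightarrow> norm (f w) \<le> real m" "\<And>n. f (z n) = x n"
        unfolding A_def by blast
      then show "x \<in> V" using N_le[of x "real m"] zb by metis
    qed
    show "V = (\<Union>m. A m)"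
    proof (intro equalityI subsetI)
      fix x assume "x \<in> V"
      then have "x \<in> {\<lambda>n. f (z n) | f. f \<in> Hardy_inf}"
        using z by (simp add: V_def interpolating_sequence_def)
      then obtain f where f: "x = (\<lambda>n. f (z n))" "f \<in> Hardy_inf" by blast
      then obtain B where B: "\<forall>w\<in>ball 0 1. norm (f w) \<le> B" by (auto simp: Hardy_inf_def bounded_iff)
      obtain m where "B \<le> real m" using real_arch_simple by blast
      then have "norm (f w) \<le> real m" if "norm w < 1" for w
        using bspec[OF B, of w] that by auto
      then have "x \<in> A m" using f by (auto simp: A_def Hardy_inf_def)
      then show "x \<in> (\<Union>m. A m)" by blast
    qed (use AV in blast)
    show "(\<lambda>n. x n - y n) \<in> A (2 * m)" if xy: "x \<in> A m" "y \<in> A m" for m x y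
    proof -
      obtain f g where fg: "f holomorphic_on ball 0 1" "\<And>w. norm w < 1 \<Longrightarrow> norm (f w) \<le> real m" "\<And>n. f (z n) = x n"
         "g holomorphic_on ball 0 1" "\<And>w. norm w < 1 \<Longrightarrow> norm (g w) \<le> real m" "\<And>n. g (z n) = y n"
        using xy unfolding A_def by blast
      have "norm (f w - g w) \<le> real (2 * m)" if "norm w < 1" for w
        using norm_triangle_ineq4[of "f w" "g w"] fg(2)[OF that] fg(5)[OF that] by simp
      then show ?thesis unfolding A_def using fg
        by (auto intro!: exI[of _ "\<lambda>w. f w - g w"] holomorphic_intros)
    qed
  qed auto
  then obtain m e where e: "0 < e" "\<And>x. x \<in> V \<Longrightarrow> N x < e \<Longrightarrow> x \<in> A m" by blast
  show thesis
  \<comment> \<open>The data are shrunk to norm at most \<open>e / 2\<close>, interpolated with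
    bound \<open>m\<close> and scaled back; the summand 1 keeps the constant positive for
    \<open>m = 0\<close>.\<close>
  proof (rule that[of "2 * real m / e + 1"])
    show "0 < 2 * real m / e + 1" using e by (simp add: add_nonneg_pos)
    fix a :: "nat \<Rightarrow> complex" assume a: "\<And>n. norm (a n) \<le> 1"
    define x where "x = (\<lambda>n. of_real (e / 2) * a n)"
    have "norm (x n) \<le> e / 2" for n
      using a[of n] e by (simp add: x_def norm_mult)
    then have "x \<in> V" "N x \<le> e / 2" using N_le by blast+
    then have "x \<in> A m" using e by auto
    then obtain f where f: "f holomorphic_on ball 0 1" "\<And>w. norm w < 1 \<Longrightarrow> norm (f w) \<le> real m" "\<And>n. f (z n) = x n"
      by (auto simp: A_def)
    show "\<exists>f. f holomorphic_on ball 0 1 \<and> (\<forall>w. norm w < 1 \<longrightarrow> norm (f w) \<le> 2 * real m / e + 1) \<and> (\<forall>n. f (z n) = a n)"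
    proof (intro exI conjI allI impI)
      show "(\<lambda>w. of_real (2 / e) * f w) holomorphic_on ball 0 1" by (intro holomorphic_intros f)
      show "norm (of_real (2 / e) * f w) \<le> 2 * real m / e + 1" if "norm w < 1" for w
      proof -
        have "norm (of_real (2 / e) * f w) = (2 / e) * norm (f w)" using e by (simp only: norm_mult norm_of_real) simp
        also have "\<dots> \<le> (2 / e) * real m" using f(2)[OF that] e by (intro mult_left_mono) auto
        finally show ?thesis by simp
      qed
      show "of_real (2 / e) * f (z n) = a n" for n
        using e by (simp add: f(3) x_def)
    qed
  qed
qed

section \<open>Characters of finite cyclic groups and averaged interpolating functions\<close>

definition root_char :: "nat \<Rightarrow> nat \<Rightarrow> nat \<Rightarrow> complex" where
  "root_char N j k = exp (2 * of_real pi * \<i> * of_nat j / of_nat N) ^ k"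

lemma root_char_commute: "root_char N j k = root_char N k j"
  by (simp add: root_char_def exp_of_nat_mult[symmetric] mult_ac)

lemma norm_root_char [simp]: "norm (root_char N j k) = 1"
  by (simp add: root_char_def norm_power)

text \<open>The quotient of two different characters is generated by an \<open>N\<close>-th root of
  unity other than 1, whose powers sum to zero.\<close>

lemma root_char_orthogonal:
  assumes "i < N" "j < N"
  shows "(\<Sum>k<N. root_char N i k * cnj (root_char N j k)) = (if i = j then of_nat N else 0)"
proof -
  define e where "e = (\<lambda>j::nat. exp (2 * of_real pi * \<i> * of_nat j / of_nat N))"
  have ne: "norm (e j) = 1" for j by (simp add: e_def)
  have eN: "e j ^ N = 1" for j using complex_root_unity[of N j] assms by (simp add: e_def)
  define x where "x = e i * cnj (e j)"
  have e1: "e j * cnj (e j) = 1" for j using complex_norm_square[of "e j"] ne by simp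
  have sum: "(\<Sum>k<N. root_char N i k * cnj (root_char N j k)) = (\<Sum>k<N. x ^ k)"
    by (simp add: root_char_def e_def x_def power_mult_distrib)
  show ?thesis
  proof (cases "i = j")
    case True then show ?thesis unfolding sum by (simp add: x_def e1)
  next
    case False
    have "x \<noteq> 1"
    proof
      assume "x = 1"
      then have "e i * cnj (e j) = e j * cnj (e j)" using e1[of j] by (simp only: x_def)
      moreover have "cnj (e j) \<noteq> 0" by (simp add: e_def)
      ultimately have "e i = e j" by (metis mult_right_cancel)
      then have "i mod N = j mod N" using complex_root_unity_eq[of N i j] assms by (simp add: e_def)
      then show False using False assms by simp
    qed
    moreover have "x ^ N = 1" by (simp only: x_def power_mult_distrib complex_cnj_power[symmetric] eN) simp
    ultimately show ?thesis unfolding sum using False by (simp add: geometric_sum)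
  qed
qed

lemma Parseval_roots:
  "(\<Sum>k<N. (norm (\<Sum>j<N. root_char N j k * c j))^2) = real N * (\<Sum>j<N. (norm (c j))^2)"
proof -
  have "complex_of_real (\<Sum>k<N. (norm (\<Sum>j<N. root_char N j k * c j))^2)
      = (\<Sum>k<N. (\<Sum>i<N. root_char N i k * c i) * (\<Sum>j<N. cnj (root_char N j k) * cnj (c j)))"
    by (simp only: of_real_sum complex_norm_square cnj_sum complex_cnj_mult)
  also have "\<dots> = (\<Sum>k<N. \<Sum>i<N. \<Sum>j<N. (c i * cnj (c j)) * (root_char N i k * cnj (root_char N j k)))"
    by (simp add: sum_product mult_ac)
  also have "\<dots> = (\<Sum>i<N. \<Sum>j<N. \<Sum>k<N. (c i * cnj (c j)) * (root_char N i k * cnj (root_char N j k)))"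
    by (subst sum.swap, rule sum.cong[OF refl], rule sum.swap)
  also have "\<dots> = (\<Sum>i<N. \<Sum>j<N. (c i * cnj (c j)) * (if i = j then of_nat N else 0))"
    by (intro sum.cong refl) (simp add: sum_distrib_left[symmetric] root_char_orthogonal)
  also have "\<dots> = (\<Sum>i<N. of_nat N * (c i * cnj (c i)))"
  proof (intro sum.cong refl)
    fix i assume "i \<in> {..<N}"
    have "(\<Sum>j<N. (c i * cnj (c j)) * (if i = j then of_nat N else 0)) = (\<Sum>j<N. if i = j then of_nat N * (c i * cnj (c j)) else 0)"
      by (intro sum.cong refl) auto
    also have "\<dots> = of_nat N * (c i * cnj (c i))" using \<open>i \<in> {..<N}\<close> by simp
    finally show "(\<Sum>j<N. (c i * cnj (c j)) * (if i = j then of_nat N else 0)) = of_nat N * (c i * cnj (c i))" .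
  qed
  also have "\<dots> = complex_of_real (real N * (\<Sum>j<N. (norm (c j))^2))"
    by (simp only: of_real_mult of_real_sum complex_norm_square sum_distrib_left of_real_of_nat_eq)
  finally show ?thesis by (simp only: of_real_eq_iff)
qed

text \<open>Varopoulos: interpolate the characters of the cyclic group of order \<open>N\<close> and average;
  the squares keep the interpolation values 0 and 1.\<close>

lemma Beurling_functions:
  fixes N :: nat
  assumes M: "\<And>a. (\<And>n. norm (a n) \<le> 1) \<Longrightarrow>
    \<exists>f. f holomorphic_on ball 0 1 \<and> (\<forall>w. norm w < 1 \<longrightarrow> norm (f w) \<le> M) \<and> (\<forall>n. f (z n) = a n)"
  shows "\<exists>F. (\<forall>k. F k holomorphic_on ball 0 1) \<and> (\<forall>w. norm w < 1 \<longrightarrow> (\<Sum>k<N. norm (F k w)) \<le> M^2)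
    \<and> (\<forall>k<N. \<forall>l<N. F k (z l) = (if k = l then 1 else 0))"
proof (cases "N = 0")
  case True
  then show ?thesis by (intro exI[of _ "\<lambda>_ _. 0"]) auto
next
  case False
  have "\<forall>j. \<exists>f. f holomorphic_on ball 0 1 \<and> (\<forall>w. norm w < 1 \<longrightarrow> norm (f w) \<le> M) \<and> (\<forall>n. f (z n) = cnj (root_char N j n))"
    by (intro allI M) simp
  from choice[OF this] obtain f where f: "\<And>j. f j holomorphic_on ball 0 1"
    "\<And>j w. norm w < 1 \<Longrightarrow> norm (f j w) \<le> M" "\<And>j n. f j (z n) = cnj (root_char N j n)" by blast
  \<comment> \<open>A discrete Fourier transform in \<open>j\<close>; by orthogonality
    \<open>g k\<close> is 1 at \<open>z k\<close> and 0 at the other points with index below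
    \<open>N\<close>.\<close>
  define g where "g = (\<lambda>k w. (\<Sum>j<N. root_char N j k * f j w) / of_nat N)"
  show ?thesis
  proof (intro exI[of _ "\<lambda>k w. (g k w)^2"] conjI allI impI)
    show "(\<lambda>w. (g k w)^2) holomorphic_on ball 0 1" for k
      unfolding g_def using False by (intro holomorphic_intros f) auto
    fix w :: complex assume w: "norm w < 1"
    \<comment> \<open>By Parseval this sum is the mean of \<open>(norm (f j w))^2\<close> over
      \<open>j\<close>, whence a bound independent of \<open>N\<close>.\<close>
    have "(\<Sum>k<N. norm ((g k w)^2)) = (\<Sum>k<N. (norm (\<Sum>j<N. root_char N j k * f j w))^2 / (real N)^2)"
      by (simp add: g_def norm_power norm_divide power_divide)
    also have "\<dots> = (\<Sum>k<N. (norm (\<Sum>j<N. root_char N j k * f j w))^2) / (real N)^2"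
      by (rule sum_divide_distrib[symmetric])
    also have "\<dots> = real N * (\<Sum>j<N. (norm (f j w))^2) / (real N)^2"
      by (simp add: Parseval_roots)
    also have "\<dots> \<le> real N * (\<Sum>j<N. M^2) / (real N)^2"
      using f(2)[OF w] by (intro divide_right_mono mult_left_mono sum_mono power_mono) auto
    also have "\<dots> = M^2" using False by (simp add: power2_eq_square)
    finally show "(\<Sum>k<N. norm ((g k w)^2)) \<le> M^2" .
  next
    fix k l assume kl: "k < N" "l < N"
    have "g k (z l) = (\<Sum>j<N. root_char N k j * cnj (root_char N l j)) / of_nat N"
      by (simp add: g_def f(3) root_char_commute[of N k] root_char_commute[of N l])
    also have "\<dots> = (if k = l then 1 else 0)"
      using root_char_orthogonal[OF kl] False by simp
    finally show "(g k (z l))^2 = (if k = l then 1 else 0)" by simp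
  qed
qed

text \<open>All \<open>t n\<close> are replaced by the largest one, whose \<open>p\<close>-th power
  is a term on the right; the argument is the same for \<open>p\<close> below and above 1.\<close>

lemma weighted_sum_powr_le:
  fixes t u :: "'a \<Rightarrow> real"
  assumes I: "finite I" and u: "\<And>n. n \<in> I \<Longrightarrow> 0 \<le> u n" and t: "\<And>n. n \<in> I \<Longrightarrow> 0 \<le> t n"
    and M: "(\<Sum>n\<in>I. u n) \<le> M" and p: "0 < p"
  shows "(\<Sum>n\<in>I. u n * t n) powr p \<le> M powr p * (\<Sum>n\<in>I. t n powr p)"
proof (cases "I = {}")
  case False
  \<comment> \<open>Minimising \<open>- t\<close> selects an index where \<open>t\<close> is
    largest.\<close>
  define k where "k = arg_min_on (\<lambda>n. - t n) I"
  have k: "k \<in> I" "\<And>n. n \<in> I \<Longrightarrow> t n \<le> t k"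
    using arg_min_if_finite(1)[OF I False, of "\<lambda>n. - t n"] arg_min_least[OF I False, where f="\<lambda>n. - t n"]
    by (simp_all add: k_def)
  have "0 \<le> (\<Sum>n\<in>I. u n)" by (rule sum_nonneg) (rule u)
  then have "0 \<le> M" using M by (rule order_trans)
  have "(\<Sum>n\<in>I. u n * t n) \<le> (\<Sum>n\<in>I. u n) * t k"
    unfolding sum_distrib_right by (intro sum_mono mult_left_mono u k(2))
  also have "\<dots> \<le> M * t k" using M t[OF k(1)] by (rule mult_right_mono)
  finally have "(\<Sum>n\<in>I. u n * t n) \<le> M * t k" .
  moreover have "0 \<le> (\<Sum>n\<in>I. u n * t n)" by (intro sum_nonneg mult_nonneg_nonneg u t)
  ultimately have "(\<Sum>n\<in>I. u n * t n) powr p \<le> (M * t k) powr p"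
    using p by (intro powr_mono2) simp_all
  also have "\<dots> = M powr p * t k powr p"
    using \<open>0 \<le> M\<close> t[OF k(1)] by (simp add: powr_mult)
  also have "\<dots> \<le> M powr p * (\<Sum>n\<in>I. t n powr p)"
    using k I by (intro mult_left_mono member_le_sum) auto
  finally show ?thesis .
qed simp

text \<open>Combines \<open>1 - |a|^2 \<le> 2 * (1 - |a|)\<close> with
  \<open>1 - |a| \<le> norm (1 - cnj a * z)\<close>.\<close>

lemma norm_kernel_le:
  assumes a: "norm a < 1" and z: "norm z \<le> 1"
  shows "norm (of_real (1 - (norm a)^2) / (1 - cnj a * z)) \<le> 2"
proof -
  have "norm (cnj a * z) \<le> norm a * 1" unfolding norm_mult complex_mod_cnj using z by (intro mult_left_mono) auto
  then have "1 - norm a \<le> norm (1 - cnj a * z)" using norm_triangle_ineq2[of 1 "cnj a * z"] by simp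
  have "0 \<le> (1 - norm a)^2" by simp
  then have "1 - (norm a)^2 \<le> 2 * (1 - norm a)" by (simp add: power2_diff)
  also have "\<dots> \<le> 2 * norm (1 - cnj a * z)"
    using \<open>1 - norm a \<le> norm (1 - cnj a * z)\<close> by (rule mult_left_mono) simp
  finally have le: "1 - (norm a)^2 \<le> 2 * norm (1 - cnj a * z)" .
  have "0 \<le> 1 - (norm a)^2" using a by (simp add: power_le_one)
  then have "norm (of_real (1 - (norm a)^2) / (1 - cnj a * z)) = (1 - (norm a)^2) / norm (1 - cnj a * z)"
    unfolding norm_divide norm_of_real by (simp only: abs_of_nonneg)
  also have "\<dots> \<le> 2"
    using le one_minus_mult_cnj_nonzero(2)[OF a z] by (subst pos_divide_le_eq) (simp_all only: zero_less_norm_iff not_False_eq_True)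
  finally show ?thesis .
qed

text \<open>Two of the \<open>q\<close> powers are integrated exactly, as a Szego kernel at
  \<open>r * a\<close>; the other \<open>q - 2\<close> are bounded by 2 each.\<close>

lemma kernel_mean_le:
  assumes a: "norm a < 1" and r: "0 < r" "r < 1" and q: "2 \<le> q"
  shows "(LINT \<zeta>|circle_measure. norm (of_real (1 - (norm a)^2) / (1 - cnj a * (of_real r * \<zeta>))) powr q)
    \<le> 2 powr (q - 2) * (1 - (norm a)^2)"
proof -
  define W where "W = 1 - (norm a)^2"
  define k where "k = (\<lambda>\<zeta>. complex_of_real W / (1 - cnj a * (of_real r * \<zeta>)))"
  have rz: "norm (of_real r * \<zeta>) \<le> 1" if "norm \<zeta> = 1" for \<zeta> :: complex
    using that r by (simp add: norm_mult)
  have kc: "continuous_on (sphere 0 1) k"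
    unfolding k_def using one_minus_mult_cnj_nonzero(2)[OF a rz] by (intro continuous_intros) auto
  have ra: "norm (of_real r * a) < 1" using a r mult_strict_mono[of r 1 "norm a" 1] by (simp add: norm_mult)
  have w: "0 < W" using a by (simp add: W_def abs_square_less_1)
  have "(LINT \<zeta>|circle_measure. norm (k \<zeta>) powr q) \<le> (LINT \<zeta>|circle_measure. 2 powr (q - 2) * (norm (k \<zeta>))^2)"
  proof (rule integral_mono)
    show "integrable circle_measure (\<lambda>\<zeta>. norm (k \<zeta>) powr q)"
      using q by (intro integrable_circle continuous_on_powr' continuous_intros kc) auto
    show "integrable circle_measure (\<lambda>\<zeta>. 2 powr (q - 2) * (norm (k \<zeta>))^2)"
      by (intro integrable_circle continuous_intros kc)
    fix \<zeta> assume "\<zeta> \<in> space circle_measure"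
    then have z1: "norm \<zeta> = 1" by simp
    have "k \<zeta> \<noteq> 0" using one_minus_mult_cnj_nonzero(2)[OF a rz[OF z1]] w by (simp add: k_def)
    then have "norm (k \<zeta>) powr q = norm (k \<zeta>) powr (q - 2) * (norm (k \<zeta>))^2"
      using powr_add[of "norm (k \<zeta>)" "q - 2" 2] by (simp add: powr_numeral)
    also have "\<dots> \<le> 2 powr (q - 2) * (norm (k \<zeta>))^2"
      using q norm_kernel_le[OF a rz[OF z1]]
      by (intro mult_right_mono powr_mono2) (auto simp: k_def W_def)
    finally show "norm (k \<zeta>) powr q \<le> 2 powr (q - 2) * (norm (k \<zeta>))^2" .
  qed
  also have "\<dots> = 2 powr (q - 2) * (W^2 * (LINT \<zeta>|circle_measure. (norm (1 / (1 - cnj (of_real r * a) * \<zeta>)))^2))"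
  proof -
    have "(norm (k \<zeta>))^2 = W^2 * (norm (1 / (1 - cnj (of_real r * a) * \<zeta>)))^2" for \<zeta>
      using w by (simp add: k_def norm_divide power_divide mult_ac)
    then show ?thesis by simp
  qed
  also have "(LINT \<zeta>|circle_measure. (norm (1 / (1 - cnj (of_real r * a) * \<zeta>)))^2) = 1 / (1 - (norm (of_real r * a))^2)"
    by (rule norm_Szego_square_integral[OF ra])
  also have "2 powr (q - 2) * (W^2 * (1 / (1 - (norm (of_real r * a))^2))) \<le> 2 powr (q - 2) * W"
  proof (rule mult_left_mono)
    have "norm (of_real r * a) \<le> 1 * norm a" unfolding norm_mult using r by (intro mult_right_mono) auto
    then have "(norm (of_real r * a))^2 \<le> (norm a)^2" by (intro power_mono) auto
    then have le: "W \<le> 1 - (norm (of_real r * a))^2" by (simp add: W_def)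
    have key: "W^2 * (1 / v) \<le> W" if "W \<le> v" for v
    proof -
      have "W * W \<le> W * v" using w that by (intro mult_left_mono) auto
      then show ?thesis using w that by (simp add: pos_divide_le_eq power2_eq_square)
    qed
    show "W^2 * (1 / (1 - (norm (of_real r * a))^2)) \<le> W" by (rule key[OF le])
  qed simp
  finally have "(LINT \<zeta>|circle_measure. norm (k \<zeta>) powr q) \<le> 2 powr (q - 2) * W" .
  then show ?thesis by (simp only: k_def W_def)
qed

text \<open>The powers of the kernels have \<open>p\<close>-th means comparable to the weights
  \<open>1 - |z n|^2\<close>, while the factors from \<open>F\<close> control how the terms add up
  and decouple their values on the sequence.\<close>

lemma Hp_interpolation:
  fixes z a :: "nat \<Rightarrow> complex"
  assumes p: "0 < p" and zb: "\<And>n. norm (z n) < 1"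
    and F: "\<And>N. \<exists>F. (\<forall>k. F k holomorphic_on ball 0 1) \<and> (\<forall>w. norm w < 1 \<longrightarrow> (\<Sum>k<N. norm (F k w)) \<le> L)
      \<and> (\<forall>k<N. \<forall>l<N. F k (z l) = (if k = l then 1 else 0))"
    and sm: "summable (\<lambda>n. (1 - (norm (z n))^2) * norm (a n) powr p)"
  shows "\<exists>f A. Hp_le p A f \<and> (\<forall>n. f (z n) = a n)"
proof -
  \<comment> \<open>\<open>kernel_mean_le\<close> is used with the exponent \<open>s * p\<close>,
    which has to be at least 2.\<close>
  obtain s :: nat where "2 / p \<le> real s" using real_arch_simple by blast
  then have q: "2 \<le> real s * p" using p by (simp add: divide_le_eq)
  define W where "W = (\<lambda>n. 1 - (norm (z n))^2)"
  have W0: "0 < W n" for n using zb[of n] by (simp add: W_def abs_square_less_1)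
  define K where "K = (\<lambda>n w. of_real (W n) / (1 - cnj (z n) * w))"
  have den: "1 - cnj (z n) * w \<noteq> 0" if "norm w \<le> 1" for n w
    by (rule one_minus_mult_cnj_nonzero(2)[OF zb that])
  have K0: "K n w \<noteq> 0" if "norm w \<le> 1" for n w
    unfolding K_def divide_eq_0_iff of_real_eq_0_iff using den[OF that] W0[of n] by simp
  have Kz: "K n (z n) = 1" for n
  proof -
    have "of_real (W n) = 1 - cnj (z n) * z n"
      using complex_norm_square[of "z n"] by (simp add: W_def mult.commute)
    then show ?thesis using den[of "z n" n] zb[of n] by (simp add: K_def less_imp_le)
  qed
  have holK: "K n holomorphic_on ball 0 1" for n
    unfolding K_def using den by (intro holomorphic_intros) auto
  have "\<exists>F. \<forall>N. (\<forall>k. F N k holomorphic_on ball 0 1) \<and> (\<forall>w. norm w < 1 \<longrightarrow> (\<Sum>k<N. norm (F N k w)) \<le> L)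
      \<and> (\<forall>k<N. \<forall>l<N. F N k (z l) = (if k = l then 1 else 0))"
    by (rule choice, rule allI, rule F)
  then obtain F where "\<forall>N. (\<forall>k. F N k holomorphic_on ball 0 1) \<and> (\<forall>w. norm w < 1 \<longrightarrow> (\<Sum>k<N. norm (F N k w)) \<le> L)
      \<and> (\<forall>k<N. \<forall>l<N. F N k (z l) = (if k = l then 1 else 0))" ..
  then have F: "\<And>N k. F N k holomorphic_on ball 0 1"
    "\<And>N w. norm w < 1 \<Longrightarrow> (\<Sum>k<N. norm (F N k w)) \<le> L"
    "\<And>N k l. k < N \<Longrightarrow> l < N \<Longrightarrow> F N k (z l) = (if k = l then 1 else 0)"
    by simp_all
  define f where "f = (\<lambda>N w. \<Sum>n<N. F N n w * (a n * K n w ^ s))"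
  define A where "A = L powr p * (2 powr (real s * p - 2) * (\<Sum>n. W n * norm (a n) powr p))"
  have holf: "f N holomorphic_on ball 0 1" for N
    unfolding f_def by (intro holomorphic_intros F holK)
  have Hp: "Hp_le p A (f N)" for N
    unfolding Hp_le_def
  proof (intro conjI allI impI holf)
    fix r :: real assume r: "0 < r" "r < 1"
    have rz: "norm (of_real r * \<zeta>) = r" if "norm \<zeta> = 1" for \<zeta> :: complex using that r by (simp add: norm_mult)
    \<comment> \<open>The moduli of the \<open>F N n\<close> act as weights of total at most
      \<open>L\<close>, through which the power \<open>p\<close> passes into the sum.\<close>
    have pw: "norm (f N (of_real r * \<zeta>)) powr p \<le> (\<Sum>n<N. L powr p * (norm (a n) powr p * norm (K n (of_real r * \<zeta>)) powr (real s * p)))"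
      if \<zeta>: "norm \<zeta> = 1" for \<zeta>
    proof -
      define w where "w = of_real r * \<zeta>"
      have w: "norm w < 1" using rz[OF \<zeta>] r by (simp add: w_def)
      have "norm (f N w) \<le> (\<Sum>n<N. norm (F N n w) * (norm (a n) * norm (K n w) ^ s))"
        unfolding f_def by (rule order_trans[OF norm_sum]) (simp add: norm_mult norm_power)
      then have "norm (f N w) powr p \<le> (\<Sum>n<N. norm (F N n w) * (norm (a n) * norm (K n w) ^ s)) powr p"
        using p by (intro powr_mono2) auto
      also have "\<dots> \<le> L powr p * (\<Sum>n<N. (norm (a n) * norm (K n w) ^ s) powr p)"
        by (rule weighted_sum_powr_le) (use F(2)[OF w] p in auto)
      also have "\<dots> = (\<Sum>n<N. L powr p * (norm (a n) powr p * norm (K n w) powr (real s * p)))"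
      proof -
        have "(norm (K n w) ^ s) powr p = norm (K n w) powr (real s * p)" for n
          using K0[of w n] w by (simp add: powr_powr flip: powr_realpow)
        then show ?thesis by (simp add: sum_distrib_left powr_mult)
      qed
      finally show ?thesis by (simp add: w_def)
    qed
    have intK: "integrable circle_measure (\<lambda>\<zeta>. norm (K n (of_real r * \<zeta>)) powr (real s * p))" for n
      by (rule integrable_hardy_mean[OF holK _ r]) (use q in simp)
    have "pmean p (f N) r \<le> (LINT \<zeta>|circle_measure. (\<Sum>n<N. L powr p * (norm (a n) powr p * norm (K n (of_real r * \<zeta>)) powr (real s * p))))"
      unfolding pmean_def
      by (rule integral_mono[OF integrable_hardy_mean[OF holf p r]]) (use pw intK in auto)
    also have "\<dots> = (\<Sum>n<N. L powr p * (norm (a n) powr p * (LINT \<zeta>|circle_measure. norm (K n (of_real r * \<zeta>)) powr (real s * p))))"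
      using intK by simp
    also have "\<dots> \<le> (\<Sum>n<N. L powr p * (norm (a n) powr p * (2 powr (real s * p - 2) * W n)))"
      using kernel_mean_le[OF zb r q] unfolding K_def W_def by (intro sum_mono mult_left_mono) auto
    also have "\<dots> = L powr p * (2 powr (real s * p - 2) * (\<Sum>n<N. W n * norm (a n) powr p))"
      unfolding sum_distrib_left by (intro sum.cong refl) (simp only: mult_ac)
    also have "\<dots> \<le> A"
      unfolding A_def using sm W0 by (intro mult_left_mono sum_le_suminf) (auto simp: W_def less_imp_le)
    finally show "pmean p (f N) r \<le> A" .
  qed
  \<comment> \<open>\<open>f N\<close> takes only the first \<open>N\<close> prescribed values; a
    limit of these functions takes all of them.\<close>
  obtain g t where g: "Hp_le p A g" "strict_mono (t::nat \<Rightarrow> nat)" "\<And>w. norm w < 1 \<Longrightarrow> (\<lambda>i. f (t i) w) \<longlonglongrightarrow> g w"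
    using Hp_le_Montel[of p A f, OF p Hp] by metis
  have "g (z k) = a k" for k
  proof (rule LIMSEQ_unique[OF g(3)[OF zb]])
    have "f N (z k) = a k" if "k < N" for N
    proof -
      have "f N (z k) = (\<Sum>n<N. if n = k then a k * K k (z k) ^ s else 0)"
        unfolding f_def using F(3)[OF _ that] by (intro sum.cong) auto
      then show ?thesis using that by (simp add: Kz)
    qed
    moreover have "\<forall>\<^sub>F i in sequentially. k < t i"
      by (rule eventually_compose_filterlim[OF eventually_gt_at_top filterlim_subseq[OF g(2)]])
    ultimately have "\<forall>\<^sub>F i in sequentially. f (t i) (z k) = a k" by (auto elim: eventually_mono)
    then show "(\<lambda>i. f (t i) (z k)) \<longlonglongrightarrow> a k" by (rule tendsto_eventually)
  qed
  then show ?thesis using g(1) by blast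
qed

subsection \<open>Measures on a sequence of points\<close>

text \<open>The image of a weighted counting measure on the indices, so that integrals become series
  over \<open>n\<close>.\<close>

definition atomic_measure :: "(nat \<Rightarrow> complex) \<Rightarrow> (nat \<Rightarrow> real) \<Rightarrow> complex measure" where
  "atomic_measure z w = distr (density (count_space UNIV) (\<lambda>n. ennreal (w n))) (restrict_space borel (ball 0 1)) z"

lemma measurable_atoms:
  assumes "range z \<subseteq> ball 0 1"
  shows "z \<in> measurable (density (count_space UNIV) (\<lambda>n. ennreal (w n))) (restrict_space borel (ball 0 1))"
  using assms by (auto simp: measurable_def space_restrict_space)

lemma
  shows space_atomic_measure: "space (atomic_measure z w) = ball 0 1"
    and sets_atomic_measure: "sets (atomic_measure z w) = sets (restrict_space borel (ball 0 1))"
  by (simp_all add: atomic_measure_def space_restrict_space)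

lemma emeasure_atomic_measure:
  assumes "range z \<subseteq> ball 0 1" "A \<in> sets (restrict_space borel (ball 0 1))"
  shows "emeasure (atomic_measure z w) A = (\<Sum>n. ennreal (w n) * indicator A (z n))"
proof -
  have "emeasure (atomic_measure z w) A = emeasure (density (count_space UNIV) (\<lambda>n. ennreal (w n))) (z -` A \<inter> UNIV)"
    unfolding atomic_measure_def by (subst emeasure_distr[OF measurable_atoms[OF assms(1)] assms(2)]) simp
  also have "\<dots> = (\<integral>\<^sup>+n. ennreal (w n) * indicator (z -` A) n \<partial>count_space UNIV)"
    by (subst emeasure_density) auto
  also have "\<dots> = (\<Sum>n. ennreal (w n) * indicator (z -` A) n)"
    by (rule nn_integral_count_space_nat)
  finally show ?thesis by (simp add: indicator_def)
qed

lemma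
  fixes g :: "complex \<Rightarrow> real"
  assumes z: "range z \<subseteq> ball 0 1" and w: "\<And>n. 0 \<le> w n" and g: "g \<in> borel_measurable (restrict_space borel (ball 0 1))"
    and g0: "\<And>x. 0 \<le> g x"
  shows integrable_atomic_measure: "integrable (atomic_measure z w) g \<longleftrightarrow> summable (\<lambda>n. w n * g (z n))"
    and integral_atomic_measure: "summable (\<lambda>n. w n * g (z n)) \<Longrightarrow> (LINT x|atomic_measure z w. g x) = (\<Sum>n. w n * g (z n))"
proof -
  have "integrable (atomic_measure z w) g \<longleftrightarrow> integrable (density (count_space UNIV) (\<lambda>n. ennreal (w n))) (\<lambda>n. g (z n))"
    unfolding atomic_measure_def by (rule integrable_distr_eq[OF measurable_atoms[OF z] g])
  also have "\<dots> \<longleftrightarrow> integrable (count_space UNIV) (\<lambda>n. w n * g (z n))"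
    using w by (subst integrable_density) auto
  also have "\<dots> \<longleftrightarrow> summable (\<lambda>n. w n * g (z n))"
    using w g0 by (simp add: integrable_count_space_nat_iff abs_mult)
  finally show iff: "integrable (atomic_measure z w) g \<longleftrightarrow> summable (\<lambda>n. w n * g (z n))" .
  assume s: "summable (\<lambda>n. w n * g (z n))"
  have "(LINT x|atomic_measure z w. g x) = (LINT n|density (count_space UNIV) (\<lambda>n. ennreal (w n)). g (z n))"
    unfolding atomic_measure_def by (rule integral_distr[OF measurable_atoms[OF z] g])
  also have "\<dots> = (LINT n|count_space UNIV. w n * g (z n))"
    using w by (subst integral_density) auto
  also have "\<dots> = (\<Sum>n. w n * g (z n))"
    using s w g0 by (intro integral_count_space_nat) (simp add: integrable_count_space_nat_iff abs_mult)
  finally show "(LINT x|atomic_measure z w. g x) = (\<Sum>n. w n * g (z n))" .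
qed

lemma borel_disc_restrict:
  assumes "borel_measure_on_disc \<mu>"
  shows "space \<mu> = ball 0 1" "measurable \<mu> N = measurable (restrict_space borel (ball 0 1)) N"
proof -
  have s: "sets \<mu> = sets (restrict_space borel (ball 0 1))" using assms by (simp add: borel_measure_on_disc_def)
  then show "space \<mu> = ball 0 1" using sets_eq_imp_space_eq[OF s] by (simp add: space_restrict_space)
  show "measurable \<mu> N = measurable (restrict_space borel (ball 0 1)) N"
    by (rule measurable_cong_sets[OF s refl])
qed

lemma countable_sets_disc:
  assumes "borel_measure_on_disc \<mu>" "countable X" "X \<subseteq> ball 0 1"
  shows "X \<in> sets \<mu>"
proof -
  have "X \<in> sets borel" by (rule sets.countable[OF _ assms(2)]) simp
  moreover have "ball 0 1 \<inter> space borel \<in> sets (borel :: complex measure)" by simp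
  ultimately have "X \<in> sets (restrict_space borel (ball 0 1))"
    using assms(3) sets_restrict_space_iff by blast
  then show ?thesis using assms(1) by (simp only: borel_measure_on_disc_def)
qed

text \<open>The complement of the sequence is null while no single point of it is; hence the class
  of a function amounts to its sequence of values.\<close>

lemma AE_supported:
  assumes b: "borel_measure_on_disc \<mu>" and s: "supported_precisely_on \<mu> (range z)" and z: "range z \<subseteq> ball 0 1"
  shows "(AE x in \<mu>. P x) \<longleftrightarrow> (\<forall>n::nat. P (z n))"
proof
  assume "AE x in \<mu>. P x"
  then obtain X where X: "{x \<in> space \<mu>. \<not> P x} \<subseteq> X" "emeasure \<mu> X = 0" "X \<in> sets \<mu>" by (rule AE_E)
  show "\<forall>n. P (z n)"
  proof (rule allI, rule ccontr)
    fix n assume "\<not> P (z n)"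
    moreover have "z n \<in> space \<mu>" using z borel_disc_restrict(1)[OF b] by blast
    ultimately have "{z n} \<subseteq> X" using X(1) by blast
    then have "emeasure \<mu> {z n} \<le> emeasure \<mu> X" using X(3) by (rule emeasure_mono)
    moreover have "0 < emeasure \<mu> {z n}" using s unfolding supported_precisely_on_def by blast
    ultimately show False using X(2) by simp
  qed
next
  assume P: "\<forall>n. P (z n)"
  have "range z \<in> sets \<mu>" by (rule countable_sets_disc[OF b _ z]) simp
  then have "space \<mu> - range z \<in> sets \<mu>" by auto
  then have "space \<mu> - range z \<in> null_sets \<mu>"
    using s by (auto simp: null_sets_def supported_precisely_on_def borel_disc_restrict(1)[OF b])
  then show "AE x in \<mu>. P x" by (rule AE_I') (use P in auto)
qed

text \<open>Finiteness makes the point masses real numbers, so that the series formulas for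
  \<open>atomic_measure\<close> apply.\<close>

lemma supported_measure_eq_atomic:
  assumes b: "borel_measure_on_disc \<mu>" and s: "supported_precisely_on \<mu> (range z)"
    and inj: "inj z" and z: "range z \<subseteq> ball 0 1" and fin: "finite_measure \<mu>"
  shows "\<mu> = atomic_measure z (\<lambda>n. measure \<mu> {z n})"
proof (rule measure_eqI)
  interpret finite_measure \<mu> by (rule fin)
  show "sets \<mu> = sets (atomic_measure z (\<lambda>n. measure \<mu> {z n}))"
    using b by (simp add: sets_atomic_measure borel_measure_on_disc_def)
  fix A assume A: "A \<in> sets \<mu>"
  have zn: "{z n} \<subseteq> ball 0 1" for n using z by blast
  have pt: "{z n} \<in> sets \<mu>" for n by (rule countable_sets_disc[OF b _ zn]) simp
  have rs: "range z \<in> sets \<mu>" by (rule countable_sets_disc[OF b _ z]) simp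
  have "emeasure \<mu> A = emeasure \<mu> (A \<inter> range z) + emeasure \<mu> (A - range z)"
    using A rs by (subst plus_emeasure) (auto intro: arg_cong[where f="emeasure \<mu>"])
  also have "emeasure \<mu> (A - range z) \<le> emeasure \<mu> (ball 0 1 - range z)"
    using sets.sets_into_space[OF A] rs sets.Diff[OF sets.top rs] borel_disc_restrict(1)[OF b]
    by (intro emeasure_mono) auto
  then have "emeasure \<mu> (A - range z) = 0" using s by (simp add: supported_precisely_on_def)
  also have "A \<inter> range z = (\<Union>n. A \<inter> {z n})" by auto
  also have "emeasure \<mu> (\<Union>n. A \<inter> {z n}) = (\<Sum>n. emeasure \<mu> (A \<inter> {z n}))"
    using A pt inj by (intro suminf_emeasure[symmetric]) (auto simp: disjoint_family_on_def inj_def)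
  also have "\<dots> = (\<Sum>n. ennreal (measure \<mu> {z n}) * indicator A (z n))"
    by (intro suminf_cong) (auto simp: indicator_def emeasure_eq_measure)
  also have "\<dots> = emeasure (atomic_measure z (\<lambda>n. measure \<mu> {z n})) A"
    using A b z by (intro emeasure_atomic_measure[symmetric]) (auto simp: borel_measure_on_disc_def)
  finally show "emeasure \<mu> A = emeasure (atomic_measure z (\<lambda>n. measure \<mu> {z n})) A" by simp
qed

lemma atomic_measure_supported:
  assumes inj: "inj z" and z: "range z \<subseteq> ball 0 1" and w: "\<And>n. 0 < w n"
  shows "borel_measure_on_disc (atomic_measure z w)" "supported_precisely_on (atomic_measure z w) (range z)"
proof -
  show b: "borel_measure_on_disc (atomic_measure z w)"
    by (simp add: borel_measure_on_disc_def sets_atomic_measure)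
  have rs: "range z \<in> sets (atomic_measure z w)" by (rule countable_sets_disc[OF b _ z]) simp
  have co: "ball 0 1 - range z \<in> sets (restrict_space borel (ball 0 1))"
    using sets.Diff[OF sets.top rs] by (simp add: space_atomic_measure sets_atomic_measure)
  have pt: "{z n} \<in> sets (restrict_space borel (ball 0 1))" for n
  proof -
    have "{z n} \<subseteq> ball 0 1" using z by blast
    then show ?thesis using countable_sets_disc[OF b, of "{z n}"] by (simp add: sets_atomic_measure)
  qed
  have "emeasure (atomic_measure z w) {z n} > 0" for n
  proof -
    have "0 < ennreal (w n)" using w by simp
    also have "\<dots> = (\<Sum>k\<in>{n}. ennreal (w k) * indicator {z n} (z k))" by simp
    also have "\<dots> \<le> (\<Sum>k. ennreal (w k) * indicator {z n} (z k))" by (rule sum_le_suminf) auto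
    also have "\<dots> = emeasure (atomic_measure z w) {z n}" by (rule emeasure_atomic_measure[OF z pt, symmetric])
    finally show ?thesis .
  qed
  moreover have "emeasure (atomic_measure z w) (ball 0 1 - range z) = 0"
    by (simp add: emeasure_atomic_measure[OF z co])
  ultimately show "supported_precisely_on (atomic_measure z w) (range z)"
    by (auto simp: supported_precisely_on_def)
qed

lemma measurable_disc_holomorphic:
  assumes "f holomorphic_on ball 0 1"
  shows "f \<in> borel_measurable (restrict_space borel (ball 0 1))"
  by (rule borel_measurable_continuous_on_restrict[OF holomorphic_on_imp_continuous_on[OF assms]])

lemma
  assumes z: "range z \<subseteq> ball 0 1" and w: "\<And>n. 0 \<le> w n"
  shows Lp_fun_atomic: "f \<in> Lp_fun (atomic_measure z w) p \<longleftrightarrow>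
      f \<in> borel_measurable (restrict_space borel (ball 0 1)) \<and> summable (\<lambda>n. w n * norm (f (z n)) powr p)"
    and Lp_norm_atomic: "f \<in> Lp_fun (atomic_measure z w) p \<Longrightarrow>
      Lp_norm (atomic_measure z w) p f = (\<Sum>n. w n * norm (f (z n)) powr p) powr (1 / p)"
proof -
  have "borel_measure_on_disc (atomic_measure z w)"
    by (simp add: borel_measure_on_disc_def sets_atomic_measure)
  note m = borel_disc_restrict(2)[OF this]
  have int: "integrable (atomic_measure z w) (\<lambda>x. norm (f x) powr p) \<longleftrightarrow> summable (\<lambda>n. w n * norm (f (z n)) powr p)"
    if "f \<in> borel_measurable (restrict_space borel (ball 0 1))" for f
    using that by (intro integrable_atomic_measure[OF z w]) auto
  then show iff: "f \<in> Lp_fun (atomic_measure z w) p \<longleftrightarrow>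
      f \<in> borel_measurable (restrict_space borel (ball 0 1)) \<and> summable (\<lambda>n. w n * norm (f (z n)) powr p)" for f
    by (auto simp: Lp_fun_def m)
  assume "f \<in> Lp_fun (atomic_measure z w) p"
  then have "f \<in> borel_measurable (restrict_space borel (ball 0 1))" "summable (\<lambda>n. w n * norm (f (z n)) powr p)"
    by (simp_all add: iff)
  then show "Lp_norm (atomic_measure z w) p f = (\<Sum>n. w n * norm (f (z n)) powr p) powr (1 / p)"
    unfolding Lp_norm_def by (subst integral_atomic_measure[OF z w]) auto
qed

theorem interpolating_imp_closed_range:
  assumes p: "0 < p" and z: "interpolating_sequence z"
  shows "\<exists>\<mu>. Carleson_measure \<mu> \<and> supported_precisely_on \<mu> (range z) \<and>
    closedin (Lp_topology \<mu> p) (embedding p \<mu> ` Hardy p)"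
proof -
  have inj: "inj z" and zr: "range z \<subseteq> ball 0 1" using z by (auto simp: interpolating_sequence_def)
  have zb: "norm (z n) < 1" for n using zr by (auto simp: image_subset_iff)
  define w where "w = (\<lambda>n. 1 - (norm (z n))^2)"
  have w: "0 < w n" for n using zb[of n] by (simp add: w_def abs_square_less_1)
  define \<mu> where "\<mu> = atomic_measure z w"
  have b: "borel_measure_on_disc \<mu>" and s: "supported_precisely_on \<mu> (range z)"
    using atomic_measure_supported[OF inj zr w] by (simp_all add: \<mu>_def)
  note AE = AE_supported[OF b s zr]
  have Lp: "f \<in> Lp_fun \<mu> p \<longleftrightarrow>
      f \<in> borel_measurable (restrict_space borel (ball 0 1)) \<and> summable (\<lambda>n. w n * norm (f (z n)) powr p)" for f
    unfolding \<mu>_def using w by (intro Lp_fun_atomic[OF zr]) (simp add: less_imp_le)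
  have "\<exists>M. \<forall>a. (\<forall>n. norm (a n) \<le> 1) \<longrightarrow>
    (\<exists>f. f holomorphic_on ball 0 1 \<and> (\<forall>w. norm w < 1 \<longrightarrow> norm (f w) \<le> M) \<and> (\<forall>n. f (z n) = a n))"
  proof (rule interpolation_constant[OF z])
    fix M
    assume "\<And>a. (\<And>n. norm (a n) \<le> 1) \<Longrightarrow>
      \<exists>f. f holomorphic_on ball 0 1 \<and> (\<forall>w. norm w < 1 \<longrightarrow> norm (f w) \<le> M) \<and> (\<forall>n. f (z n) = a n)"
    then show ?thesis by (intro exI[of _ M] allI impI) simp
  qed
  then obtain M where "\<forall>a. (\<forall>n. norm (a n) \<le> 1) \<longrightarrow>
    (\<exists>f. f holomorphic_on ball 0 1 \<and> (\<forall>w. norm w < 1 \<longrightarrow> norm (f w) \<le> M) \<and> (\<forall>n. f (z n) = a n))" ..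
  then have M: "\<And>a. (\<And>n. norm (a n) \<le> 1) \<Longrightarrow>
    \<exists>f. f holomorphic_on ball 0 1 \<and> (\<forall>w. norm w < 1 \<longrightarrow> norm (f w) \<le> M) \<and> (\<forall>n. f (z n) = a n)" by simp
  have F: "\<exists>F. (\<forall>k. F k holomorphic_on ball 0 1) \<and> (\<forall>w. norm w < 1 \<longrightarrow> (\<Sum>k<N. norm (F k w)) \<le> M^2)
    \<and> (\<forall>k<N. \<forall>l<N. F k (z l) = (if k = l then 1 else 0))" for N
    by (rule Beurling_functions) (rule M)
  have sub: "f \<in> Lp_fun \<mu> p" if "f \<in> Hardy p" for f
  proof -
    obtain A where A: "Hp_le p A f" using \<open>f \<in> Hardy p\<close> Hardy_iff[OF p] by blast
    then have hol: "f holomorphic_on ball 0 1" by (simp add: Hp_le_def)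
    \<comment> \<open>The averaged functions have total modulus at most \<open>M^2\<close>, and the
      Carleson constant is the square of such a bound.\<close>
    have "(\<Sum>n<N. w n * norm (f (z n)) powr p) \<le> (M^2)^2 * A" for N
    proof -
      obtain F where "(\<forall>k. F k holomorphic_on ball 0 1) \<and> (\<forall>w. norm w < 1 \<longrightarrow> (\<Sum>k<N. norm (F k w)) \<le> M^2)
        \<and> (\<forall>k<N. \<forall>l<N. F k (z l) = (if k = l then 1 else 0))" using F[of N] ..
      then have F: "\<And>k. F k holomorphic_on ball 0 1" "\<And>w. norm w < 1 \<Longrightarrow> (\<Sum>k<N. norm (F k w)) \<le> M^2"
        "\<And>k l. k < N \<Longrightarrow> l < N \<Longrightarrow> F k (z l) = (if k = l then 1 else 0)"
        by simp_all
      show ?thesis unfolding w_def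
        by (rule Carleson_sum_disc[where I="{..<N}" and F=F and a=z and ?r0.0=0]) (use F hol p zb A in \<open>auto simp: Hp_le_def\<close>)
    qed
    then have "summable (\<lambda>n. w n * norm (f (z n)) powr p)"
      using w by (intro summableI_nonneg_bounded[where x="(M^2)^2 * A"]) (auto simp: less_imp_le)
    then show ?thesis by (simp add: Lp measurable_disc_holomorphic[OF hol])
  qed
  have "embedding p \<mu> ` Hardy p = Lp_space \<mu> p"
  proof
    show "embedding p \<mu> ` Hardy p \<subseteq> Lp_space \<mu> p"
      using sub by (auto simp: embedding_def Lp_space_def)
    show "Lp_space \<mu> p \<subseteq> embedding p \<mu> ` Hardy p"
    proof
      fix U assume "U \<in> Lp_space \<mu> p"
      then obtain u where u: "u \<in> Lp_fun \<mu> p" "U = Lp_class \<mu> p u" by (auto simp: Lp_space_def)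
      have "summable (\<lambda>n. w n * norm (u (z n)) powr p)" using u(1) Lp by blast
      then have "\<exists>f A. Hp_le p A f \<and> (\<forall>n. f (z n) = u (z n))"
        unfolding w_def by (rule Hp_interpolation[OF p zb F])
      then obtain f A where f: "Hp_le p A f" "\<And>n. f (z n) = u (z n)" by blast
      have "U = embedding p \<mu> f"
        using f(2) by (simp add: u(2) embedding_def Lp_class_def AE)
      then show "U \<in> embedding p \<mu> ` Hardy p" using f(1) Hardy_iff[OF p] by blast
    qed
  qed
  then have "closedin (Lp_topology \<mu> p) (embedding p \<mu> ` Hardy p)"
    using closedin_topspace[of "Lp_topology \<mu> p"] by (simp add: topspace_Lp_topology)
  moreover have "Carleson_measure \<mu>" using b p sub by (auto simp: Carleson_measure_def)
  ultimately show ?thesis using s by blast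
qed

subsection \<open>From a closed range to uniform separation\<close>

text \<open>The open mapping theorem for the trace map \<open>f \<mapsto> (f (z n))\<close> from \<open>H\<^sup>p\<close> to the weighted sequence
  space \<open>\<ell>\<^sup>p(w)\<close>; the last hypothesis says that its range is closed.\<close>

lemma trace_open_mapping:
  fixes z :: "nat \<Rightarrow> complex" and w :: "nat \<Rightarrow> real"
  assumes p: "0 < p" and zb: "\<And>n. norm (z n) < 1" and w: "\<And>n. 0 < w n"
    and sm: "\<And>f A. Hp_le p A f \<Longrightarrow> summable (\<lambda>n. w n * norm (f (z n)) powr p)"
    and closed: "\<And>u x. (\<And>i::nat. \<exists>A. Hp_le p A (u i)) \<Longrightarrow> summable (\<lambda>n. w n * norm (x n) powr p) \<Longrightarrow>
      (\<lambda>i. \<Sum>n. w n * norm (u i (z n) - x n) powr p) \<longlonglongrightarrow> 0 \<Longrightarrow> \<exists>f A. Hp_le p A f \<and> (\<forall>n. f (z n) = x n)"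
  shows "\<exists>C>0. \<forall>f A. Hp_le p A f \<longrightarrow>
    (\<exists>g. Hp_le p (C * (\<Sum>n. w n * norm (f (z n)) powr p)) g \<and> (\<forall>n. g (z n) = f (z n)))"
proof -
  define V where "V = {x::nat \<Rightarrow> complex. summable (\<lambda>n. w n * norm (x n) powr p)}"
  \<comment> \<open>The \<open>p\<close>-th power of the quasinorm of the weighted sequence space,
    which is why its triangle constant \<open>K\<close> is \<open>2 powr p\<close>.\<close>
  define N where "N = (\<lambda>x. if x \<in> V then \<Sum>n. w n * norm (x n) powr p else 0)"
  define A where "A = (\<lambda>m::nat. {x. \<exists>f. Hp_le p (real m) f \<and> (\<forall>n. f (z n) = x n)})"
  define R where "R = (\<Union>m. A m)"
  define K :: real where "K = 2 powr p"
  have K: "1 \<le> K" using p by (simp add: K_def ge_one_powr_ge_zero)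
  have t0: "0 \<le> w n * norm x powr p" for n and x :: complex using w[of n] by simp
  have VD: "summable (\<lambda>n. w n * norm (x n) powr p)" if "x \<in> V" for x using that by (simp add: V_def)
  have NV: "N x = (\<Sum>n. w n * norm (x n) powr p)" if "x \<in> V" for x using that by (simp add: N_def)
  have V_diff: "(\<lambda>n. x n - y n) \<in> V" "N (\<lambda>n. x n - y n) \<le> K * (N x + N y)" if xy: "x \<in> V" "y \<in> V" for x y
  proof -
    note s = VD[OF xy(1)] VD[OF xy(2)]
    have le: "w n * norm (x n - y n) powr p \<le> K * (w n * norm (x n) powr p + w n * norm (y n) powr p)" for n
    proof -
      have "w n * norm (x n - y n) powr p \<le> w n * (K * (norm (x n) powr p + norm (y n) powr p))"
        unfolding K_def using w[of n] powr_norm_diff_le[OF p] by (intro mult_left_mono) auto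
      then show ?thesis by (simp add: algebra_simps)
    qed
    have sK: "summable (\<lambda>n. K * (w n * norm (x n) powr p + w n * norm (y n) powr p))"
      by (intro summable_mult summable_add s)
    have "summable (\<lambda>n. w n * norm (x n - y n) powr p)"
      by (rule summable_comparison_test'[OF sK]) (use le t0 in \<open>simp add: abs_of_nonneg\<close>)
    then show V: "(\<lambda>n. x n - y n) \<in> V" by (simp add: V_def)
    have "N (\<lambda>n. x n - y n) \<le> (\<Sum>n. K * (w n * norm (x n) powr p + w n * norm (y n) powr p))"
      unfolding NV[OF V] by (rule suminf_le[OF le VD[OF V] sK])
    also have "\<dots> = K * (N x + N y)"
      unfolding NV[OF xy(1)] NV[OF xy(2)] suminf_add[OF s] by (rule suminf_mult) (intro summable_add s)
    finally show "N (\<lambda>n. x n - y n) \<le> K * (N x + N y)" .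
  qed
  have zeroHp: "Hp_le p 0 (\<lambda>z. 0)" using p by (simp add: Hp_le_def pmean_def)
  \<comment> \<open>The ceiling is there because the bound of the difference has to be an index of
    \<open>A\<close>, hence a natural number.\<close>
  have A_diff: "(\<lambda>n. x n - y n) \<in> A (nat \<lceil>K * (2 * real m)\<rceil>)" if xy: "x \<in> A m" "y \<in> A m" for m x y
  proof -
    obtain f where f: "Hp_le p (real m) f" "\<forall>n. f (z n) = x n" using xy(1) unfolding A_def by blast
    obtain g where g: "Hp_le p (real m) g" "\<forall>n. g (z n) = y n" using xy(2) unfolding A_def by blast
    have "Hp_le p (K * (real m + real m)) (\<lambda>z. f z - g z)"
      unfolding K_def by (rule Hp_le_diff[OF p f(1) g(1)])
    then have "Hp_le p (real (nat \<lceil>K * (2 * real m)\<rceil>)) (\<lambda>z. f z - g z)"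
      by (rule Hp_le_mono) (simp add: real_nat_ceiling_ge)
    then show ?thesis using f g unfolding A_def by (auto intro!: exI[of _ "\<lambda>z. f z - g z"])
  qed
  have R_iff: "x \<in> R \<longleftrightarrow> (\<exists>f B. Hp_le p B f \<and> (\<forall>n. f (z n) = x n))" for x
  proof
    assume "\<exists>f B. Hp_le p B f \<and> (\<forall>n. f (z n) = x n)"
    then obtain f B where f: "Hp_le p B f" "\<forall>n. f (z n) = x n" by blast
    obtain m where "B \<le> real m" using real_arch_simple by blast
    then have "x \<in> A m" using Hp_le_mono[OF f(1)] f(2) unfolding A_def by blast
    then show "x \<in> R" unfolding R_def by blast
  qed (auto simp: R_def A_def)
  have RV: "R \<subseteq> V"
  proof
    fix x assume "x \<in> R"
    then obtain f B where "Hp_le p B f" "\<forall>n. f (z n) = x n" unfolding R_iff by blast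
    then show "x \<in> V" using sm[of B f] by (simp add: V_def)
  qed
  have R_diff: "(\<lambda>n. x n - y n) \<in> R" if xy: "x \<in> R" "y \<in> R" for x y
  proof -
    obtain f B where f: "Hp_le p B f" "\<forall>n. f (z n) = x n" using xy(1) unfolding R_iff by blast
    obtain g C where g: "Hp_le p C g" "\<forall>n. g (z n) = y n" using xy(2) unfolding R_iff by blast
    show ?thesis unfolding R_iff using Hp_le_diff[OF p f(1) g(1)] f(2) g(2)
      by (intro exI[of _ "\<lambda>z. f z - g z"] exI[of _ "2 powr p * (B + C)"]) simp
  qed
  have "\<exists>m. \<exists>e>0. \<forall>x\<in>R. N x < e \<longrightarrow> x \<in> A m"
  proof (rule baire_lower_semicontinuous[where K=K and V=V and \<phi>="\<lambda>m. nat \<lceil>K * (2 * real m)\<rceil>"])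
    show "(\<lambda>n. x n - y n) \<in> V" if "x \<in> V" "y \<in> V" for x y by (rule V_diff[OF that])
    show "0 \<le> N x" for x unfolding N_def V_def using t0 by (auto intro!: suminf_nonneg)
    show "N (\<lambda>n. 0) = 0" using p by (simp add: N_def)
    show "N (\<lambda>n. x n - y n) = N (\<lambda>n. y n - x n)" for x y
      by (simp add: N_def V_def norm_minus_commute)
    show "N (\<lambda>n. x n - v n) \<le> K * (N (\<lambda>n. x n - y n) + N (\<lambda>n. y n - v n))" if xyv: "x \<in> V" "y \<in> V" "v \<in> V" for x y v
    proof -
      have "N (\<lambda>n. v n - y n) = N (\<lambda>n. y n - v n)" by (simp add: N_def V_def norm_minus_commute)
      then show ?thesis using V_diff(2)[OF V_diff(1)[OF xyv(1,2)] V_diff(1)[OF xyv(3,2)]] by simp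
    qed
    show "\<exists>d>0. \<forall>x\<in>V. N x < d \<longrightarrow> norm (x n) < e" if e: "0 < e" for n e
    proof (intro exI conjI ballI impI)
      show "0 < w n * e powr p" using w e by simp
      fix x assume x: "x \<in> V" "N x < w n * e powr p"
      have "w n * norm (x n) powr p \<le> N x"
        unfolding NV[OF x(1)] using sum_le_suminf[OF VD[OF x(1)], of "{n}"] t0 by simp
      then have "w n * norm (x n) powr p < w n * e powr p" using x(2) by simp
      then have "norm (x n) powr p < e powr p" using w[of n] by simp
      then show "norm (x n) < e" using p e by (meson linorder_not_less norm_ge_zero powr_mono2 less_imp_le)
    qed
    show "x \<in> V \<and> N x \<le> c" if u: "\<And>i. u i \<in> V" "\<And>i. N (u i) \<le> c" "\<And>n. (\<lambda>i. u i n) \<longlonglongrightarrow> x n" for u x c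
    proof -
      have lim: "(\<lambda>i. w n * norm (u i n) powr p) \<longlonglongrightarrow> w n * norm (x n) powr p" for n
        using p by (intro tendsto_intros tendsto_powr' u(3)) auto
      have le: "suminf (\<lambda>n. w n * norm (u i n) powr p) \<le> c" for i using u(2)[of i] NV[OF u(1)] by simp
      have "x \<in> V" using suminf_Fatou(1)[OF t0 VD[OF u(1)] le lim] by (simp add: V_def)
      then show ?thesis using suminf_Fatou(2)[OF t0 VD[OF u(1)] le lim] NV by simp
    qed
    show "(\<lambda>n. 0) \<in> R" unfolding R_iff using zeroHp by auto
    show "(\<lambda>n. x n + y n) \<in> R" if "x \<in> R" "y \<in> R" for x y
    proof -
      have "(\<lambda>n. 0) \<in> R" unfolding R_iff using zeroHp by auto
      from R_diff[OF that(1) R_diff[OF this that(2)]] show ?thesis by simp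
    qed
    show "x \<in> R" if u: "\<And>i. u i \<in> R" "x \<in> V" "(\<lambda>i. N (\<lambda>n. u i n - x n)) \<longlonglongrightarrow> 0" for u x
    proof -
      have "\<forall>i. \<exists>f. (\<exists>B. Hp_le p B f) \<and> (\<forall>n. f (z n) = u i n)" using u(1) unfolding R_iff by blast
      from choice[OF this] obtain f where f: "\<forall>i. (\<exists>B. Hp_le p B (f i)) \<and> (\<forall>n. f i (z n) = u i n)" ..
      have "(\<lambda>n. u i n - x n) \<in> V" for i using V_diff(1) u RV by blast
      then have "N (\<lambda>n. u i n - x n) = (\<Sum>n. w n * norm (f i (z n) - x n) powr p)" for i
        using f by (simp add: NV)
      then have "(\<lambda>i. \<Sum>n. w n * norm (f i (z n) - x n) powr p) \<longlonglongrightarrow> 0" using u(3) by simp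
      then show ?thesis unfolding R_iff by (rule closed[rotated 2]) (use f VD[OF u(2)] in auto)
    qed
    show "x \<in> A m" if u: "\<And>i. u i \<in> A m" "\<And>n. (\<lambda>i. u i n) \<longlonglongrightarrow> x n" for m u x
    proof -
      have "\<forall>i. \<exists>f. Hp_le p (real m) f \<and> (\<forall>n. f (z n) = u i n)" using u(1) unfolding A_def by blast
      from choice[OF this] obtain f where f: "\<forall>i. Hp_le p (real m) (f i) \<and> (\<forall>n. f i (z n) = u i n)" ..
      then have "\<And>i. Hp_le p (real m) (f i)" by blast
      then obtain g s where gs: "Hp_le p (real m) g"
        "strict_mono (s::nat \<Rightarrow> nat)" "\<And>z. norm z < 1 \<Longrightarrow> (\<lambda>i. f (s i) z) \<longlonglongrightarrow> g z" using Hp_le_Montel[of p "real m" f, OF p] by metis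
      have "g (z n) = x n" for n
        using LIMSEQ_unique[OF gs(3)[OF zb[of n]]] LIMSEQ_subseq_LIMSEQ[OF u(2) gs(2), of n] f
        by (simp add: o_def)
      then show ?thesis using gs(1) by (auto simp: A_def)
    qed
    show "R = (\<Union>m. A m)" by (rule R_def)
    show "(\<lambda>n. x n - y n) \<in> A (nat \<lceil>K * (2 * real m)\<rceil>)" if "x \<in> A m" "y \<in> A m" for m x y by (rule A_diff[OF that])
  qed (rule K, rule RV)
  then obtain m e where e: "0 < e" "\<forall>x\<in>R. N x < e \<longrightarrow> x \<in> A m" by blast
  define C where "C = 2 * real m / e + 1"
  show ?thesis
  proof (intro exI[of _ C] conjI allI impI)
    show "0 < C" using e by (simp add: C_def add_nonneg_pos)
    fix f B assume f: "Hp_le p B f"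
    define S where "S = (\<Sum>n. w n * norm (f (z n)) powr p)"
    have S0: "0 \<le> S" unfolding S_def by (intro suminf_nonneg sm[OF f] t0)
    show "\<exists>g. Hp_le p (C * (\<Sum>n. w n * norm (f (z n)) powr p)) g \<and> (\<forall>n. g (z n) = f (z n))"
    proof (cases "S = 0")
      \<comment> \<open>Scaling is impossible here, but all values vanish and the zero function is
        the required competitor.\<close>
      case True
      then have "w n * norm (f (z n)) powr p = 0" for n
        using suminf_eq_zero_iff[OF sm[OF f] t0] by (simp add: S_def)
      then have "f (z n) = 0" for n using w[of n] by (metis less_irrefl mult_eq_0_iff norm_eq_zero powr_eq_0_iff)
      then show ?thesis using zeroHp True by (intro exI[of _ "\<lambda>z. 0"]) (simp add: S_def)
    next
      case False
      then have S: "0 < S" using S0 by simp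
      \<comment> \<open>Chosen so that the scaled trace has \<open>N x = e / 2\<close>, strictly
        inside the ball from the Baire lemma.\<close>
      define c where "c = (e / (2 * S)) powr (1 / p)"
      have c0: "0 < c" using e S by (simp add: c_def)
      have cp: "c powr p = e / (2 * S)" using e S p by (simp add: c_def powr_powr)
      have cf: "Hp_le p (norm (complex_of_real c) powr p * B) (\<lambda>z. of_real c * f z)" by (rule Hp_le_scale[OF f])
      define x where "x = (\<lambda>n. of_real c * f (z n))"
      have xR: "x \<in> R" unfolding R_iff x_def using cf by blast
      have "N x = (\<Sum>n. c powr p * (w n * norm (f (z n)) powr p))"
        using NV[of x] xR RV c0 by (auto simp: x_def norm_mult powr_mult mult_ac)
      also have "\<dots> = c powr p * S" unfolding S_def by (rule suminf_mult[OF sm[OF f]])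
      also have "\<dots> = e / 2" using S by (simp add: cp)
      finally have "N x < e" using e by simp
      then have "x \<in> A m" using e xR by blast
      then obtain g where g: "Hp_le p (real m) g" "\<forall>n. g (z n) = x n" unfolding A_def by blast
      have "Hp_le p (norm (complex_of_real (1 / c)) powr p * real m) (\<lambda>z. of_real (1 / c) * g z)"
        by (rule Hp_le_scale[OF g(1)])
      moreover have "norm (complex_of_real (1 / c)) powr p * real m \<le> C * S"
      proof -
        have "norm (complex_of_real (1 / c)) powr p = 1 / c powr p"
          using c0 unfolding norm_of_real by (simp add: powr_divide)
        also have "\<dots> = 2 * S / e" by (simp add: cp)
        finally show ?thesis using S by (simp add: C_def algebra_simps)
      qed
      ultimately have "Hp_le p (C * S) (\<lambda>z. of_real (1 / c) * g z)" by (rule Hp_le_mono)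
      moreover have "of_real (1 / c) * g (z n) = f (z n)" for n using g(2) c0 by (simp add: x_def)
      ultimately show ?thesis unfolding S_def by (intro exI[of _ "\<lambda>z. of_real (1 / c) * g z"]) blast
    qed
  qed
qed

lemma Re_of_real_times: "Re (of_real x * y) = x * Re y"
  by simp

lemma Re_inverse_pos:
  assumes a: "norm a < 1" and z: "norm z < 1"
  shows "0 < Re (1 / (1 - cnj a * z))"
proof -
  have "norm (cnj a * z) \<le> norm a * 1" unfolding norm_mult complex_mod_cnj using z by (intro mult_left_mono) auto
  then have "0 < Re (1 - cnj a * z)" using a complex_Re_le_cmod[of "cnj a * z"] by simp
  moreover have "1 - cnj a * z \<noteq> 0" using one_minus_mult_cnj_nonzero(2)[OF a] z by simp
  ultimately show ?thesis by (simp add: Re_divide' zero_less_divide_iff)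
qed

text \<open>If the weights were too large along a sequence of points, then the power \<open>2 / p\<close> of a sum
  of Szego kernels peaking at these points (all with positive real part) would violate summability.\<close>

lemma weight_bound:
  fixes z :: "nat \<Rightarrow> complex" and w :: "nat \<Rightarrow> real"
  assumes p: "0 < p" and zb: "\<And>n. norm (z n) < 1" and w: "\<And>n. 0 < w n"
    and sm: "\<And>f A. Hp_le p A f \<Longrightarrow> summable (\<lambda>n. w n * norm (f (z n)) powr p)"
  shows "\<exists>C>0. \<forall>n. w n \<le> C * (1 - (norm (z n))^2)"
proof (rule ccontr)
  assume contra: "\<not> ?thesis"
  \<comment> \<open>\<open>4 ^ i\<close> pays for the squares of the coefficients
    \<open>(1/2)^i\<close> used below; \<open>Suc i\<close> is left over and makes the terms
    unbounded.\<close>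
  have "\<forall>i::nat. \<exists>k. real (Suc i) * 4 ^ i * (1 - (norm (z k))^2) < w k"
  proof
    fix i :: nat
    have "0 < real (Suc i) * 4 ^ i" by simp
    then show "\<exists>k. real (Suc i) * 4 ^ i * (1 - (norm (z k))^2) < w k" using contra not_le by blast
  qed
  from choice[OF this] obtain k where k: "\<forall>i. real (Suc i) * 4 ^ i * (1 - (norm (z (k i)))^2) < w (k i)" ..
  define a where "a = (\<lambda>i. z (k i))"
  have a: "norm (a i) < 1" for i by (simp add: a_def zb)
  define W where "W = (\<lambda>i. 1 - (norm (a i))^2)"
  have W: "0 < W i" for i using a[of i] by (simp add: W_def abs_square_less_1)
  \<comment> \<open>Szego kernels with quadratic means at most 1 and the large value
    \<open>1 / sqrt (W i)\<close> at \<open>a i\<close>.\<close>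
  define v where "v = (\<lambda>i \<zeta>. of_real (sqrt (W i)) * (1 / (1 - cnj (a i) * \<zeta>)))"
  have den: "1 - cnj (a i) * \<zeta> \<noteq> 0" if "norm \<zeta> < 1" for i \<zeta>
    by (rule one_minus_mult_cnj_nonzero(2)[OF a]) (use that in simp)
  have holv: "v i holomorphic_on ball 0 1" for i
    unfolding v_def using den by (intro holomorphic_intros) auto
  have Rev: "0 < Re (v i \<zeta>)" if "norm \<zeta> < 1" for i \<zeta>
  proof -
    have "Re (v i \<zeta>) = sqrt (W i) * Re (1 / (1 - cnj (a i) * \<zeta>))" unfolding v_def by (simp only: Re_of_real_times)
    then show ?thesis using Re_inverse_pos[OF a that, of i] W[of i] by simp
  qed
  have va: "v i (a i) = of_real (1 / sqrt (W i))" for i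
  proof -
    have "1 - cnj (a i) * a i = of_real (W i)"
      using complex_norm_square[of "a i"] by (simp add: W_def mult.commute)
    then have "v i (a i) = of_real (sqrt (W i) * (1 / W i))" by (simp add: v_def)
    also have "sqrt (W i) * (1 / W i) = 1 / sqrt (W i)"
      using W[of i] by (simp add: real_div_sqrt field_simps)
    finally show ?thesis .
  qed
  define h where "h = (\<lambda>N \<zeta>. \<Sum>i\<le>N. of_real ((1/2)^i) * v i \<zeta>)"
  have holh: "h N holomorphic_on ball 0 1" for N unfolding h_def by (intro holomorphic_intros holv)
  have Reh_eq: "Re (h N \<zeta>) = (\<Sum>i\<le>N. (1/2)^i * Re (v i \<zeta>))" for N \<zeta>
    unfolding h_def Re_sum by (simp only: Re_of_real_times)
  \<comment> \<open>Positive real parts exclude cancellation, so a single term bounds the whole sum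
    from below.\<close>
  have Reh: "(1/2)^i * Re (v i \<zeta>) \<le> Re (h N \<zeta>)" if "i \<le> N" "norm \<zeta> < 1" for i N \<zeta>
    unfolding Reh_eq using that Rev[OF that(2)] by (intro member_le_sum) (auto simp: less_imp_le)
  have Reh0: "0 < Re (h N \<zeta>)" if "norm \<zeta> < 1" for N \<zeta>
    using Reh[of 0 N \<zeta>] Rev[OF that, of 0] that by simp
  have h_nonpos: "h N \<zeta> \<notin> \<real>\<^sub>\<le>\<^sub>0" if "norm \<zeta> < 1" for N \<zeta>
    using Reh0[OF that, of N] by (auto simp: complex_nonpos_Reals_iff)
  \<comment> \<open>The power \<open>2 / p\<close> of \<open>h N\<close>, holomorphic because
    \<open>h N\<close> takes its values in the right half-plane.\<close>
  define f where "f = (\<lambda>N \<zeta>. exp (of_real (2 / p) * Ln (h N \<zeta>)))"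
  have holf: "f N holomorphic_on ball 0 1" for N
    unfolding f_def using h_nonpos by (intro holomorphic_intros holh) auto
  have fp: "norm (f N \<zeta>) powr p = (norm (h N \<zeta>))^2" if "norm \<zeta> < 1" for N \<zeta>
  proof -
    have "h N \<zeta> \<noteq> 0" using Reh0[OF that, of N] by auto
    have "norm (f N \<zeta>) = exp (2 / p * ln (norm (h N \<zeta>)))"
      using \<open>h N \<zeta> \<noteq> 0\<close> unfolding f_def norm_exp_eq_Re Re_of_real_times by (simp add: Re_Ln)
    then have "norm (f N \<zeta>) powr p = exp (2 * ln (norm (h N \<zeta>)))" using p by (simp add: powr_def)
    also have "\<dots> = (norm (h N \<zeta>)) powr 2" using \<open>h N \<zeta> \<noteq> 0\<close> by (simp add: powr_def)
    finally show ?thesis by (simp add: powr_numeral)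
  qed
  have geo: "(\<Sum>i\<le>N. (1/2)^i) \<le> (2::real)" for N
    using sum_le_suminf[of "\<lambda>i. (1/2::real)^i" "{..N}"] suminf_geometric[of "1/2::real"] summable_geometric[of "1/2::real"] by simp
  \<comment> \<open>The constant is \<open>2 * 2\<close>: the geometric series enters once through
    Cauchy-Schwarz and once when the means of the \<open>v i\<close> are summed.\<close>
  have Hp: "Hp_le p 4 (f N)" for N
    unfolding Hp_le_def
  proof (intro conjI allI impI holf)
    fix r :: real assume r: "0 < r" "r < 1"
    have rz: "norm (of_real r * \<zeta>) < 1" if "norm \<zeta> = 1" for \<zeta> :: complex using that r by (simp add: norm_mult)
    have iv: "integrable circle_measure (\<lambda>\<zeta>. (norm (v i (of_real r * \<zeta>)))^2)"
      and lv: "(LINT \<zeta>|circle_measure. (norm (v i (of_real r * \<zeta>)))^2) \<le> 1" for i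
    proof -
      have c: "continuous_on (sphere 0 1) (\<lambda>\<zeta>. v i (of_real r * \<zeta>))"
        by (rule continuous_on_compose2[OF holomorphic_on_imp_continuous_on[OF holv]])
          (use rz in \<open>auto intro!: continuous_intros\<close>)
      show "integrable circle_measure (\<lambda>\<zeta>. (norm (v i (of_real r * \<zeta>)))^2)"
        by (intro integrable_circle continuous_intros c)
      have eq: "(norm (v i \<zeta>))^2 = norm (of_real (W i) / (1 - cnj (a i) * \<zeta>)) powr 2 / W i" for \<zeta>
      proof -
        have "norm (of_real (W i) / (1 - cnj (a i) * \<zeta>)) powr 2 = (W i)^2 * (norm (1 / (1 - cnj (a i) * \<zeta>)))^2"
          using W[of i] by (simp add: powr_numeral norm_divide power_divide)
        moreover have "(norm (v i \<zeta>))^2 = W i * (norm (1 / (1 - cnj (a i) * \<zeta>)))^2"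
          unfolding v_def norm_mult power_mult_distrib using W[of i] by simp
        ultimately show ?thesis using W[of i] by (simp add: power2_eq_square)
      qed
      have "(LINT \<zeta>|circle_measure. (norm (v i (of_real r * \<zeta>)))^2) =
        (LINT \<zeta>|circle_measure. norm (of_real (W i) / (1 - cnj (a i) * (of_real r * \<zeta>))) powr 2) / W i"
        unfolding eq by simp
      also have "\<dots> \<le> (2 powr (2 - 2) * W i) / W i"
        using kernel_mean_le[OF a r, of 2 i] W[of i] by (intro divide_right_mono) (simp_all add: W_def)
      finally show "(LINT \<zeta>|circle_measure. (norm (v i (of_real r * \<zeta>)))^2) \<le> 1" using W[of i] by simp
    qed
    have le: "norm (f N (of_real r * \<zeta>)) powr p \<le> 2 * (\<Sum>i\<le>N. (1/2)^i * (norm (v i (of_real r * \<zeta>)))^2)" if "norm \<zeta> = 1" for \<zeta>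
    proof -
      define y where "y = of_real r * \<zeta>"
      have y: "norm y < 1" using rz[OF that] by (simp add: y_def)
      have "norm (h N y) \<le> (\<Sum>i\<le>N. (1/2)^i * norm (v i y))"
        unfolding h_def by (rule order_trans[OF norm_sum]) (simp add: norm_mult norm_power)
      then have "(norm (h N y))^2 \<le> (\<Sum>i\<le>N. sqrt ((1/2)^i) * (sqrt ((1/2)^i) * norm (v i y)))^2"
        by (intro power_mono) (simp_all add: mult.assoc[symmetric])
      also have "\<dots> \<le> (\<Sum>i\<le>N. (sqrt ((1/2)^i))^2) * (\<Sum>i\<le>N. (sqrt ((1/2)^i) * norm (v i y))^2)"
        by (rule Cauchy_Schwarz_ineq_sum)
      also have "\<dots> = (\<Sum>i\<le>N. (1/2)^i) * (\<Sum>i\<le>N. (1/2)^i * (norm (v i y))^2)"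
        by (simp add: power_mult_distrib)
      also have "\<dots> \<le> 2 * (\<Sum>i\<le>N. (1/2)^i * (norm (v i y))^2)"
        by (intro mult_right_mono geo sum_nonneg) simp
      finally show ?thesis using fp[OF y, of N] by (simp only: y_def)
    qed
    have "pmean p (f N) r \<le> (LINT \<zeta>|circle_measure. 2 * (\<Sum>i\<le>N. (1/2)^i * (norm (v i (of_real r * \<zeta>)))^2))"
      unfolding pmean_def
      by (rule integral_mono[OF integrable_hardy_mean[OF holf p r]]) (use le iv in auto)
    also have "\<dots> = 2 * (\<Sum>i\<le>N. (1/2)^i * (LINT \<zeta>|circle_measure. (norm (v i (of_real r * \<zeta>)))^2))"
      using iv by simp
    also have "\<dots> \<le> 2 * (\<Sum>i\<le>N. (1/2)^i * 1)"
      using lv by (intro mult_left_mono sum_mono) auto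
    also have "\<dots> \<le> 2 * 2" using geo[of N] by (intro mult_left_mono) auto
    finally show "pmean p (f N) r \<le> 4" by simp
  qed
  obtain g s where g: "Hp_le p 4 g" "strict_mono (s::nat \<Rightarrow> nat)" "\<And>\<zeta>. norm \<zeta> < 1 \<Longrightarrow> (\<lambda>j. f (s j) \<zeta>) \<longlonglongrightarrow> g \<zeta>"
    using Hp_le_Montel[of p 4 f, OF p Hp] by metis
  \<comment> \<open>The \<open>i\<close>-th term of \<open>h\<close> alone contributes
    \<open>(1/2)^i / sqrt (W i)\<close> at \<open>a i\<close>; its square survives the passage to
    the limit \<open>g\<close>.\<close>
  have large: "(1/4)^i / W i \<le> norm (g (a i)) powr p" for i
  proof (rule LIMSEQ_le_const)
    show "(\<lambda>j. norm (f (s j) (a i)) powr p) \<longlonglongrightarrow> norm (g (a i)) powr p"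
      using p by (intro tendsto_powr' tendsto_norm g(3)[OF a] tendsto_const) auto
    have "(1/4)^i / W i \<le> norm (f (s j) (a i)) powr p" if "i \<le> j" for j
    proof -
      have "i \<le> s j" using seq_suble[OF g(2), of j] that by simp
      then have "(1/2)^i * (1 / sqrt (W i)) \<le> Re (h (s j) (a i))"
        using Reh[of i "s j" "a i"] a[of i] by (simp add: va)
      also have "\<dots> \<le> norm (h (s j) (a i))" by (rule complex_Re_le_cmod)
      finally have "((1/2)^i * (1 / sqrt (W i)))^2 \<le> (norm (h (s j) (a i)))^2"
        using W[of i] by (intro power_mono) auto
      moreover have "((1/2)^i * (1 / sqrt (W i)))^2 = (1/4)^i / W i"
        using W[of i] by (simp add: power_mult_distrib power_divide power_mult[symmetric] mult.commute[of i 2]) (simp add: power_mult)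
      ultimately show ?thesis using fp[OF a] by simp
    qed
    then show "\<exists>N. \<forall>j\<ge>N. (1/4)^i / W i \<le> norm (f (s j) (a i)) powr p" by blast
  qed
  define S where "S = (\<Sum>n. w n * norm (g (z n)) powr p)"
  \<comment> \<open>The single term at index \<open>k i\<close> is already at least
    \<open>i + 1\<close>, although the series converges.\<close>
  have "real (Suc i) \<le> S" for i
  proof -
    have "real (Suc i) = (real (Suc i) * 4 ^ i * W i) * ((1/4)^i / W i)"
      using W[of i] by (simp add: power_divide)
    also have "\<dots> \<le> w (k i) * norm (g (z (k i))) powr p"
      using k large[of i] W[of i] w[of "k i"] by (intro mult_mono) (auto simp: W_def a_def less_imp_le)
    also have "\<dots> \<le> S"
      unfolding S_def using sum_le_suminf[OF sm[OF g(1)], of "{k i}"] w by (simp add: less_imp_le)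
    finally show ?thesis .
  qed
  moreover obtain i where "S < real i" using reals_Archimedean2 by blast
  ultimately show False by (metis less_le_not_le of_nat_mono order_trans lessI less_imp_le_nat)
qed

section \<open>Finite Blaschke products\<close>

definition blaschke :: "complex \<Rightarrow> complex \<Rightarrow> complex" where
  "blaschke a z = (z - a) / (1 - cnj a * z)"

lemma blaschke_holomorphic:
  assumes "norm a < 1"
  shows "blaschke a holomorphic_on ball 0 1"
  unfolding blaschke_def using one_minus_mult_cnj_nonzero(2)[OF assms]
  by (intro holomorphic_intros) auto

lemma blaschke_continuous:
  assumes "norm a < 1"
  shows "continuous_on (cball 0 1) (blaschke a)"
  unfolding blaschke_def using one_minus_mult_cnj_nonzero(2)[OF assms]
  by (intro continuous_intros) auto

lemma norm_blaschke:
  assumes a: "norm a < 1" and z: "norm z \<le> 1"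
  shows "(norm (blaschke a z))^2 = 1 - (1 - (norm a)^2) * (1 - (norm z)^2) / (norm (1 - cnj a * z))^2"
proof -
  have "norm (1 - cnj a * z)^2 = norm (z - a)^2 + (1 - norm a^2) * (1 - norm z^2)"
    unfolding cmod_power2 by (simp add: power2_eq_square algebra_simps)
  moreover have "norm (1 - cnj a * z) \<noteq> 0" using one_minus_mult_cnj_nonzero(2)[OF a z] by simp
  ultimately show ?thesis by (simp add: blaschke_def norm_divide power_divide field_simps)
qed

lemma norm_blaschke_le_1:
  assumes a: "norm a < 1" and z: "norm z \<le> 1"
  shows "norm (blaschke a z) \<le> 1"
proof -
  have "0 \<le> (1 - (norm a)^2) * (1 - (norm z)^2) / (norm (1 - cnj a * z))^2"
    using a z by (intro divide_nonneg_nonneg mult_nonneg_nonneg) (auto simp: power_le_one)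
  then have "(norm (blaschke a z))^2 \<le> 1" unfolding norm_blaschke[OF a z] by simp
  then show ?thesis by (simp add: abs_square_le_1)
qed

lemma norm_blaschke_sphere:
  assumes a: "norm a < 1" and z: "norm z = 1"
  shows "norm (blaschke a z) = 1"
  using norm_blaschke[OF a, of z] z by (simp add: power2_eq_1_iff) (metis norm_ge_zero not_one_le_zero neg_0_le_iff_le order_trans zero_le_one)

lemma blaschke_eq_0_iff:
  assumes "norm a < 1" "norm z \<le> 1"
  shows "blaschke a z = 0 \<longleftrightarrow> z = a"
  using one_minus_mult_cnj_nonzero(2)[OF assms] by (simp add: blaschke_def)

text \<open>The difference quotient at the zero has a removable singularity; the factor
  \<open>1 - cnj a * z\<close> compensates the denominator of the Blaschke factor.\<close>

lemma blaschke_factor: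
  assumes g: "g holomorphic_on ball 0 1" and a: "norm a < 1" "g a = 0"
  shows "\<exists>h. h holomorphic_on ball 0 1 \<and> (\<forall>z. norm z < 1 \<longrightarrow> g z = blaschke a z * h z)"
proof -
  define h where "h = (\<lambda>z. (1 - cnj a * z) * (if z = a then deriv g a else (g z - g a) / (z - a)))"
  have "h holomorphic_on ball 0 1"
    unfolding h_def by (intro holomorphic_on_mult pole_lemma_open g holomorphic_intros) auto
  moreover have "g z = blaschke a z * h z" if "norm z < 1" for z
    using one_minus_mult_cnj_nonzero(2)[OF a(1), of z] that a(2) by (simp add: blaschke_def h_def)
  ultimately show ?thesis by blast
qed

text \<open>Zeros are divided out one at a time; as the points are distinct, the factors already
  removed do not vanish at the next one.\<close>

lemma blaschke_product_factor:
  assumes "finite J" "inj_on a J" "g holomorphic_on ball 0 1"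
    and "\<And>j. j \<in> J \<Longrightarrow> norm (a j) < 1" "\<And>j. j \<in> J \<Longrightarrow> g (a j) = 0"
  shows "\<exists>h. h holomorphic_on ball 0 1 \<and> (\<forall>z. norm z < 1 \<longrightarrow> g z = (\<Prod>j\<in>J. blaschke (a j) z) * h z)"
  using assms
proof (induction J)
  case empty
  then show ?case by (intro exI[of _ g]) simp
next
  case (insert i J)
  have "inj_on a J" using insert.prems(1) by (rule inj_on_subset) auto
  from insert.IH[OF this insert.prems(2)] insert.prems(3,4)
  obtain h where h: "h holomorphic_on ball 0 1" "\<forall>z. norm z < 1 \<longrightarrow> g z = (\<Prod>j\<in>J. blaschke (a j) z) * h z" by auto
  have ai: "norm (a i) < 1" "g (a i) = 0" using insert.prems(3,4) by auto
  have "blaschke (a j) (a i) \<noteq> 0" if "j \<in> J" for j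
  proof -
    have "a i \<noteq> a j" using insert.prems(1) insert.hyps(2) that by (auto simp: inj_on_def)
    then show ?thesis using blaschke_eq_0_iff[of "a j" "a i"] insert.prems(3)[of j] ai(1) that by simp
  qed
  then have "(\<Prod>j\<in>J. blaschke (a j) (a i)) \<noteq> 0" using insert.hyps(1) by simp
  then have "h (a i) = 0" using h(2)[rule_format, OF ai(1)] ai(2) by simp
  then obtain q where q: "q holomorphic_on ball 0 1" "\<forall>z. norm z < 1 \<longrightarrow> h z = blaschke (a i) z * q z"
    using blaschke_factor[OF h(1) ai(1)] by blast
  show ?case
  proof (intro exI[of _ q] conjI q allI impI)
    fix z :: complex assume "norm z < 1"
    then show "g z = (\<Prod>j\<in>insert i J. blaschke (a j) z) * q z"
      using h(2) q(2) insert.hyps by simp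
  qed
qed

lemma blaschke_product_norm_le_1:
  assumes "\<And>j. j \<in> J \<Longrightarrow> norm (a j) < 1" "norm z \<le> 1"
  shows "norm (\<Prod>j\<in>J. blaschke (a j) z) \<le> 1"
  unfolding prod_norm[symmetric] using norm_blaschke_le_1 assms by (intro prod_le_1) auto

text \<open>The product is continuous up to the circle, where its modulus is 1, so the compact set
  where the modulus is at most \<open>1 / 2\<close> stays away from the circle. Dividing by the
  product then costs at most a factor 2 near the boundary.\<close>

lemma blaschke_product_near_circle:
  assumes J: "\<And>j. j \<in> J \<Longrightarrow> norm (a j) < 1"
  shows "\<exists>r<1. \<forall>z. r < norm z \<longrightarrow> norm z \<le> 1 \<longrightarrow> 1 / 2 \<le> norm (\<Prod>j\<in>J. blaschke (a j) z)"
proof -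
  define B where "B = (\<lambda>z. \<Prod>j\<in>J. blaschke (a j) z)"
  have c: "continuous_on (cball 0 1) (\<lambda>z. norm (B z))"
    unfolding B_def by (intro continuous_intros blaschke_continuous J)
  define X where "X = cball 0 1 \<inter> (\<lambda>z. norm (B z)) -` {..1/2}"
  have "closed X" unfolding X_def by (intro continuous_closed_preimage c) auto
  moreover have "bounded X" by (rule bounded_subset[OF bounded_cball[of 0 1]]) (auto simp: X_def)
  ultimately have "compact X" by (simp add: compact_eq_bounded_closed)
  have X1: "norm z < 1" if "z \<in> X" for z
  proof (rule ccontr)
    assume "\<not> norm z < 1"
    then have "norm z = 1" using that by (simp add: X_def)
    then have "norm (B z) = 1" unfolding B_def prod_norm[symmetric] using norm_blaschke_sphere[OF J] by simp
    then show False using that by (simp add: X_def)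
  qed
  show ?thesis
  proof (cases "X = {}")
    case True
    then have "1 / 2 \<le> norm (B z)" if "norm z \<le> 1" for z using that by (force simp: X_def)
    then show ?thesis by (intro exI[of _ 0]) (simp add: B_def)
  next
    case False
    have "compact (norm ` X)" using \<open>compact X\<close> by (intro compact_continuous_image continuous_intros)
    then obtain x where x: "x \<in> X" "\<And>z. z \<in> X \<Longrightarrow> norm z \<le> norm x"
      using compact_attains_sup[of "norm ` X"] False by auto
    have "1 / 2 \<le> norm (B z)" if "norm x < norm z" "norm z \<le> 1" for z
      using x(2)[of z] that by (force simp: X_def)
    then show ?thesis using X1[OF x(1)] by (intro exI[of _ "norm x"]) (simp add: B_def)
  qed
qed

text \<open>Apply the open mapping constant to the finite Blaschke product vanishing at all \<open>z j\<close>,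
  \<open>j < L\<close>, except \<open>z k\<close>: a competitor of small norm with the same values is divisible by this
  product, and the quotient takes the value 1 at \<open>z k\<close>.\<close>

lemma closed_range_imp_separated:
  fixes z :: "nat \<Rightarrow> complex" and w :: "nat \<Rightarrow> real"
  assumes p: "0 < p" and inj: "inj z" and zb: "\<And>n. norm (z n) < 1" and w: "\<And>n. 0 < w n"
    and sm: "\<And>f A. Hp_le p A f \<Longrightarrow> summable (\<lambda>n. w n * norm (f (z n)) powr p)"
    and closed: "\<And>u x. (\<And>i::nat. \<exists>A. Hp_le p A (u i)) \<Longrightarrow> summable (\<lambda>n. w n * norm (x n) powr p) \<Longrightarrow>
      (\<lambda>i. \<Sum>n. w n * norm (u i (z n) - x n) powr p) \<longlonglongrightarrow> 0 \<Longrightarrow> \<exists>f A. Hp_le p A f \<and> (\<forall>n. f (z n) = x n)"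
  shows "\<exists>\<delta>>0. \<forall>N. \<forall>k<N. \<delta> \<le> norm (\<Prod>j\<in>{..<N} - {k}. blaschke (z j) (z k))"
proof -
  have "\<exists>C>0. \<forall>f A. Hp_le p A f \<longrightarrow>
    (\<exists>g. Hp_le p (C * (\<Sum>n. w n * norm (f (z n)) powr p)) g \<and> (\<forall>n. g (z n) = f (z n)))"
  proof (rule trace_open_mapping[OF p zb w])
    show "summable (\<lambda>n. w n * norm (f (z n)) powr p)" if "Hp_le p A f" for f A by (rule sm[OF that])
    show "\<exists>f A. Hp_le p A f \<and> (\<forall>n. f (z n) = x n)"
      if "\<And>i::nat. \<exists>A. Hp_le p A (u i)" "summable (\<lambda>n. w n * norm (x n) powr p)"
        "(\<lambda>i. \<Sum>n. w n * norm (u i (z n) - x n) powr p) \<longlonglongrightarrow> 0" for u x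
      by (rule closed) (rule that)+
  qed
  then obtain C where C: "0 < C" "\<And>f A. Hp_le p A f \<Longrightarrow>
    \<exists>g. Hp_le p (C * (\<Sum>n. w n * norm (f (z n)) powr p)) g \<and> (\<forall>n. g (z n) = f (z n))" by blast
  have "\<exists>C>0. \<forall>n. w n \<le> C * (1 - (norm (z n))^2)" by (rule weight_bound[OF p zb w]) (rule sm)
  then obtain D where D: "0 < D" "\<And>n. w n \<le> D * (1 - (norm (z n))^2)" by blast
  define B where "B = (\<lambda>k N \<zeta>. \<Prod>j\<in>{..<N} - {k}. blaschke (z j) \<zeta>)"
  have holB: "B k N holomorphic_on ball 0 1" for k N
    unfolding B_def by (intro holomorphic_intros blaschke_holomorphic zb)
  have B1: "norm (B k N \<zeta>) \<le> 1" if "norm \<zeta> \<le> 1" for k N \<zeta>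
    unfolding B_def by (rule blaschke_product_norm_le_1[OF zb that])
  have mass: "(LINT \<zeta>|circle_measure. 1) = (1::real)"
    by (simp add: measure_def prob_circle_measure)
  have HpB: "Hp_le p 1 (B k N)" for k N
    unfolding Hp_le_def
  proof (intro conjI allI impI holB)
    fix r :: real assume r: "0 < r" "r < 1"
    have "pmean p (B k N) r \<le> (LINT \<zeta>|circle_measure. 1)"
      unfolding pmean_def
    proof (rule integral_mono[OF integrable_hardy_mean[OF holB p r]])
      show "integrable circle_measure (\<lambda>\<zeta>. 1::real)" by (rule integrable_circle) simp
      fix \<zeta> assume "\<zeta> \<in> space circle_measure"
      then have "norm (of_real r * \<zeta>) \<le> 1" using r by (simp add: norm_mult)
      from B1[OF this, of k N] show "norm (B k N (of_real r * \<zeta>)) powr p \<le> 1"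
        using p powr_mono2[of p "norm (B k N (of_real r * \<zeta>))" 1] by simp
    qed
    then show "pmean p (B k N) r \<le> 1" by (simp only: mass)
  qed
  \<comment> \<open>The constant function shows that the weights are summable, so their tails tend
    to 0.\<close>
  have "Hp_le p 1 (\<lambda>_. 1)" using mass by (simp add: Hp_le_def pmean_def)
  from sm[OF this] have sw: "summable w" by simp
  \<comment> \<open>The product up to \<open>L\<close> vanishes at every \<open>z n\<close> with
    \<open>n < L\<close> except \<open>z k\<close>, and the points beyond contribute at most the
    tail of \<open>w\<close>. At \<open>z k\<close> it may be replaced by the shorter product up to
    \<open>N\<close>, since further factors only decrease the modulus.\<close>
  have main: "1 - (norm (z k))^2 \<le> 2 powr p * (C * (w k * norm (B k N (z k)) powr p + (\<Sum>n. w (n + L))))"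
    if k: "k < N" "N \<le> L" for k N L
  proof -
    obtain g where g: "Hp_le p (C * (\<Sum>n. w n * norm (B k L (z n)) powr p)) g" "\<And>n. g (z n) = B k L (z n)"
      using C(2)[OF HpB] by blast
    define A where "A = C * (\<Sum>n. w n * norm (B k L (z n)) powr p)"
    have Bz: "B k L (z n) = 0" if "n \<in> {..<L} - {k}" for n
      unfolding B_def using that zb by (intro prod_zero) (auto simp: blaschke_def)
    have Bk: "B k L (z k) \<noteq> 0"
    proof -
      have "blaschke (z j) (z k) \<noteq> 0" if "j \<in> {..<L} - {k}" for j
        using blaschke_eq_0_iff[OF zb, of "z k" j] zb[of k] that inj by (auto simp: inj_def less_imp_le)
      then show ?thesis unfolding B_def by simp
    qed
    have "\<exists>h. h holomorphic_on ball 0 1 \<and> (\<forall>\<zeta>. norm \<zeta> < 1 \<longrightarrow> g \<zeta> = B k L \<zeta> * h \<zeta>)"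
      unfolding B_def
      by (rule blaschke_product_factor) (use g Bz zb inj in \<open>auto simp: Hp_le_def intro: inj_on_subset\<close>)
    then obtain h where h: "h holomorphic_on ball 0 1" "\<And>\<zeta>. norm \<zeta> < 1 \<Longrightarrow> g \<zeta> = B k L \<zeta> * h \<zeta>" by blast
    have hk: "h (z k) = 1" using h(2)[OF zb[of k]] g(2)[of k] Bk by simp
    obtain r0 where r0: "r0 < 1" "\<And>\<zeta>. r0 < norm \<zeta> \<Longrightarrow> norm \<zeta> \<le> 1 \<Longrightarrow> 1 / 2 \<le> norm (B k L \<zeta>)"
      using blaschke_product_near_circle[of "{..<L} - {k}" z, OF zb] unfolding B_def by blast
    \<comment> \<open>The factor \<open>2 powr p\<close> comes from the lower bound
      \<open>1 / 2\<close> for the product near the circle.\<close>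
    have mean: "pmean p h r \<le> 2 powr p * A" if r: "r0 < r" "0 < r" "r < 1" for r
    proof -
      have holg: "g holomorphic_on ball 0 1" using g(1) by (simp add: Hp_le_def)
      have "pmean p h r \<le> (LINT \<zeta>|circle_measure. 2 powr p * norm (g (of_real r * \<zeta>)) powr p)"
        unfolding pmean_def
      proof (rule integral_mono[OF integrable_hardy_mean[OF h(1) p r(2,3)] integrable_mult_right[OF integrable_hardy_mean[OF holg p r(2,3)]]])
        fix \<zeta> assume "\<zeta> \<in> space circle_measure"
        then have nr: "norm (of_real r * \<zeta>) = r" using r by (simp add: norm_mult)
        have "1 / 2 \<le> norm (B k L (of_real r * \<zeta>))" using r0(2)[of "of_real r * \<zeta>"] r unfolding nr by simp
        then have "1 / 2 * norm (h (of_real r * \<zeta>)) \<le> norm (B k L (of_real r * \<zeta>)) * norm (h (of_real r * \<zeta>))"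
          by (rule mult_right_mono) simp
        also have "\<dots> = norm (g (of_real r * \<zeta>))"
          using h(2)[of "of_real r * \<zeta>"] r unfolding nr by (simp add: norm_mult)
        finally have "norm (h (of_real r * \<zeta>)) \<le> 2 * norm (g (of_real r * \<zeta>))" by simp
        then have "norm (h (of_real r * \<zeta>)) powr p \<le> (2 * norm (g (of_real r * \<zeta>))) powr p"
          using p by (intro powr_mono2) auto
        then show "norm (h (of_real r * \<zeta>)) powr p \<le> 2 powr p * norm (g (of_real r * \<zeta>)) powr p"
          by (simp add: powr_mult)
      qed
      also have "\<dots> = 2 powr p * pmean p g r" by (simp add: pmean_def)
      also have "\<dots> \<le> 2 powr p * A" using g(1) r unfolding Hp_le_def A_def by (intro mult_left_mono) auto
      finally show ?thesis .
    qed
    have "(1 - (norm (z k))^2) * norm (h (z k)) powr p \<le> 2 powr p * A"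
      by (rule point_evaluation_bound[OF h(1) p zb r0(1) mean])
    then have 1: "1 - (norm (z k))^2 \<le> 2 powr p * A" by (simp add: hk)
    have "(\<Sum>n. w n * norm (B k L (z n)) powr p) \<le> w k * norm (B k N (z k)) powr p + (\<Sum>n. w (n + L))"
    proof -
      note sB = sm[OF HpB, of k L]
      have "(\<Sum>n. w n * norm (B k L (z n)) powr p) = (\<Sum>n. w (n + L) * norm (B k L (z (n + L))) powr p) + (\<Sum>n<L. w n * norm (B k L (z n)) powr p)"
        by (rule suminf_split_initial_segment[OF sB])
      also have "(\<Sum>n<L. w n * norm (B k L (z n)) powr p) = (\<Sum>n<L. if n = k then w k * norm (B k L (z k)) powr p else 0)"
        using Bz p by (intro sum.cong) auto
      also have "\<dots> = w k * norm (B k L (z k)) powr p" using k by simp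
      also have "\<dots> \<le> w k * norm (B k N (z k)) powr p"
      proof (intro mult_left_mono powr_mono2)
        have eq: "{..<L} - {k} = ({..<N} - {k}) \<union> {N..<L}" using k by auto
        have split: "B k L (z k) = B k N (z k) * (\<Prod>j\<in>{N..<L}. blaschke (z j) (z k))"
          unfolding B_def eq by (rule prod.union_disjoint) auto
        have "norm (B k L (z k)) \<le> norm (B k N (z k)) * 1"
          unfolding split norm_mult
          using blaschke_product_norm_le_1[of "{N..<L}" z "z k", OF zb] zb[of k] by (intro mult_left_mono) auto
        then show "norm (B k L (z k)) \<le> norm (B k N (z k))" by simp
      qed (use p w[of k] in auto)
      also have "(\<Sum>n. w (n + L) * norm (B k L (z (n + L))) powr p) \<le> (\<Sum>n. w (n + L))"
      proof (rule suminf_le)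
        show "w (n + L) * norm (B k L (z (n + L))) powr p \<le> w (n + L)" for n
          using B1[of "z (n + L)" k L] zb[of "n + L"] p w[of "n + L"]
            powr_mono2[of p "norm (B k L (z (n + L)))" 1] by (simp add: mult_le_cancel_left1 less_imp_le)
        show "summable (\<lambda>n. w (n + L) * norm (B k L (z (n + L))) powr p)"
          using summable_iff_shift[of "\<lambda>n. w n * norm (B k L (z n)) powr p" L] sB by simp
        show "summable (\<lambda>n. w (n + L))" using sw by (simp add: summable_iff_shift)
      qed
      finally show ?thesis by simp
    qed
    then have "2 powr p * A \<le> 2 powr p * (C * (w k * norm (B k N (z k)) powr p + (\<Sum>n. w (n + L))))"
      unfolding A_def using C(1) by (intro mult_left_mono) auto
    with 1 show ?thesis by linarith
  qed
  \<comment> \<open>Letting \<open>L\<close> grow removes the tail; the upper bound \<open>D\<close>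
    for the weights then lets \<open>1 - |z k|^2\<close> cancel on both sides.\<close>
  have sep: "1 / (2 powr p * C * D) \<le> norm (B k N (z k)) powr p" if k: "k < N" for k N
  proof -
    define b where "b = norm (B k N (z k)) powr p"
    have "(\<lambda>L. \<Sum>n. w (n + L)) \<longlonglongrightarrow> 0" by (rule suminf_exist_split2[OF sw])
    then have "(\<lambda>L. 2 powr p * (C * (w k * b + (\<Sum>n. w (n + L))))) \<longlonglongrightarrow> 2 powr p * (C * (w k * b + 0))"
      by (intro tendsto_intros)
    then have "1 - (norm (z k))^2 \<le> 2 powr p * (C * (w k * b + 0))"
      by (rule LIMSEQ_le_const) (use main[OF k] in \<open>auto simp: b_def\<close>)
    also have "\<dots> = 2 powr p * C * (w k * b)" by simp
    also have "\<dots> \<le> 2 powr p * C * ((D * (1 - (norm (z k))^2)) * b)"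
      using C(1) D(2)[of k] by (intro mult_left_mono mult_right_mono) (auto simp: b_def)
    also have "\<dots> = (1 - (norm (z k))^2) * (2 powr p * C * D * b)" by simp
    finally have "1 \<le> 2 powr p * C * D * b"
      using zb[of k] by (simp add: mult_le_cancel_left1 abs_square_less_1)
    then show ?thesis using C(1) D(1) by (simp add: b_def field_simps)
  qed
  define \<delta> where "\<delta> = (1 / (2 powr p * C * D)) powr (1 / p)"
  have "0 < \<delta>" using C(1) D(1) by (simp add: \<delta>_def)
  moreover have "\<delta> \<le> norm (B k N (z k))" if "k < N" for k N
  proof -
    have "\<delta> \<le> (norm (B k N (z k)) powr p) powr (1 / p)"
      unfolding \<delta>_def using sep[OF that] C(1) D(1) p by (intro powr_mono2) auto
    then show ?thesis using p by (simp add: powr_powr)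
  qed
  ultimately show ?thesis unfolding B_def by blast
qed

subsection \<open>From uniform separation to interpolation\<close>

text \<open>In essence a lower Riemann sum for the integral of \<open>exp (- t)\<close>. Terms are
  added in order of decreasing \<open>\<phi>\<close>, so the new one has the full sum in its
  exponent and \<open>(1 + s) * exp (- s) \<le> 1\<close> closes the induction. Ties only enlarge
  the exponents of earlier terms.\<close>

lemma sum_exp_tail_le_1:
  fixes s \<phi> :: "'a \<Rightarrow> real"
  assumes "finite I" and s: "\<And>n. 0 \<le> s n"
  shows "(\<Sum>n\<in>I. s n * exp (- (\<Sum>k | k \<in> I \<and> \<phi> n \<le> \<phi> k. s k))) \<le> 1 - exp (- (\<Sum>k\<in>I. s k))"
  using assms(1)
proof (induction rule: finite_ranking_induct[where f="\<lambda>n. - \<phi> n"])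
  case (insert x S)
  show ?case
  proof (cases "x \<in> S")
    case True
    then show ?thesis using insert by (simp add: insert_absorb)
  next
    case False
    define \<sigma> where "\<sigma> = (\<Sum>k\<in>S. s k)"
    have x: "{k. k \<in> insert x S \<and> \<phi> x \<le> \<phi> k} = insert x S" using insert.hyps(2) by auto
    have "(\<Sum>n\<in>insert x S. s n * exp (- (\<Sum>k | k \<in> insert x S \<and> \<phi> n \<le> \<phi> k. s k)))
        = s x * exp (- (s x + \<sigma>)) + (\<Sum>n\<in>S. s n * exp (- (\<Sum>k | k \<in> insert x S \<and> \<phi> n \<le> \<phi> k. s k)))"
      unfolding sum.insert[OF insert.hyps(1) False] x by (simp add: \<sigma>_def)
    also have "\<dots> \<le> s x * exp (- (s x + \<sigma>)) + (\<Sum>n\<in>S. s n * exp (- (\<Sum>k | k \<in> S \<and> \<phi> n \<le> \<phi> k. s k)))"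
    proof (intro add_left_mono sum_mono mult_left_mono s)
      fix n assume "n \<in> S"
      have "(\<Sum>k | k \<in> S \<and> \<phi> n \<le> \<phi> k. s k) \<le> (\<Sum>k | k \<in> insert x S \<and> \<phi> n \<le> \<phi> k. s k)"
        using insert.hyps(1) s by (intro sum_mono2) auto
      then show "exp (- (\<Sum>k | k \<in> insert x S \<and> \<phi> n \<le> \<phi> k. s k)) \<le> exp (- (\<Sum>k | k \<in> S \<and> \<phi> n \<le> \<phi> k. s k))" by simp
    qed
    also have "\<dots> \<le> s x * exp (- (s x + \<sigma>)) + (1 - exp (- \<sigma>))"
      using insert.IH by (simp add: \<sigma>_def)
    also have "\<dots> \<le> 1 - exp (- (s x + \<sigma>))"
    proof -
      have "(1 + s x) * exp (- (s x + \<sigma>)) \<le> exp (s x) * exp (- (s x + \<sigma>))"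
        using exp_ge_add_one_self[of "s x"] by (intro mult_right_mono) auto
      also have "\<dots> = exp (- \<sigma>)" by (simp add: exp_add[symmetric])
      finally show ?thesis by (simp add: algebra_simps)
    qed
    finally show ?thesis using insert.hyps(1) False by (simp add: \<sigma>_def)
  qed
qed simp

lemma Re_Moebius:
  fixes v :: complex
  assumes "v \<noteq> 1"
  shows "Re ((1 + v) / (1 - v)) = (1 - (norm v)^2) / (norm (1 - v))^2"
proof -
  have "norm (1 - v) \<noteq> 0" using assms by simp
  then show ?thesis
    unfolding Re_divide' cmod_power2 by (simp add: power2_eq_square algebra_simps)
qed

text \<open>P. Jones' explicit interpolating functions for finitely many points.\<close>

lemma Jones_functions:
  fixes z :: "nat \<Rightarrow> complex"
  assumes zb: "\<And>n. norm (z n) < 1" and \<delta>: "0 < \<delta>"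
    and sep: "\<And>k. k < N \<Longrightarrow> \<delta> \<le> norm (\<Prod>j\<in>{..<N} - {k}. blaschke (z j) (z k))"
  shows "\<exists>F. (\<forall>k<N. F k holomorphic_on ball 0 1) \<and> (\<forall>\<zeta>. norm \<zeta> < 1 \<longrightarrow> (\<Sum>k<N. norm (F k \<zeta>)) \<le> exp 2 / \<delta> ^ 5)
    \<and> (\<forall>k<N. \<forall>l<N. F k (z l) = (if k = l then 1 else 0))"
proof -
  define W where "W = (\<lambda>k. 1 - (norm (z k))^2)"
  have W: "0 < W k" for k using zb[of k] by (simp add: W_def abs_square_less_1)
  have den: "1 - cnj (z k) * \<zeta> \<noteq> 0" if "norm \<zeta> < 1" for k \<zeta>
    by (rule one_minus_mult_cnj_nonzero(2)[OF zb]) (use that in simp)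
  define K where "K = (\<lambda>k \<zeta>. of_real (W k) / (1 - cnj (z k) * \<zeta>))"
  define u where "u = (\<lambda>k \<zeta>. of_real (W k) * ((1 + cnj (z k) * \<zeta>) / (1 - cnj (z k) * \<zeta>)))"
  \<comment> \<open>The points at least as far from the origin as \<open>z n\<close>; for these
    \<open>Re (u k (z n))\<close> is controlled by the Blaschke factor, see
    \<open>upper\<close>.\<close>
  define T where "T = (\<lambda>n. {k. k \<in> {..<N} \<and> norm (z n) \<le> norm (z k)})"
  define B where "B = (\<lambda>n \<zeta>. \<Prod>j\<in>{..<N} - {n}. blaschke (z j) \<zeta>)"
  \<comment> \<open>The Blaschke quotient places the zeros, the exponential makes the squared
    kernels summable through \<open>sum_exp_tail_le_1\<close>, and subtracting
    \<open>u k (z n)\<close> normalises the value at \<open>z n\<close> to 1.\<close>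
  define F where "F = (\<lambda>n \<zeta>. B n \<zeta> / B n (z n) * (K n \<zeta>)^2 * exp (- (\<Sum>k\<in>T n. u k \<zeta> - u k (z n))))"
  have Re_u: "Re (u k \<zeta>) = W k * ((1 - (norm (z k))^2 * (norm \<zeta>)^2) / (norm (1 - cnj (z k) * \<zeta>))^2)" if "norm \<zeta> < 1" for k \<zeta>
    unfolding u_def Re_of_real_times using Re_Moebius[of "cnj (z k) * \<zeta>"] den[OF that, of k] by (simp add: norm_mult power_mult_distrib)
  have norm_K: "(norm (K k \<zeta>))^2 = W k * (W k / (norm (1 - cnj (z k) * \<zeta>))^2)" for k \<zeta>
    unfolding K_def norm_divide norm_of_real power_divide power2_abs by (simp add: power2_eq_square)
  have lower: "(norm (K k \<zeta>))^2 \<le> Re (u k \<zeta>)" if "norm \<zeta> < 1" for k \<zeta>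
  proof -
    have "(norm (z k))^2 * (norm \<zeta>)^2 \<le> (norm (z k))^2 * 1"
      using that by (intro mult_left_mono) (auto simp: power_le_one)
    then have "W k \<le> 1 - (norm (z k))^2 * (norm \<zeta>)^2" by (simp add: W_def)
    then show ?thesis unfolding Re_u[OF that] norm_K
      using W[of k] by (intro mult_left_mono divide_right_mono) auto
  qed
  \<comment> \<open>From \<open>norm (z n) \<le> norm (z k)\<close> follows
    \<open>1 - |z k|^2 * |z n|^2 \<le> 1 - |z n|^4 \<le> 2 * W n\<close>.\<close>
  have upper: "Re (u k (z n)) \<le> 2 * (1 - (norm (blaschke (z k) (z n)))^2)" if "k \<in> T n" for k n
  proof -
    define x where "x = (norm (z n))^2"
    have x: "0 \<le> x" "x \<le> 1" using zb[of n] by (auto simp: x_def power_le_one)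
    have "x \<le> (norm (z k))^2" unfolding x_def using that by (intro power_mono) (auto simp: T_def)
    then have "x * x \<le> (norm (z k))^2 * x" using x by (intro mult_right_mono) auto
    moreover have "0 \<le> (1 - x) * (1 - x)" by simp
    ultimately have "1 - (norm (z k))^2 * (norm (z n))^2 \<le> 2 * W n"
      by (simp add: x_def[symmetric] W_def algebra_simps)
    then have "Re (u k (z n)) \<le> W k * ((2 * W n) / (norm (1 - cnj (z k) * z n))^2)"
      unfolding Re_u[OF zb] using W[of k] by (intro mult_left_mono divide_right_mono) auto
    also have "\<dots> = 2 * (1 - (norm (blaschke (z k) (z n)))^2)"
      using norm_blaschke[OF zb, of "z n" k] zb[of n] by (simp add: W_def)
    finally show ?thesis .
  qed
  \<comment> \<open>\<open>k = n\<close> accounts for the factor \<open>exp 2\<close>. For the other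
    indices \<open>x \<le> exp (x - 1)\<close> turns the lower bound \<open>\<delta>^2\<close> of
    the product of the \<open>x k\<close> into an upper bound of \<open>exp \<sigma>\<close>, which
    the factor 2 in \<open>upper\<close> squares.\<close>
  have exp_upper: "exp (\<Sum>k\<in>T n. Re (u k (z n))) \<le> exp 2 / \<delta> ^ 4" if n: "n < N" for n
  proof -
    define x where "x = (\<lambda>k. (norm (blaschke (z k) (z n)))^2)"
    have x1: "x k \<le> 1" for k using norm_blaschke_le_1[OF zb, of "z n" k] zb[of n] by (simp add: x_def power_le_one)
    have xn: "x n = 0" by (simp add: x_def blaschke_def)
    define \<sigma> where "\<sigma> = (\<Sum>k\<in>{..<N} - {n}. 1 - x k)"
    have "(\<Sum>k\<in>T n. Re (u k (z n))) \<le> (\<Sum>k\<in>T n. 2 * (1 - x k))"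
      unfolding x_def by (rule sum_mono) (rule upper)
    also have "\<dots> \<le> (\<Sum>k<N. 2 * (1 - x k))" using x1 by (intro sum_mono2) (auto simp: T_def)
    also have "\<dots> = 2 + 2 * \<sigma>"
      using sum.remove[of "{..<N}" n "\<lambda>k. 2 * (1 - x k)"] n xn by (simp add: \<sigma>_def sum_distrib_left)
    finally have "exp (\<Sum>k\<in>T n. Re (u k (z n))) \<le> exp (2 + 2 * \<sigma>)" by simp
    also have "\<dots> = exp 2 * (exp \<sigma>)^2" by (simp add: exp_add exp_double)
    also have "\<dots> \<le> exp 2 * (1 / \<delta>^2)^2"
    proof (intro mult_left_mono power_mono)
      have "\<delta>^2 \<le> (norm (\<Prod>j\<in>{..<N} - {n}. blaschke (z j) (z n)))^2"
        using sep[OF n] \<delta> by (intro power_mono) auto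
      also have "\<dots> = (\<Prod>j\<in>{..<N} - {n}. x j)" by (simp add: x_def prod_norm[symmetric] prod_power_distrib)
      also have "\<dots> \<le> (\<Prod>j\<in>{..<N} - {n}. exp (- (1 - x j)))"
      proof (rule prod_mono)
        fix j
        have "x j \<le> exp (- (1 - x j))" using exp_ge_add_one_self[of "x j - 1"] by simp
        then show "0 \<le> x j \<and> x j \<le> exp (- (1 - x j))" by (simp add: x_def)
      qed
      also have "\<dots> = exp (- \<sigma>)" by (simp add: exp_sum[symmetric] \<sigma>_def sum_negf[symmetric] del: minus_diff_eq)
      finally show "exp \<sigma> \<le> 1 / \<delta>^2" using \<delta> by (simp add: exp_minus field_simps)
    qed auto
    also have "\<dots> = exp 2 / \<delta> ^ 4" by (simp add: power_divide power_mult[symmetric])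
    finally show ?thesis .
  qed
  have Bn: "\<delta> \<le> norm (B n (z n))" if "n < N" for n using sep[OF that] by (simp add: B_def)
  \<comment> \<open>The fifth power collects \<open>1 / \<delta>\<close> from the division by
    \<open>B n (z n)\<close> and \<open>1 / \<delta> ^ 4\<close> from the exponential.\<close>
  have bound: "norm (F n \<zeta>) \<le> exp 2 / \<delta> ^ 5 * ((norm (K n \<zeta>))^2 * exp (- (\<Sum>k\<in>T n. (norm (K k \<zeta>))^2)))"
    if n: "n < N" and \<zeta>: "norm \<zeta> < 1" for n \<zeta>
  proof -
    have "norm (exp (- (\<Sum>k\<in>T n. u k \<zeta> - u k (z n)))) = exp (- (\<Sum>k\<in>T n. Re (u k \<zeta>))) * exp (\<Sum>k\<in>T n. Re (u k (z n)))"
      by (simp add: sum_subtractf exp_add[symmetric])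
    also have "\<dots> \<le> exp (- (\<Sum>k\<in>T n. (norm (K k \<zeta>))^2)) * (exp 2 / \<delta> ^ 4)"
      using lower[OF \<zeta>] by (intro mult_mono exp_upper[OF n]) (auto intro: sum_mono)
    finally have e: "norm (exp (- (\<Sum>k\<in>T n. u k \<zeta> - u k (z n)))) \<le> exp (- (\<Sum>k\<in>T n. (norm (K k \<zeta>))^2)) * (exp 2 / \<delta> ^ 4)" .
    have b: "norm (B n \<zeta> / B n (z n)) \<le> 1 / \<delta>"
      unfolding norm_divide using Bn[OF n] \<delta> blaschke_product_norm_le_1[OF zb, where z=\<zeta> and J="{..<N} - {n}"] \<zeta>
      by (intro frac_le) (auto simp: B_def)
    have "norm (F n \<zeta>) = norm (B n \<zeta> / B n (z n)) * (norm (K n \<zeta>))^2 * norm (exp (- (\<Sum>k\<in>T n. u k \<zeta> - u k (z n))))"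
      unfolding F_def norm_mult norm_power ..
    also have "\<dots> \<le> 1 / \<delta> * (norm (K n \<zeta>))^2 * (exp (- (\<Sum>k\<in>T n. (norm (K k \<zeta>))^2)) * (exp 2 / \<delta> ^ 4))"
      using \<delta> by (intro mult_mono b e order_refl) auto
    also have "\<dots> = exp 2 / \<delta> ^ 5 * ((norm (K n \<zeta>))^2 * exp (- (\<Sum>k\<in>T n. (norm (K k \<zeta>))^2)))"
      by (simp add: eval_nat_numeral)
    finally show ?thesis .
  qed
  show ?thesis
  proof (intro exI[of _ F] conjI allI impI)
    show "F n holomorphic_on ball 0 1" if "n < N" for n
    proof -
      have "B n (z n) \<noteq> 0" using Bn[OF that] \<delta> by auto
      then show ?thesis unfolding F_def B_def K_def u_def
        using den zb by (intro holomorphic_intros blaschke_holomorphic) auto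
    qed
    show "(\<Sum>n<N. norm (F n \<zeta>)) \<le> exp 2 / \<delta> ^ 5" if \<zeta>: "norm \<zeta> < 1" for \<zeta>
    proof -
      have "(\<Sum>n<N. norm (F n \<zeta>)) \<le> (\<Sum>n<N. exp 2 / \<delta> ^ 5 * ((norm (K n \<zeta>))^2 * exp (- (\<Sum>k\<in>T n. (norm (K k \<zeta>))^2))))"
        by (intro sum_mono bound \<zeta>) auto
      also have "\<dots> = exp 2 / \<delta> ^ 5 * (\<Sum>n<N. (norm (K n \<zeta>))^2 * exp (- (\<Sum>k\<in>T n. (norm (K k \<zeta>))^2)))"
        by (simp add: sum_distrib_left)
      also have "\<dots> \<le> exp 2 / \<delta> ^ 5 * 1"
      proof (rule mult_left_mono)
        have "(\<Sum>n<N. (norm (K n \<zeta>))^2 * exp (- (\<Sum>k\<in>T n. (norm (K k \<zeta>))^2))) \<le> 1 - exp (- (\<Sum>k<N. (norm (K k \<zeta>))^2))"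
          unfolding T_def by (rule sum_exp_tail_le_1) auto
        then show "(\<Sum>n<N. (norm (K n \<zeta>))^2 * exp (- (\<Sum>k\<in>T n. (norm (K k \<zeta>))^2))) \<le> 1"
          by (rule order_trans) simp
      qed (use \<delta> in simp)
      finally show ?thesis by simp
    qed
    fix k l assume kl: "k < N" "l < N"
    show "F k (z l) = (if k = l then 1 else 0)"
    proof (cases "k = l")
      case True
      have "of_real (W l) = 1 - cnj (z l) * z l"
        using complex_norm_square[of "z l"] by (simp add: W_def mult.commute)
      then have "K l (z l) = 1" using den[OF zb, of l] by (simp add: K_def)
      moreover have "B l (z l) \<noteq> 0" using Bn[OF kl(2)] \<delta> by auto
      ultimately show ?thesis using True by (simp add: F_def)
    next
      case False
      then have "B k (z l) = 0" unfolding B_def using kl by (intro prod_zero) (auto simp: blaschke_def)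
      then show ?thesis using False by (simp add: F_def)
    qed
  qed
qed

text \<open>The bound in \<open>Jones_functions\<close> is uniform in \<open>N\<close>, so the
  interpolants of finitely many values form a normal family and a limit takes all of them.\<close>

lemma separated_imp_interpolating:
  fixes z :: "nat \<Rightarrow> complex"
  assumes inj: "inj z" and zb: "\<And>n. norm (z n) < 1" and \<delta>: "0 < \<delta>"
    and sep: "\<And>N k. k < N \<Longrightarrow> \<delta> \<le> norm (\<Prod>j\<in>{..<N} - {k}. blaschke (z j) (z k))"
  shows "interpolating_sequence z"
proof -
  define M where "M = exp 2 / \<delta> ^ 5"
  have "\<forall>N. \<exists>F. (\<forall>k<N. F k holomorphic_on ball 0 1) \<and> (\<forall>\<zeta>. norm \<zeta> < 1 \<longrightarrow> (\<Sum>k<N. norm (F k \<zeta>)) \<le> M)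
    \<and> (\<forall>k<N. \<forall>l<N. F k (z l) = (if k = l then 1 else 0))"
    unfolding M_def by (intro allI Jones_functions zb \<delta> sep)
  from choice[OF this] obtain F where "\<forall>N. (\<forall>k<N. F N k holomorphic_on ball 0 1) \<and> (\<forall>\<zeta>. norm \<zeta> < 1 \<longrightarrow> (\<Sum>k<N. norm (F N k \<zeta>)) \<le> M)
    \<and> (\<forall>k<N. \<forall>l<N. F N k (z l) = (if k = l then 1 else 0))" ..
  then have F: "\<And>N k. k < N \<Longrightarrow> F N k holomorphic_on ball 0 1"
    "\<And>N \<zeta>. norm \<zeta> < 1 \<Longrightarrow> (\<Sum>k<N. norm (F N k \<zeta>)) \<le> M"
    "\<And>N k l. k < N \<Longrightarrow> l < N \<Longrightarrow> F N k (z l) = (if k = l then 1 else 0)" by simp_all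
  have surj: "\<exists>g\<in>Hardy_inf. \<forall>n. g (z n) = a n" if "bounded (range a)" for a :: "nat \<Rightarrow> complex"
  proof -
    obtain c where c: "\<And>n. norm (a n) \<le> c" using \<open>bounded (range a)\<close> unfolding bounded_iff by blast
    have c0: "0 \<le> c" using order_trans[OF norm_ge_zero c[of 0]] .
    define f where "f = (\<lambda>N \<zeta>. \<Sum>n<N. a n * F N n \<zeta>)"
    have hol: "f N holomorphic_on ball 0 1" for N unfolding f_def by (intro holomorphic_intros F(1)) simp
    have bd: "norm (f N \<zeta>) \<le> c * M" if "norm \<zeta> < 1" for N \<zeta>
    proof -
      have "norm (f N \<zeta>) \<le> (\<Sum>n<N. c * norm (F N n \<zeta>))"
        unfolding f_def by (rule order_trans[OF norm_sum]) (auto simp: norm_mult intro!: sum_mono mult_right_mono c)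
      also have "\<dots> \<le> c * M" unfolding sum_distrib_left[symmetric] by (intro mult_left_mono F(2) that c0)
      finally show ?thesis .
    qed
    obtain g t where g: "g holomorphic_on ball 0 1" "\<And>\<zeta>. norm \<zeta> < 1 \<Longrightarrow> norm (g \<zeta>) \<le> c * M"
      "strict_mono (t::nat \<Rightarrow> nat)" "\<And>\<zeta>. norm \<zeta> < 1 \<Longrightarrow> (\<lambda>i. f (t i) \<zeta>) \<longlonglongrightarrow> g \<zeta>"
      by (rule bounded_Montel[of f "c * M"]) (simp_all add: hol bd)
    have "g (z k) = a k" for k
    proof (rule LIMSEQ_unique[OF g(4)[OF zb]])
      have "f N (z k) = a k" if "k < N" for N
      proof -
        have "f N (z k) = (\<Sum>n<N. if n = k then a k else 0)"
          unfolding f_def using F(3)[OF _ that] by (intro sum.cong) auto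
        then show ?thesis using that by simp
      qed
      moreover have "\<forall>\<^sub>F i in sequentially. k < t i"
        by (rule eventually_compose_filterlim[OF eventually_gt_at_top filterlim_subseq[OF g(3)]])
      ultimately have "\<forall>\<^sub>F i in sequentially. f (t i) (z k) = a k" by (auto elim: eventually_mono)
      then show "(\<lambda>i. f (t i) (z k)) \<longlonglongrightarrow> a k" by (rule tendsto_eventually)
    qed
    moreover have "g \<in> Hardy_inf" using g(1,2) by (auto simp: Hardy_inf_def bounded_iff intro!: exI[of _ "c * M"])
    ultimately show ?thesis by blast
  qed
  have bounded: "bounded (range (\<lambda>n. f (z n)))" if f: "f \<in> Hardy_inf" for f
  proof (rule bounded_subset)
    show "bounded (f ` ball 0 1)" using f by (simp add: Hardy_inf_def)
    show "range (\<lambda>n. f (z n)) \<subseteq> f ` ball 0 1" using zb by auto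
  qed
  have "{\<lambda>n. f (z n) | f. f \<in> Hardy_inf} = {a. bounded (range a)}"
  proof (intro equalityI subsetI)
    fix a assume "a \<in> {a :: nat \<Rightarrow> complex. bounded (range a)}"
    then obtain g where g: "g \<in> Hardy_inf" "\<forall>n. g (z n) = a n" using surj by blast
    then have "a = (\<lambda>n. g (z n))" by simp
    then show "a \<in> {\<lambda>n. f (z n) | f. f \<in> Hardy_inf}" using g(1) by blast
  qed (use bounded in blast)
  moreover have "range z \<subseteq> ball 0 1" using zb by auto
  ultimately show ?thesis using inj unfolding interpolating_sequence_def by blast
qed

section \<open>From the measure to weighted sequences\<close>

lemma Hp_le_const_1: "Hp_le p 1 (\<lambda>_. 1)"
proof -
  have "measure circle_measure (sphere 0 1) = 1"
    by (simp add: measure_def prob_circle_measure)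
  then show ?thesis by (simp add: Hp_le_def pmean_def)
qed

text \<open>Brings the hypotheses into the form of \<open>closed_range_imp_separated\<close>: the
  measure becomes a sequence of weights, classes become sequences of values, and topological
  closedness becomes sequential closedness.\<close>

lemma closed_range_imp_interpolating:
  assumes p: "0 < p" and inj: "inj z" and zr: "range z \<subseteq> ball 0 1"
    and b: "borel_measure_on_disc \<mu>" and s: "supported_precisely_on \<mu> (range z)"
    and cl: "closedin (Lp_topology \<mu> p) (embedding p \<mu> ` Hardy p)"
  shows "interpolating_sequence z"
proof -
  have zball: "z n \<in> ball 0 1" for n using zr by blast
  then have zb: "norm (z n) < 1" for n by simp
  note AE = AE_supported[OF b s zr]
  \<comment> \<open>A closed set lies in the underlying space, so the class of \<open>f\<close> is
    that of some \<open>h\<close> in \<open>Lp_fun \<mu> p\<close>; then \<open>f\<close> agrees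
    with \<open>h\<close> almost everywhere and is integrable to the power \<open>p\<close> as
    well.\<close>
  have sub: "f \<in> Lp_fun \<mu> p" if "f \<in> Hardy p" for f
  proof -
    have "Lp_class \<mu> p f \<in> Lp_space \<mu> p"
      using closedin_subset[OF cl] \<open>f \<in> Hardy p\<close> by (auto simp: topspace_Lp_topology embedding_def)
    then obtain h where h: "h \<in> Lp_fun \<mu> p" "Lp_class \<mu> p f = Lp_class \<mu> p h" unfolding Lp_space_def by blast
    have "h \<in> Lp_class \<mu> p h" using h(1) by (simp add: Lp_class_def)
    then have "AE x in \<mu>. h x = f x" unfolding h(2)[symmetric] by (simp add: Lp_class_def)
    moreover have "f \<in> borel_measurable \<mu>"
      unfolding borel_disc_restrict(2)[OF b] using \<open>f \<in> Hardy p\<close> by (intro measurable_disc_holomorphic) (simp add: Hardy_def)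
    moreover have "h \<in> borel_measurable \<mu>" "integrable \<mu> (\<lambda>x. norm (h x) powr p)"
      using h(1) by (simp_all add: Lp_fun_def)
    moreover have "integrable \<mu> (\<lambda>x. norm (h x) powr p) \<longleftrightarrow> integrable \<mu> (\<lambda>x. norm (f x) powr p)"
      by (rule integrable_cong_AE) (use calculation in \<open>auto\<close>)
    ultimately show ?thesis by (simp add: Lp_fun_def)
  qed
  have fin: "finite_measure \<mu>"
  proof (rule finite_measureI)
    have "(\<lambda>_. 1) \<in> Lp_fun \<mu> p" using sub Hp_le_const_1 Hardy_iff[OF p] by blast
    then have "integrable \<mu> (\<lambda>_. 1::real)" by (simp add: Lp_fun_def)
    then show "emeasure \<mu> (space \<mu>) \<noteq> \<infinity>" by (simp add: integrable_iff_bounded less_top)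
  qed
  define w where "w = (\<lambda>n. measure \<mu> {z n})"
  have \<mu>: "\<mu> = atomic_measure z w"
    unfolding w_def by (rule supported_measure_eq_atomic[OF b s inj zr fin])
  have w: "0 < w n" for n
  proof -
    have "0 < emeasure \<mu> {z n}" using s unfolding supported_precisely_on_def by blast
    then show ?thesis by (simp add: w_def finite_measure.emeasure_eq_measure[OF fin])
  qed
  have w0: "0 \<le> w n" for n using w[of n] by simp
  have Lp: "f \<in> Lp_fun \<mu> p \<longleftrightarrow>
      f \<in> borel_measurable (restrict_space borel (ball 0 1)) \<and> summable (\<lambda>n. w n * norm (f (z n)) powr p)" for f
    unfolding \<mu> by (rule Lp_fun_atomic[OF zr w0])
  have Lp_norm: "Lp_norm \<mu> p f = (\<Sum>n. w n * norm (f (z n)) powr p) powr (1 / p)" if "f \<in> Lp_fun \<mu> p" for f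
    using that unfolding \<mu> by (rule Lp_norm_atomic[OF zr w0])
  have sm: "summable (\<lambda>n. w n * norm (f (z n)) powr p)" if "Hp_le p A f" for f A
    using sub[of f] that Hardy_iff[OF p] Lp by blast
  have closed: "\<exists>f A. Hp_le p A f \<and> (\<forall>n. f (z n) = x n)"
    if u: "\<And>i::nat. \<exists>A. Hp_le p A (u i)" and x: "summable (\<lambda>n. w n * norm (x n) powr p)"
      and lim: "(\<lambda>i. \<Sum>n. w n * norm (u i (z n) - x n) powr p) \<longlonglongrightarrow> 0" for u x
  proof -
    \<comment> \<open>A Borel extension of the sequence \<open>x\<close>: it differs from the zero
      function only on a countable set.\<close>
    define X where "X = (\<lambda>y. if y \<in> range z then x (the_inv z y) else 0)"
    have Xz: "X (z n) = x n" for n by (simp add: X_def the_inv_f_f[OF inj])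
    have "X \<in> borel_measurable \<mu>"
    proof (rule measurable_discrete_difference[where f="\<lambda>_. 0" and X="range z"])
      show "{y} \<in> sets \<mu>" if "y \<in> range z" for y
        by (rule countable_sets_disc[OF b]) (use that zr in auto)
    qed (auto simp: X_def)
    then have X: "X \<in> Lp_fun \<mu> p" using x by (simp add: Lp Xz borel_disc_restrict(2)[OF b])
    have ui: "u i \<in> Hardy p" for i using u Hardy_iff[OF p] by blast
    have uX: "(\<lambda>y. u i y - X y) \<in> Lp_fun \<mu> p" for i
    proof -
      have "summable (\<lambda>n. w n * norm (u i (z n) - x n) powr p)"
      proof (rule summable_comparison_test')
        show "summable (\<lambda>n. 2 powr p * (w n * norm (u i (z n)) powr p + w n * norm (x n) powr p))"
          using u[of i] sm by (intro summable_mult summable_add x) blast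
        fix n
        have "w n * norm (u i (z n) - x n) powr p \<le> w n * (2 powr p * (norm (u i (z n)) powr p + norm (x n) powr p))"
          by (intro mult_left_mono powr_norm_diff_le p w0)
        then show "norm (w n * norm (u i (z n) - x n) powr p) \<le> 2 powr p * (w n * norm (u i (z n)) powr p + w n * norm (x n) powr p)"
          using w0[of n] by (simp add: abs_mult algebra_simps)
      qed
      moreover have "u i \<in> borel_measurable \<mu>" "X \<in> borel_measurable \<mu>"
        using sub[OF ui] X by (simp_all add: Lp_fun_def)
      then have "(\<lambda>y. u i y - X y) \<in> borel_measurable \<mu>" by (rule borel_measurable_diff)
      ultimately show ?thesis by (simp add: Lp Xz borel_disc_restrict(2)[OF b])
    qed
    have norm_lim: "(\<lambda>i. Lp_norm \<mu> p (\<lambda>y. u i y - X y)) \<longlonglongrightarrow> 0"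
    proof -
      have sd: "summable (\<lambda>n. w n * norm (u i (z n) - x n) powr p)" for i
        using uX[of i] by (simp add: Lp Xz)
      have "Lp_norm \<mu> p (\<lambda>y. u i y - X y) = (\<Sum>n. w n * norm (u i (z n) - x n) powr p) powr (1 / p)" for i
        using Lp_norm[OF uX[of i]] by (simp add: Xz)
      moreover have "(\<lambda>i. (\<Sum>n. w n * norm (u i (z n) - x n) powr p) powr (1 / p)) \<longlonglongrightarrow> 0 powr (1 / p)"
        using p sd w0 by (intro tendsto_powr'[OF lim tendsto_const]) (auto intro!: always_eventually suminf_nonneg)
      ultimately show ?thesis by simp
    qed
    have small: "\<exists>i. Lp_norm \<mu> p (\<lambda>y. u i y - X y) < e" if "0 < e" for e
      using order_tendstoD(2)[OF norm_lim that] unfolding eventually_sequentially by blast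
    \<comment> \<open>Otherwise the open complement of the range would contain a ball around
      \<open>X\<close>, and some \<open>u i\<close> lies in that ball.\<close>
    have "Lp_class \<mu> p X \<in> embedding p \<mu> ` Hardy p"
    proof (rule ccontr)
      assume not_in: "\<not> ?thesis"
      have "Lp_open \<mu> p (Lp_space \<mu> p - embedding p \<mu> ` Hardy p)"
        using cl unfolding closedin_def openin_Lp_topology topspace_Lp_topology by blast
      moreover have "Lp_class \<mu> p X \<in> Lp_space \<mu> p - embedding p \<mu> ` Hardy p"
        using not_in X by (auto simp: Lp_space_def)
      ultimately obtain e where e: "0 < e"
        "\<forall>g\<in>Lp_fun \<mu> p. Lp_norm \<mu> p (\<lambda>y. g y - X y) < e \<longrightarrow> Lp_class \<mu> p g \<in> Lp_space \<mu> p - embedding p \<mu> ` Hardy p"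
        using X unfolding Lp_open_def by blast
      obtain i where "Lp_norm \<mu> p (\<lambda>y. u i y - X y) < e" using small[OF e(1)] by blast
      then have "Lp_class \<mu> p (u i) \<notin> embedding p \<mu> ` Hardy p" using e(2) sub[OF ui] by blast
      then show False using ui by (auto simp: embedding_def)
    qed
    then obtain f where f: "f \<in> Hardy p" "Lp_class \<mu> p X = Lp_class \<mu> p f" by (auto simp: embedding_def)
    have "X \<in> Lp_class \<mu> p X" using X by (simp add: Lp_class_def)
    then have "AE y in \<mu>. X y = f y" unfolding f(2) by (simp add: Lp_class_def)
    then have "f (z n) = x n" for n using AE[of "\<lambda>y. X y = f y"] Xz by simp
    then show ?thesis using f(1) Hardy_iff[OF p] by blast
  qed
  have "\<exists>\<delta>>0. \<forall>N. \<forall>k<N. \<delta> \<le> norm (\<Prod>j\<in>{..<N} - {k}. blaschke (z j) (z k))"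
  proof (rule closed_range_imp_separated[OF p inj zb w])
    show "summable (\<lambda>n. w n * norm (f (z n)) powr p)" if "Hp_le p A f" for f A by (rule sm[OF that])
    show "\<exists>f A. Hp_le p A f \<and> (\<forall>n. f (z n) = x n)"
      if "\<And>i::nat. \<exists>A. Hp_le p A (u i)" "summable (\<lambda>n. w n * norm (x n) powr p)"
        "(\<lambda>i. \<Sum>n. w n * norm (u i (z n) - x n) powr p) \<longlonglongrightarrow> 0" for u x
      by (rule closed) (rule that)+
  qed
  then obtain \<delta> where "0 < \<delta>" "\<And>N k. k < N \<Longrightarrow> \<delta> \<le> norm (\<Prod>j\<in>{..<N} - {k}. blaschke (z j) (z k))" by blast
  then show ?thesis by (rule separated_imp_interpolating[OF inj zb])
qed

theorem corollary1p2:
  fixes p :: real and z :: "nat \<Rightarrow> complex"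
  assumes "0 < p" and "inj z" and "range z \<subseteq> ball 0 1"
  shows "interpolating_sequence z \<longleftrightarrow>
    (\<exists>\<mu>. Carleson_measure \<mu> \<and> supported_precisely_on \<mu> (range z) \<and>
         closedin (Lp_topology \<mu> p) (embedding p \<mu> ` Hardy p))"
  using interpolating_imp_closed_range[OF assms(1)] closed_range_imp_interpolating[OF assms]
  unfolding Carleson_measure_def by blast

end
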